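(* Given $n\geqslant 3$, let $r_1,\dots,r_n\in\mathbb{R}$ be positive real numbers. Then there is a planar polynomial vector field $X$ of degree at most $n$ with a polycycle $\Gamma^n$ composed by $n$ distinct hyperbolic saddles $p_1,\dots,p_n$ such that $r_i$ is the hyperbolicity ratio of $p_i$, for every $i\in\{1,\dots,n\}$.
   Context: A graphic for a planar smooth vector field is a compact, non-empty invariant subset which is a continuous (not necessarily homeomorphic) image of $\mathbb{S}^1$ and consists of a finite number of isolated singularities $p_1,\dots,p_n$ and a compatible set of distinct regular orbits $L_1,\dots,L_n$ such that $p_i$ is the $\omega$-limit of $L_i$ (compatible: following the curve, each orbit $L_i$ joins two consecutive singularities). A polycycle is a graphic with a well-defined first return map on one of its sides. $\Gamma^n$ denotes a polycycle whose singularities $p_1,\dots,p_n$ are hyperbolic saddles and which has $n$ distinct regular orbits $L_1,\dots,L_n$. If $\lambda_i^s<0<\lambda_i^u$ are the eigenvalues of the hyperbolic saddle $p_i$, its hyperbolicity ratio is $|\lambda_i^s|/\lambda_i^u$. The degree of a planar polynomial vector field $(P,Q)$ is $\max\{\deg P,\deg Q\}$. *)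

theory Defs
  imports "HOL-Analysis.Analysis" "HOL-Computational_Algebra.Polynomial"
begin

text \<open>A bivariate polynomial is a \<open>real poly poly\<close>: the coefficient of \<open>x^i y^j\<close> in \<open>F\<close> is
  \<open>coeff (coeff F j) i\<close>.\<close>

definition eval2 :: "real poly poly \<Rightarrow> real \<times> real \<Rightarrow> real" where
  "eval2 F z = poly (poly F [:snd z:]) (fst z)"

text \<open>Total degree; the zero polynomial gets degree 0, as in the library.\<close>

definition total_degree :: "real poly poly \<Rightarrow> nat" where
  "total_degree F =
     Max ((\<lambda>j. if coeff F j = 0 then 0 else degree (coeff F j) + j) ` {..degree F})"

definition poly_vf :: "real poly poly \<Rightarrow> real poly poly \<Rightarrow> real \<times> real \<Rightarrow> real \<times> real" where
  "poly_vf P Q z = (eval2 P z, eval2 Q z)"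

definition vf_degree :: "real poly poly \<Rightarrow> real poly poly \<Rightarrow> nat" where
  "vf_degree P Q = max (total_degree P) (total_degree Q)"

type_synonym planar_vf = "real \<times> real \<Rightarrow> real \<times> real"

definition solution_on :: "planar_vf \<Rightarrow> real set \<Rightarrow> (real \<Rightarrow> real \<times> real) \<Rightarrow> bool" where
  "solution_on X I x \<longleftrightarrow> (\<forall>t\<in>I. (x has_vector_derivative X (x t)) (at t within I))"

text \<open>No completeness of the flow is assumed: a point lies on the orbit of \<open>q\<close> if some solution
  defined between times 0 and \<open>t\<close> leads from \<open>q\<close> to it (\<open>t\<close> may be negative).\<close>

definition orbit :: "planar_vf \<Rightarrow> real \<times> real \<Rightarrow> (real \<times> real) set" where
  "orbit X q = {y. \<exists>x t. solution_on X (closed_segment 0 t) x \<and> x 0 = q \<and> x t = y}"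

definition regular_orbit :: "planar_vf \<Rightarrow> (real \<times> real) set \<Rightarrow> bool" where
  "regular_orbit X L \<longleftrightarrow> (\<exists>q. X q \<noteq> 0 \<and> L = orbit X q)"

text \<open>Empty if the solution through \<open>q\<close> does not exist for all positive (negative) times.\<close>

definition omega_limit :: "planar_vf \<Rightarrow> real \<times> real \<Rightarrow> (real \<times> real) set" where
  "omega_limit X q = {y. \<exists>x \<tau>. solution_on X {0..} x \<and> x 0 = q \<and>
     filterlim \<tau> at_top sequentially \<and> (\<lambda>k. x (\<tau> k)) \<longlonglongrightarrow> y}"

definition alpha_limit :: "planar_vf \<Rightarrow> real \<times> real \<Rightarrow> (real \<times> real) set" where
  "alpha_limit X q = {y. \<exists>x \<tau>. solution_on X {..0} x \<and> x 0 = q \<and>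
     filterlim \<tau> at_bot sequentially \<and> (\<lambda>k. x (\<tau> k)) \<longlonglongrightarrow> y}"

text \<open>The singularities and orbits are indexed cyclically by \<open>{1..n}\<close>: the successor of \<open>i\<close> is
  \<open>Suc (i mod n)\<close>.  Compatibility means that \<open>L (i+1)\<close> runs from \<open>p i\<close> to \<open>p (i+1)\<close>.\<close>

definition graphic ::
  "planar_vf \<Rightarrow> nat \<Rightarrow> (real \<times> real) set \<Rightarrow> (nat \<Rightarrow> real \<times> real) \<Rightarrow> (nat \<Rightarrow> (real \<times> real) set) \<Rightarrow> bool"
where
  "graphic X n \<Gamma> p L \<longleftrightarrow>
     compact \<Gamma> \<and> \<Gamma> \<noteq> {} \<and> (\<forall>q\<in>\<Gamma>. orbit X q \<subseteq> \<Gamma>) \<and>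
     (\<exists>g. continuous_on (sphere (0::complex) 1) g \<and> g ` sphere 0 1 = \<Gamma>) \<and>
     \<Gamma> = p ` {1..n} \<union> (\<Union>i\<in>{1..n}. L i) \<and>
     (\<forall>i\<in>{1..n}. p i isolated_in {z. X z = 0}) \<and>
     (\<forall>i\<in>{1..n}. regular_orbit X (L i)) \<and> inj_on L {1..n} \<and>
     (\<forall>i\<in>{1..n}. \<forall>q\<in>L i. omega_limit X q = {p i}) \<and>
     (\<forall>i\<in>{1..n}. \<forall>q\<in>L (Suc (i mod n)). alpha_limit X q = {p i})"

definition transversal_to :: "planar_vf \<Rightarrow> real \<times> real \<Rightarrow> real \<times> real \<Rightarrow> bool" where
  "transversal_to X z v \<longleftrightarrow> fst (X z) * snd v - snd (X z) * fst v \<noteq> 0"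

text \<open>The solution \<open>x\<close> starting at \<open>z\<close> meets \<open>S\<close> for the first positive time at time \<open>T\<close>.\<close>

definition first_return ::
  "planar_vf \<Rightarrow> (real \<times> real) set \<Rightarrow> real \<times> real \<Rightarrow> real \<Rightarrow> (real \<Rightarrow> real \<times> real) \<Rightarrow> bool"
where
  "first_return X S z T x \<longleftrightarrow> 0 < T \<and> solution_on X {0..T} x \<and> x 0 = z \<and> x T \<in> S \<and>
     (\<forall>t. 0 < t \<and> t < T \<longrightarrow> x t \<notin> S)"

text \<open>A first return map along \<open>\<Gamma>\<close> on one of its sides: there is a transversal segment \<open>S\<close> issuing from
  a point \<open>q\<close> of \<open>\<Gamma>\<close>, otherwise disjoint from \<open>\<Gamma>\<close>, such that all points of \<open>S\<close> close to \<open>q\<close> return to \<open>S\<close>.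
  The last two conditions say that the orbit arcs up to the first return converge to \<open>\<Gamma>\<close> in the
  Hausdorff distance as the initial point tends to \<open>q\<close>; this rules out returns that do not follow
  \<open>\<Gamma>\<close> all the way around, and forces the return map to tend to \<open>q\<close>.\<close>

definition has_first_return_map :: "planar_vf \<Rightarrow> (real \<times> real) set \<Rightarrow> bool" where
  "has_first_return_map X \<Gamma> \<longleftrightarrow>
     (\<exists>q\<in>\<Gamma>. \<exists>v S. S = (\<lambda>s. q + s *\<^sub>R v) ` {0<..1} \<and>
        (\<forall>z\<in>insert q S. transversal_to X z v) \<and> S \<inter> \<Gamma> = {} \<and>
        (\<forall>\<epsilon>>0. \<forall>\<^sub>F s in at_right 0. \<exists>T x.
           first_return X S (q + s *\<^sub>R v) T x \<and>
           (\<forall>t\<in>{0..T}. infdist (x t) \<Gamma> < \<epsilon>) \<and>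
           (\<forall>y\<in>\<Gamma>. infdist y (x ` {0..T}) < \<epsilon>)))"

definition polycycle ::
  "planar_vf \<Rightarrow> nat \<Rightarrow> (real \<times> real) set \<Rightarrow> (nat \<Rightarrow> real \<times> real) \<Rightarrow> (nat \<Rightarrow> (real \<times> real) set) \<Rightarrow> bool"
where
  "polycycle X n \<Gamma> p L \<longleftrightarrow> graphic X n \<Gamma> p L \<and> has_first_return_map X \<Gamma>"

definition jacobian_eigenvalue :: "planar_vf \<Rightarrow> real \<times> real \<Rightarrow> real \<Rightarrow> bool" where
  "jacobian_eigenvalue X p l \<longleftrightarrow> (\<exists>v. v \<noteq> 0 \<and> frechet_derivative X (at p) v = l *\<^sub>R v)"

definition hyperbolic_saddle :: "planar_vf \<Rightarrow> real \<times> real \<Rightarrow> bool" where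
  "hyperbolic_saddle X p \<longleftrightarrow> X p = 0 \<and> X differentiable (at p) \<and>
     (\<exists>l<0. jacobian_eigenvalue X p l) \<and> (\<exists>l>0. jacobian_eigenvalue X p l)"

text \<open>Both descriptions are unique at a hyperbolic saddle, the phase space being two-dimensional.\<close>

definition hyperbolicity_ratio :: "planar_vf \<Rightarrow> real \<times> real \<Rightarrow> real" where
  "hyperbolicity_ratio X p =
     \<bar>THE l. l < 0 \<and> jacobian_eigenvalue X p l\<bar> / (THE l. l > 0 \<and> jacobian_eigenvalue X p l)"

end

theory Submission
  imports Defs
begin

text \<open>The polycycle is the boundary of a convex polygon with \<open>n\<close> vertices whose edges lie on invariant lines.  Let
\<open>l i\<close> be the affine function vanishing on the line through the \<open>i\<close>-th edge and positive inside, and let \<open>e i\<close> be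
the edge vector.  The field
\<open>X = (\<Sum>i<n. C i * (\<Prod>j\<noteq>i. l j) *\<^sub>R e i)\<close>
is tangent to every line, because on the line of edge \<open>i\<close> every summand but the \<open>i\<close>-th, which is parallel to \<open>e i\<close>,
vanishes.  With constant weights \<open>C i\<close> this is, up to a factor, Hamiltonian, and the hyperbolicity ratios of
the vertices multiply to 1.  With affine weights the degree is at most \<open>n\<close>, and there is enough freedom: at the vertex
between the edges \<open>i\<close> and \<open>i + 1\<close> the ratio is \<open>C i / C (i + 1)\<close>, and an affine function may be prescribed
at the two ends of its edge, namely as 1 at the start and as the ratio of the end vertex at the end.  The weight is then
positive along the edge, so that the open edge is a single orbit joining its two ends.

With \<open>det2 v w\<close> the determinant of two vectors, the dynamics is derived from the cofactor identity \<open>det2 (e i) (X z) = l i z * K i z\<close> with continuous \<open>K i\<close>,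
that is, \<open>l i\<close> evolves along orbits by \<open>l' = K * l\<close>; at a vertex the two cofactors are the eigenvalues, the
positive one belonging to the edge that ends there.  The locale \<open>polygon_field\<close> isolates these properties.

For the return map, a small transversal segment is placed at the midpoint of an edge.  An orbit that starts on it
near the edge follows the polygon: along a compact piece of an open edge by continuous dependence
on the initial value (\<open>tracks_edge\<close>), and past a vertex by comparing, in the coordinates \<open>(l i, l (i + 1))\<close>,
the growth of the first coordinate with the decay of the second (\<open>saddle_passage\<close>).  These two kinds of passages
compose (\<open>tracks_trans\<close>) to a full turn, which ends at the segment again
(\<open>polygon_first_return_map\<close>).

The solutions themselves come from Picard iteration, which solves the equation for a globally Lipschitz field; the
polynomial field is made globally Lipschitz by precomposing it with the projection onto a large disc, which does not
change it near the polygon.\<close>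

section \<open>Linear growth bounds and existence of solutions\<close>

text \<open>Gronwall's inequality in both directions: \<open>exp (2 M t) |d|\<^sup>2\<close> does not decrease and
\<open>exp (- 2 M t) |d|\<^sup>2\<close> does not increase, by the Cauchy--Schwarz inequality.  The upper bound gives uniqueness and continuous dependence; the lower
bound shows that a quantity that is not zero initially never becomes zero, which makes invariant lines uncrossable.\<close>
lemma exponential_growth_bounds:
  fixes d :: "real \<Rightarrow> 'a::real_inner"
  assumes der: "\<And>t. t \<in> {0..T} \<Longrightarrow> (d has_vector_derivative d' t) (at t within {0..T})"
    and bd: "\<And>t. t \<in> {0..T} \<Longrightarrow> norm (d' t) \<le> M * norm (d t)"
    and t: "t \<in> {0..T}"
  shows "exp (- M * t) * norm (d 0) \<le> norm (d t)" "norm (d t) \<le> exp (M * t) * norm (d 0)"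
proof -
  have cont: "continuous_on {0..T} d"
    using der has_vector_derivative_continuous continuous_on_eq_continuous_within by blast
  have der_sq: "((\<lambda>t. exp (c * t) * (d t \<bullet> d t)) has_real_derivative
        exp (c * s) * (c * (d s \<bullet> d s) + 2 * (d s \<bullet> d' s))) (at s)"
    if "0 < s" "s < t" for s c
  proof -
    have "(d has_vector_derivative d' s) (at s)"
      using der[of s] that t at_within_Icc_at[of 0 s T] by auto
    then have D: "(d has_derivative (\<lambda>h. h *\<^sub>R d' s)) (at s)"
      by (simp add: has_vector_derivative_def)
    have "((\<lambda>t. d t \<bullet> d t) has_derivative (\<lambda>h. d s \<bullet> (h *\<^sub>R d' s) + (h *\<^sub>R d' s) \<bullet> d s)) (at s)"
      by (rule has_derivative_inner[OF D D])
    then have "((\<lambda>t. d t \<bullet> d t) has_real_derivative 2 * (d s \<bullet> d' s)) (at s)"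
      unfolding has_field_derivative_def
      by (rule has_derivative_eq_rhs) (auto simp: fun_eq_iff inner_commute algebra_simps)
    then show ?thesis
      by (auto intro!: derivative_eq_intros simp: algebra_simps)
  qed
  have inner_bd: "\<bar>d s \<bullet> d' s\<bar> \<le> M * (d s \<bullet> d s)" if "0 < s" "s < t" for s
  proof -
    have "\<bar>d s \<bullet> d' s\<bar> \<le> norm (d s) * norm (d' s)"
      by (rule Cauchy_Schwarz_ineq2)
    also have "\<dots> \<le> norm (d s) * (M * norm (d s))"
      using bd[of s] that t by (intro mult_left_mono) auto
    finally show ?thesis by (simp add: dot_square_norm power2_eq_square algebra_simps)
  qed
  have contc: "continuous_on {0..t} (\<lambda>t. exp (c * t) * (d t \<bullet> d t))" for c
    using t by (intro continuous_intros continuous_on_subset[OF cont]) auto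
  have sq: "norm x ^ 2 = x \<bullet> x" for x :: 'a by (simp add: dot_square_norm)
  have "exp (2 * M * 0) * (d 0 \<bullet> d 0) \<le> exp (2 * M * t) * (d t \<bullet> d t)"
  proof (rule DERIV_nonneg_imp_increasing_open[OF _ _ contc])
    fix s assume s: "0 < s" "s < t"
    show "\<exists>y. ((\<lambda>t. exp (2 * M * t) * (d t \<bullet> d t)) has_real_derivative y) (at s) \<and> 0 \<le> y"
      using der_sq[OF s, of "2 * M"] inner_bd[OF s] by (intro exI conjI) (auto intro!: mult_nonneg_nonneg)
  qed (use t in auto)
  then have "(exp (- M * t) * norm (d 0)) ^ 2 \<le> (exp (- M * t) * exp (M * t) * norm (d t)) ^ 2"
    by (auto simp: power_mult_distrib sq exp_double[symmetric] algebra_simps)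
  then have "(exp (- M * t) * norm (d 0)) ^ 2 \<le> norm (d t) ^ 2"
    by (simp add: exp_minus)
  then show "exp (- M * t) * norm (d 0) \<le> norm (d t)"
    by (rule power2_le_imp_le) simp
  have "exp (- 2 * M * t) * (d t \<bullet> d t) \<le> exp (- 2 * M * 0) * (d 0 \<bullet> d 0)"
  proof (rule DERIV_nonpos_imp_decreasing_open[OF _ _ contc])
    fix s assume s: "0 < s" "s < t"
    show "\<exists>y. ((\<lambda>t. exp (- 2 * M * t) * (d t \<bullet> d t)) has_real_derivative y) (at s) \<and> y \<le> 0"
      using der_sq[OF s, of "- 2 * M"] inner_bd[OF s] by (intro exI conjI) (auto intro!: mult_nonneg_nonpos)
  qed (use t in auto)
  then have "(exp (- M * t) * norm (d t)) ^ 2 \<le> norm (d 0) ^ 2"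
    by (simp add: power_mult_distrib sq exp_double[symmetric] algebra_simps)
  then have "exp (- M * t) * norm (d t) \<le> norm (d 0)"
    by (rule power2_le_imp_le) simp
  then show "norm (d t) \<le> exp (M * t) * norm (d 0)"
    by (simp add: exp_minus field_simps)
qed

text \<open>The Picard iterates on \<open>[0, \<infinity>)\<close> converge for all times at once, since the distance of consecutive iterates is
bounded by \<open>2\<^sup>-\<^sup>k\<close> times a multiple of the weight \<open>exp (2 l t)\<close>.\<close>
lemma ode_solution_exists:
  fixes f :: "'a::euclidean_space \<Rightarrow> 'a"
  assumes lip: "L-lipschitz_on UNIV f"
  shows "\<exists>x. x 0 = z \<and> (\<forall>t\<ge>0. (x has_vector_derivative f (x t)) (at t within {0..}))"
proof -
  \<comment> \<open>The Lipschitz constant is enlarged so that it can be divided by.\<close>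
  define l where "l = L + 1"
  have l: "l > 0" using lipschitz_on_nonneg[OF lip] by (simp add: l_def)
  have lip': "norm (f x - f y) \<le> l * norm (x - y)" for x y
    using lipschitz_onD[OF lip, of x y] lipschitz_on_nonneg[OF lip]
    by (auto simp: dist_norm l_def distrib_right intro: add_increasing2)
  have contf: "continuous_on S f" for S
    using lipschitz_on_continuous_on[OF lip] continuous_on_subset by blast
  define x :: "nat \<Rightarrow> real \<Rightarrow> 'a"
    where "x = rec_nat (\<lambda>t. z) (\<lambda>_ y t. z + integral {0..t} (\<lambda>s. f (y s)))"
  have x0: "x 0 t = z" and xS: "x (Suc k) t = z + integral {0..t} (\<lambda>s. f (x k s))" for k t
    by (simp_all add: x_def)
  have contx: "continuous_on {0..T} (x k)" for k T
  proof (induction k arbitrary: T)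
    case 0
    have "x 0 = (\<lambda>t. z)" using x0 by auto
    then show ?case by simp
  next
    case (Suc k)
    have "(\<lambda>s. f (x k s)) integrable_on {0..T}"
      by (intro integrable_continuous_interval continuous_on_compose2[OF contf[of UNIV] Suc]) auto
    then have "continuous_on {0..T} (\<lambda>t. z + integral {0..t} (\<lambda>s. f (x k s)))"
      by (intro continuous_intros indefinite_integral_continuous_1)
    moreover have "x (Suc k) = (\<lambda>t. z + integral {0..t} (\<lambda>s. f (x k s)))" using xS by auto
    ultimately show ?case by simp
  qed
  have contfx: "continuous_on {0..T} (\<lambda>s. f (x k s))" for k T
    by (intro continuous_on_compose2[OF contf[of UNIV] contx]) auto
  have int: "(\<lambda>s. f (x k s)) integrable_on {0..T}" for k T
    by (intro integrable_continuous_interval contfx)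
  \<comment> \<open>The integral of \<open>l * exp (2 * l * t)\<close> is half of \<open>exp (2 * l * t)\<close>, hence each step halves the bound.\<close>
  define M where "M = norm (f z) / (2 * l)"
  have M: "M \<ge> 0" using l by (simp add: M_def)
  have step: "norm (x (Suc k) t - x k t) \<le> M * (1/2)^k * exp (2 * l * t)" if "t \<ge> 0" for k t
    using that
  proof (induction k arbitrary: t)
    case 0
    have "norm (x (Suc 0) t - x 0 t) = t * norm (f z)"
      using 0 by (simp add: xS x0)
    also have "\<dots> = M * (2 * l * t)" using l by (simp add: M_def)
    also have "\<dots> \<le> M * exp (2 * l * t)"
      using M exp_ge_add_one_self[of "2 * l * t"] by (intro mult_left_mono) linarith+
    finally show ?case by simp
  next
    case (Suc k)
    have E: "((\<lambda>s. l * (M * (1/2)^k * exp (2 * l * s))) has_integral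
        M * (1/2)^Suc k * exp (2 * l * t) - M * (1/2)^Suc k * exp (2 * l * 0)) {0..t}"
      using l Suc.prems
      by (intro fundamental_theorem_of_calculus)
         (auto intro!: derivative_eq_intros simp flip: has_real_derivative_iff_has_vector_derivative)
    have "x (Suc (Suc k)) t - x (Suc k) t
        = integral {0..t} (\<lambda>s. f (x (Suc k) s) - f (x k s))"
      by (subst Henstock_Kurzweil_Integration.integral_diff[OF int int]) (simp add: xS[of "Suc k"] xS[of k t])
    also have "norm \<dots> \<le> integral {0..t} (\<lambda>s. l * (M * (1/2)^k * exp (2 * l * s)))"
    proof (rule integral_norm_bound_integral)
      fix s assume "s \<in> {0..t}"
      then show "norm (f (x (Suc k) s) - f (x k s)) \<le> l * (M * (1/2)^k * exp (2 * l * s))"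
        using lip'[of "x (Suc k) s" "x k s"] Suc.IH[of s] l
        by (meson atLeastAtMost_iff mult_left_mono order.strict_implies_order order_trans)
    qed (use int E in \<open>auto intro!: Henstock_Kurzweil_Integration.integrable_diff\<close>)
    also have "\<dots> \<le> M * (1/2)^Suc k * exp (2 * l * t)"
      unfolding integral_unique[OF E] using M by simp
    finally show ?case .
  qed
  define y where "y = (\<lambda>t. z + (\<Sum>k. x (Suc k) t - x k t))"
  have tele: "(\<Sum>i<k. x (Suc i) t - x i t) = x k t - z" for k t
    by (simp add: sum_lessThan_telescope[of "\<lambda>k. x k t"] x0)
  have lim: "uniform_limit {0..T} x y sequentially" for T
  proof -
    have "uniform_limit {0..T} (\<lambda>k t. \<Sum>i<k. x (Suc i) t - x i t) (\<lambda>t. \<Sum>k. x (Suc k) t - x k t) sequentially"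
    proof (rule Weierstrass_m_test)
      fix k t assume t: "t \<in> {0..T}"
      have "norm (x (Suc k) t - x k t) \<le> M * (1/2)^k * exp (2 * l * t)"
        using step t by auto
      also have "\<dots> \<le> M * (1/2)^k * exp (2 * l * T)"
        using M l t by (intro mult_left_mono) auto
      finally show "norm (x (Suc k) t - x k t) \<le> M * (1/2)^k * exp (2 * l * T)" .
    next
      show "summable (\<lambda>k. M * (1/2)^k * exp (2 * l * T))"
        by (intro summable_mult summable_mult2 summable_geometric) auto
    qed
    then have "uniform_limit {0..T} (\<lambda>k t. z + (\<Sum>i<k. x (Suc i) t - x i t)) y sequentially"
      unfolding y_def by (rule uniform_limit_add[OF uniform_limit_const])
    then show ?thesis by (simp add: tele)
  qed
  have conty: "continuous_on {0..T} y" for T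
    by (rule uniform_limit_theorem[OF _ lim]) (auto simp: contx)
  have limf: "uniform_limit {0..T} (\<lambda>k s. f (x k s)) (\<lambda>s. f (y s)) sequentially" for T
    by (rule uniform_limit_compose_uniformly_continuous_on[OF lim lipschitz_on_uniformly_continuous[OF lip]]) auto
  have y_eq: "y t = z + integral {0..t} (\<lambda>s. f (y s))" if t: "t \<ge> 0" for t
  proof -
    obtain I J where I: "\<And>k. ((\<lambda>s. f (x k s)) has_integral I k) {0..t}"
      and J: "((\<lambda>s. f (y s)) has_integral J) {0..t}" and IJ: "I \<longlonglongrightarrow> J"
      using uniform_limit_integral[OF limf contfx] by (metis sequentially_bot)
    have "(\<lambda>k. x (Suc k) t) \<longlonglongrightarrow> y t"
      by (rule LIMSEQ_Suc) (rule tendsto_uniform_limitI[OF lim[of t]], use t in auto)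
    moreover have "(\<lambda>k. x (Suc k) t) \<longlonglongrightarrow> z + J"
      using IJ by (auto simp: xS integral_unique[OF I] intro!: tendsto_intros)
    ultimately show ?thesis
      using J by (auto simp: integral_unique dest: LIMSEQ_unique)
  qed
  have "(y has_vector_derivative f (y t)) (at t within {0..})" if t: "t \<ge> 0" for t
  proof -
    have "continuous_on {0..t+1} (\<lambda>s. f (y s))"
      by (intro continuous_on_compose2[OF contf[of UNIV] conty]) auto
    then have "((\<lambda>u. integral {0..u} (\<lambda>s. f (y s))) has_vector_derivative f (y t)) (at t within {0..t+1})"
      using t by (intro integral_has_vector_derivative) auto
    then have "((\<lambda>u. z + integral {0..u} (\<lambda>s. f (y s))) has_vector_derivative f (y t)) (at t within {0..t+1})"
      by (auto intro!: derivative_eq_intros)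
    then have "(y has_vector_derivative f (y t)) (at t within {0..t+1})"
      by (rule has_vector_derivative_transform[rotated -1]) (use t y_eq in auto)
    moreover have "at t within {0..t+1} = at t within {0..}"
      by (rule at_within_nhd[of _ "{t-1<..<t+1}"]) auto
    ultimately show ?thesis by simp
  qed
  moreover have "y 0 = z" using y_eq[of 0] by simp
  ultimately show ?thesis by blast
qed

text \<open>Polynomial fields are in general not globally Lipschitz, but they have this property; as the trace of a solution over a
compact time interval is bounded, it suffices for uniqueness.\<close>
definition lipschitz_on_balls :: "('a::real_normed_vector \<Rightarrow> 'b::metric_space) \<Rightarrow> bool" where
  "lipschitz_on_balls f \<longleftrightarrow> (\<forall>R. \<exists>L. L-lipschitz_on (cball 0 R) f)"

lemma lipschitz_on_balls_minus:
  "lipschitz_on_balls X \<Longrightarrow> lipschitz_on_balls (\<lambda>z. - X z :: 'b::real_normed_vector)"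
  unfolding lipschitz_on_balls_def by simp

lemma ode_difference_bounds:
  fixes f :: "'a::real_inner \<Rightarrow> 'a"
  assumes lip: "L-lipschitz_on S f"
    and x: "\<And>t. t \<in> {0..T} \<Longrightarrow> (x has_vector_derivative f (x t)) (at t within {0..T})"
    and y: "\<And>t. t \<in> {0..T} \<Longrightarrow> (y has_vector_derivative f (y t)) (at t within {0..T})"
    and S: "x ` {0..T} \<subseteq> S" "y ` {0..T} \<subseteq> S"
    and t: "t \<in> {0..T}"
  shows "exp (- L * t) * dist (x 0) (y 0) \<le> dist (x t) (y t)"
    and "dist (x t) (y t) \<le> exp (L * t) * dist (x 0) (y 0)"
proof -
  have "((\<lambda>t. x t - y t) has_vector_derivative f (x s) - f (y s)) (at s within {0..T})"
    if "s \<in> {0..T}" for s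
    using x y that by (auto intro!: derivative_eq_intros)
  moreover have "norm (f (x s) - f (y s)) \<le> L * norm (x s - y s)" if "s \<in> {0..T}" for s
    using lipschitz_onD[OF lip, of "x s" "y s"] S that unfolding dist_norm by blast
  ultimately show "exp (- L * t) * dist (x 0) (y 0) \<le> dist (x t) (y t)"
    "dist (x t) (y t) \<le> exp (L * t) * dist (x 0) (y 0)"
    using exponential_growth_bounds[of T "\<lambda>t. x t - y t" "\<lambda>s. f (x s) - f (y s)" L t] t
    by (auto simp: dist_norm)
qed

lemma ode_solution_unique:
  fixes f :: "'a::real_inner \<Rightarrow> 'a"
  assumes lip: "lipschitz_on_balls f"
    and x: "\<And>t. t \<in> {0..T} \<Longrightarrow> (x has_vector_derivative f (x t)) (at t within {0..T})"
    and y: "\<And>t. t \<in> {0..T} \<Longrightarrow> (y has_vector_derivative f (y t)) (at t within {0..T})"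
    and eq: "x 0 = y 0" and t: "t \<in> {0..T}"
  shows "x t = y t"
proof -
  have "continuous_on {0..T} x" "continuous_on {0..T} y"
    using x y has_vector_derivative_continuous continuous_on_eq_continuous_within by blast+
  then have "bounded (x ` {0..T} \<union> y ` {0..T})"
    by (auto intro!: compact_imp_bounded compact_continuous_image)
  then obtain R where "x ` {0..T} \<union> y ` {0..T} \<subseteq> cball 0 R"
    unfolding bounded_iff subset_iff mem_cball_0 by blast
  moreover obtain L where "L-lipschitz_on (cball 0 R) f"
    using lip by (auto simp: lipschitz_on_balls_def)
  ultimately show ?thesis
    using ode_difference_bounds(2)[of L "cball 0 R" f T x y t] x y t eq by auto
qed

section \<open>Orbits along an invariant edge\<close>

text \<open>A heteroclinic connection of a scalar equation.  Continuing \<open>g\<close> constantly outside the unit interval makes it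
globally Lipschitz without changing the solution, which increases and, by the lower growth bound for the distance to the
equilibrium 1, stays below 1.  It comes arbitrarily close to 1 because \<open>g\<close> is bounded below by a positive constant on
every \<open>[s, c]\<close> with \<open>c < 1\<close>.\<close>
lemma scalar_connection:
  fixes g :: "real \<Rightarrow> real"
  assumes lip: "L-lipschitz_on {0..1} g" and g0: "g 0 = 0" and g1: "g 1 = 0"
    and pos: "\<And>u. 0 < u \<Longrightarrow> u < 1 \<Longrightarrow> 0 < g u" and s: "0 < s" "s < 1"
  obtains x where "x 0 = s"
    "\<And>t. t \<ge> 0 \<Longrightarrow> (x has_vector_derivative g (x t)) (at t within {0..})"
    "\<And>t. t \<ge> 0 \<Longrightarrow> s \<le> x t \<and> x t < 1"
    "\<And>c. s \<le> c \<Longrightarrow> c < 1 \<Longrightarrow> \<exists>T\<ge>0. x T = c \<and> x ` {0..T} = {s..c}"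
    "(x \<longlongrightarrow> 1) at_top"
proof -
  define h where "h = (\<lambda>u. g (max 0 (min 1 u)))"
  have hlip: "L-lipschitz_on UNIV h"
  proof (rule lipschitz_onI)
    fix u v :: real
    have "dist (h u) (h v) \<le> L * dist (max 0 (min 1 u)) (max 0 (min 1 v))"
      unfolding h_def by (rule lipschitz_onD[OF lip]) auto
    also have "\<dots> \<le> L * dist u v"
      by (rule mult_left_mono[OF _ lipschitz_on_nonneg[OF lip]]) (auto simp: dist_real_def)
    finally show "dist (h u) (h v) \<le> L * dist u v" .
  qed (rule lipschitz_on_nonneg[OF lip])
  have h_nonneg: "h u \<ge> 0" for u
    using pos[of u] g0 g1 by (cases "u \<le> 0"; cases "u \<ge> 1") (auto simp: h_def)
  obtain x where x0: "x 0 = s"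
    and x: "\<And>t. t \<ge> 0 \<Longrightarrow> (x has_vector_derivative h (x t)) (at t within {0..})"
    using ode_solution_exists[OF hlip] by blast
  have xT: "(x has_vector_derivative h (x t)) (at t within {0..T})" if "t \<in> {0..T}" for t T
    by (rule has_vector_derivative_within_subset[OF x]) (use that in auto)
  have xD: "(x has_real_derivative h (x t)) (at t)" if "t > 0" for t
  proof -
    have "at t within {0..} = at t" using that by (intro at_within_interior) auto
    then show ?thesis
      using x[of t] that by (simp add: has_real_derivative_iff_has_vector_derivative)
  qed
  have contx: "continuous_on A x" if "A \<subseteq> {0..}" for A
  proof -
    have "continuous_on {0..} x"
      unfolding continuous_on_eq_continuous_within
      by (intro ballI has_vector_derivative_continuous[OF x]) simp
    then show ?thesis using that by (rule continuous_on_subset)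
  qed
  have mono: "x t \<le> x t'" if "0 \<le> t" "t \<le> t'" for t t'
  proof (rule DERIV_nonneg_imp_increasing_open[OF that(2)])
    fix u assume "t < u" "u < t'"
    then show "\<exists>y. (x has_real_derivative y) (at u) \<and> 0 \<le> y"
      using xD[of u] h_nonneg that by (intro exI[of _ "h (x u)"]) auto
  qed (use that in \<open>auto intro!: contx\<close>)
  have ne1: "x t \<noteq> 1" if "t \<ge> 0" for t
  proof -
    have "exp (- L * t) * dist (x 0) 1 \<le> dist (x t) 1"
      by (rule ode_difference_bounds(1)[OF hlip, of t x "\<lambda>_. 1" t])
         (use xT that g1 in \<open>auto simp: h_def\<close>)
    then show ?thesis using s x0 by (auto simp: dist_real_def mult_le_0_iff)
  qed
  have lt1: "x t < 1" if t: "t \<ge> 0" for t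
  proof (rule ccontr)
    assume "\<not> x t < 1"
    then obtain u where "0 \<le> u" "u \<le> t" "x u = 1"
      using IVT'[of x 0 1 t] t x0 s contx[of "{0..t}"] by auto
    then show False using ne1 by blast
  qed
  have ge: "s \<le> x t" if "t \<ge> 0" for t using mono[of 0 t] x0 that by simp
  have hg: "h (x t) = g (x t)" if "t \<ge> 0" for t
    using ge[OF that] lt1[OF that] s by (simp add: h_def)
  have attain: "\<exists>T\<ge>0. x T = c \<and> x ` {0..T} = {s..c}" if c: "s \<le> c" "c < 1" for c
  proof -
    have "\<exists>t\<ge>0. x t \<ge> c"
    proof (rule ccontr)
      assume "\<not> ?thesis"
      then have lt: "x t < c" if "t \<ge> 0" for t using that by force
      have "continuous_on {s..c} g"
        using lipschitz_on_continuous_on[OF lip] s c by (rule_tac continuous_on_subset) auto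
      then obtain m where m: "m \<in> {s..c}" and mle: "\<And>u. u \<in> {s..c} \<Longrightarrow> g m \<le> g u"
        using continuous_attains_inf[of "{s..c}" g] c by auto
      have gm: "g m > 0" using pos[of m] m s c by auto
      define t where "t = (c - s) / g m"
      have t: "t \<ge> 0" using gm c by (simp add: t_def)
      have "x 0 - g m * 0 \<le> x t - g m * t"
      proof (rule DERIV_nonneg_imp_increasing_open[OF t, of "\<lambda>t. x t - g m * t"])
        fix u assume u: "0 < u" "u < t"
        have "g m \<le> h (x u)" using mle[of "x u"] hg[of u] ge[of u] lt[of u] u by auto
        then show "\<exists>y. ((\<lambda>t. x t - g m * t) has_real_derivative y) (at u) \<and> 0 \<le> y"
          using xD[of u] u by (intro exI[of _ "h (x u) - g m"]) (auto intro!: derivative_eq_intros)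
      qed (auto intro!: continuous_intros contx)
      then show False using lt[OF t] x0 gm by (simp add: t_def)
    qed
    then obtain t where "t \<ge> 0" "x t \<ge> c" by blast
    then obtain T where T: "0 \<le> T" "x T = c"
      using IVT'[of x 0 c t] x0 c contx[of "{0..t}"] by auto
    moreover have "x ` {0..T} = {s..c}"
    proof (intro equalityI subsetI)
      fix u assume "u \<in> {s..c}"
      then show "u \<in> x ` {0..T}"
        using IVT'[of x 0 u T] x0 T contx[of "{0..T}"] by (auto simp: image_iff)
    qed (use T ge mono in auto)
    ultimately show ?thesis by blast
  qed
  have lim: "(x \<longlongrightarrow> 1) at_top"
  proof (rule order_tendstoI)
    fix a :: real assume a: "a < 1"
    obtain T where T: "T \<ge> 0" "x T = max s ((a + 1) / 2)"
      using attain[of "max s ((a + 1) / 2)"] a s by auto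
    then have "(a + 1) / 2 \<le> x T" by simp
    then have "x t > a" if "t \<ge> T" for t
      using mono[OF T(1) that] a by (simp add: field_simps)
    then show "\<forall>\<^sub>F t in at_top. a < x t"
      by (auto simp: eventually_at_top_linorder)
  next
    fix a :: real assume "1 < a"
    then show "\<forall>\<^sub>F t in at_top. x t < a"
      using lt1 by (force simp: eventually_at_top_linorder intro: exI[of _ 0])
  qed
  show ?thesis
    by (rule that[of x]) (use x0 x hg ge lt1 attain lim in auto)
qed

lemma solution_on_subset: "solution_on X I x \<Longrightarrow> J \<subseteq> I \<Longrightarrow> solution_on X J x"
  unfolding solution_on_def by (meson has_vector_derivative_within_subset subsetD)

lemma solution_on_unique:
  assumes "lipschitz_on_balls X" "solution_on X {0..T} x" "solution_on X {0..T} y"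
    "x 0 = y 0" "t \<in> {0..T}"
  shows "x t = y t"
  using ode_solution_unique[OF assms(1), of T x y t] assms by (auto simp: solution_on_def)

text \<open>The planar equation restricted to the segment from \<open>a\<close> to \<open>b\<close> is the scalar one for the coordinate \<open>u\<close>.\<close>
lemma edge_connection:
  fixes X :: planar_vf
  assumes lip: "lipschitz_on_balls X" and ab: "a \<noteq> b" and Xa: "X a = 0" and Xb: "X b = 0"
    and along: "\<And>u. 0 < u \<Longrightarrow> u < 1 \<Longrightarrow> \<exists>c>0. X (a + u *\<^sub>R (b - a)) = c *\<^sub>R (b - a)"
    and s: "0 < s" "s < 1"
  obtains x where "solution_on X {0..} x" "x 0 = a + s *\<^sub>R (b - a)"
    "\<And>t. t \<ge> 0 \<Longrightarrow> x t \<in> (\<lambda>u. a + u *\<^sub>R (b - a)) ` {s..<1}"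
    "\<And>c. s \<le> c \<Longrightarrow> c < 1 \<Longrightarrow> \<exists>T\<ge>0. x T = a + c *\<^sub>R (b - a) \<and>
        x ` {0..T} = (\<lambda>u. a + u *\<^sub>R (b - a)) ` {s..c}"
    "(x \<longlongrightarrow> b) at_top"
proof -
  define e where "e = b - a"
  have e: "e \<bullet> e > 0" using ab by (simp add: e_def)
  define g where "g = (\<lambda>u. (X (a + u *\<^sub>R e) \<bullet> e) / (e \<bullet> e))"
  have Xg: "X (a + u *\<^sub>R e) = g u *\<^sub>R e" if "u \<in> {0..1}" for u
  proof (cases "u = 0 \<or> u = 1")
    case True
    then show ?thesis using Xa Xb by (auto simp: g_def e_def)
  next
    case False
    then show ?thesis using along[of u] that e by (auto simp: g_def e_def)
  qed
  have g_pos: "g u > 0" if "0 < u" "u < 1" for u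
    using along[of u] that e by (auto simp: g_def e_def)
  obtain L where L: "L-lipschitz_on (cball 0 (norm a + norm e)) X"
    using lip by (auto simp: lipschitz_on_balls_def)
  have glip: "(L * norm e / norm e)-lipschitz_on {0..1} g"
  proof (rule lipschitz_onI)
    fix u v :: real assume uv: "u \<in> {0..1}" "v \<in> {0..1}"
    have mem: "a + w *\<^sub>R e \<in> cball 0 (norm a + norm e)" if "w \<in> {0..1}" for w
      using that norm_triangle_ineq[of a "w *\<^sub>R e"] mult_left_le_one_le[of "norm e" w] by auto
    have "\<bar>g u - g v\<bar> = dist (g u *\<^sub>R e) (g v *\<^sub>R e) / norm e"
      using e by (simp add: dist_norm flip: scaleR_diff_left)
    also have "\<dots> \<le> L * dist (a + u *\<^sub>R e) (a + v *\<^sub>R e) / norm e"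
      using lipschitz_onD[OF L mem[OF uv(1)] mem[OF uv(2)]] Xg uv by (auto simp: divide_right_mono)
    also have "\<dots> = L * norm e / norm e * dist u v"
      by (simp add: dist_norm flip: scaleR_diff_left)
    finally show "dist (g u) (g v) \<le> L * norm e / norm e * dist u v" by (simp add: dist_real_def)
  qed (use lipschitz_on_nonneg[OF L] in auto)
  obtain y where y: "y 0 = s"
    "\<And>t. t \<ge> 0 \<Longrightarrow> (y has_vector_derivative g (y t)) (at t within {0..})"
    "\<And>t. t \<ge> 0 \<Longrightarrow> s \<le> y t \<and> y t < 1"
    "\<And>c. s \<le> c \<Longrightarrow> c < 1 \<Longrightarrow> \<exists>T\<ge>0. y T = c \<and> y ` {0..T} = {s..c}"
    "(y \<longlongrightarrow> 1) at_top"
    using scalar_connection[OF glip _ _ g_pos s] Xa Xb by (auto simp: g_def e_def)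
  define x where "x = (\<lambda>t. a + y t *\<^sub>R e)"
  show ?thesis
  proof (rule that[of x])
    show "solution_on X {0..} x"
      unfolding solution_on_def
    proof
      fix t :: real assume t: "t \<in> {0..}"
      then have "(x has_vector_derivative g (y t) *\<^sub>R e) (at t within {0..})"
        using y(2)[of t] unfolding x_def
        by (auto intro!: derivative_eq_intros simp: has_real_derivative_iff_has_vector_derivative)
      moreover have "X (x t) = g (y t) *\<^sub>R e"
        using Xg[of "y t"] y(3)[of t] t s by (auto simp: x_def)
      ultimately show "(x has_vector_derivative X (x t)) (at t within {0..})" by simp
    qed
    show "x t \<in> (\<lambda>u. a + u *\<^sub>R (b - a)) ` {s..<1}" if "t \<ge> 0" for t
      using y(3)[OF that] by (auto simp: x_def e_def)
    show "\<exists>T\<ge>0. x T = a + c *\<^sub>R (b - a) \<and> x ` {0..T} = (\<lambda>u. a + u *\<^sub>R (b - a)) ` {s..c}"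
      if c: "s \<le> c" "c < 1" for c
    proof -
      obtain T where T: "T \<ge> 0" "y T = c" "y ` {0..T} = {s..c}" using y(4)[OF c] by blast
      have "x ` {0..T} = (\<lambda>u. a + u *\<^sub>R e) ` y ` {0..T}" by (auto simp: x_def)
      then show ?thesis using T by (auto simp: x_def e_def)
    qed
    have "(x \<longlongrightarrow> a + 1 *\<^sub>R e) at_top"
      unfolding x_def by (intro tendsto_intros y(5))
    then show "(x \<longlongrightarrow> b) at_top" by (simp add: e_def)
  qed (simp add: x_def e_def y(1))
qed

text \<open>Reversing time reduces all statements about the past, that is, about \<open>\<alpha>\<close>-limits and the backward halves of orbits,
to statements about the future of the opposite field.\<close>
lemma solution_on_reverse:
  assumes "solution_on X I x"
  shows "solution_on (\<lambda>z. - X z) (uminus ` I) (\<lambda>t. x (- t))"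
  unfolding solution_on_def
proof
  fix t assume "t \<in> uminus ` I"
  then have "- t \<in> I" by auto
  then have D: "(x has_vector_derivative X (x (- t))) (at (- t) within I)"
    using assms by (auto simp: solution_on_def)
  have "(uminus has_vector_derivative - 1) (at t within uminus ` I)"
    by (auto intro!: derivative_eq_intros)
  moreover have "uminus ` uminus ` I = I" by (auto simp: image_image)
  ultimately have "(x \<circ> uminus has_vector_derivative (- 1) *\<^sub>R X (x (- t))) (at t within uminus ` I)"
    using D by (intro vector_diff_chain_within) auto
  then show "((\<lambda>t. x (- t)) has_vector_derivative - X (x (- t))) (at t within uminus ` I)"
    by (simp add: o_def)
qed

lemma alpha_limit_eq_omega_limit_reverse: "alpha_limit X q = omega_limit (\<lambda>z. - X z) q"
proof -
  have 1: "uminus ` {..0::real} = {0..}" by auto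
  have 2: "uminus ` {0::real..} = {..0}" by auto
  show ?thesis
  proof (intro equalityI subsetI)
    fix y assume "y \<in> alpha_limit X q"
    then obtain x \<tau> where H: "solution_on X {..0} x" "x 0 = q" "filterlim \<tau> at_bot sequentially"
      "(\<lambda>k. x (\<tau> k)) \<longlonglongrightarrow> y" by (auto simp: alpha_limit_def)
    have "solution_on (\<lambda>z. - X z) {0..} (\<lambda>t. x (- t))" using solution_on_reverse[OF H(1)] 1 by simp
    moreover have "filterlim (\<lambda>k. - \<tau> k) at_top sequentially"
      using H(3) by (simp add: filterlim_uminus_at_bot)
    ultimately show "y \<in> omega_limit (\<lambda>z. - X z) q"
      unfolding omega_limit_def mem_Collect_eq using H
      by (intro exI[of _ "\<lambda>t. x (- t)"] exI[of _ "\<lambda>k. - \<tau> k"]) auto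
  next
    fix y assume "y \<in> omega_limit (\<lambda>z. - X z) q"
    then obtain x \<tau> where H: "solution_on (\<lambda>z. - X z) {0..} x" "x 0 = q"
      "filterlim \<tau> at_top sequentially" "(\<lambda>k. x (\<tau> k)) \<longlonglongrightarrow> y" by (auto simp: omega_limit_def)
    have "solution_on X {..0} (\<lambda>t. x (- t))" using solution_on_reverse[OF H(1)] 2 by simp
    moreover have "filterlim (\<lambda>k. - \<tau> k) at_bot sequentially"
      using H(3) by (simp add: filterlim_uminus_at_top)
    ultimately show "y \<in> alpha_limit X q"
      unfolding alpha_limit_def mem_Collect_eq using H
      by (intro exI[of _ "\<lambda>t. x (- t)"] exI[of _ "\<lambda>k. - \<tau> k"]) auto
  qed
qed

lemma orbit_forward_backward:
  "orbit X q = {y. \<exists>x t. t \<ge> 0 \<and> solution_on X {0..t} x \<and> x 0 = q \<and> x t = y} \<union>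
     {y. \<exists>x t. t \<ge> 0 \<and> solution_on (\<lambda>z. - X z) {0..t} x \<and> x 0 = q \<and> x t = y}" (is "_ = ?F \<union> ?B")
proof (intro equalityI subsetI)
  fix y assume "y \<in> orbit X q"
  then obtain x t where H: "solution_on X (closed_segment 0 t) x" "x 0 = q" "x t = y"
    by (auto simp: orbit_def)
  show "y \<in> ?F \<union> ?B"
  proof (cases "t \<ge> 0")
    case True
    then show ?thesis using H by (auto simp: closed_segment_eq_real_ivl)
  next
    case False
    then have "solution_on (\<lambda>z. - X z) {0..- t} (\<lambda>t. x (- t))"
      using solution_on_reverse[OF H(1)] by (auto simp: closed_segment_eq_real_ivl)
    then have "y \<in> ?B"
      using H False by (auto intro!: exI[of _ "\<lambda>t. x (- t)"] exI[of _ "- t"])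
    then show ?thesis ..
  qed
next
  fix y assume "y \<in> ?F \<union> ?B"
  then show "y \<in> orbit X q"
  proof
    assume "y \<in> ?F"
    then show ?thesis by (auto simp: orbit_def closed_segment_eq_real_ivl)
  next
    assume "y \<in> ?B"
    then obtain x t where H: "t \<ge> 0" "solution_on (\<lambda>z. - X z) {0..t} x" "x 0 = q" "x t = y" by blast
    have "closed_segment 0 (- t) = uminus ` {0..t}" using H(1) by (auto simp: closed_segment_eq_real_ivl)
    then have "solution_on X (closed_segment 0 (- t)) (\<lambda>t. x (- t))"
      using solution_on_reverse[OF H(2)] by simp
    then show ?thesis
      using H by (auto simp: orbit_def intro!: exI[of _ "\<lambda>t. x (- t)"] exI[of _ "- t"])
  qed
qed

lemma omega_limit_convergent:
  assumes lip: "lipschitz_on_balls X" and x: "solution_on X {0..} x" and lim: "(x \<longlongrightarrow> b) at_top"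
  shows "omega_limit X (x 0) = {b}"
proof (intro equalityI subsetI)
  fix y assume "y \<in> omega_limit X (x 0)"
  then obtain x' \<tau> where H: "solution_on X {0..} x'" "x' 0 = x 0"
      "filterlim \<tau> at_top sequentially" "(\<lambda>k. x' (\<tau> k)) \<longlonglongrightarrow> y" by (auto simp: omega_limit_def)
  have "x' t = x t" if "t \<ge> 0" for t
    by (rule solution_on_unique[OF lip, of t])
       (use that H x in \<open>auto elim: solution_on_subset\<close>)
  then have "(x' \<longlongrightarrow> b) at_top"
    using lim by (subst tendsto_cong[of _ x]) (auto simp: eventually_at_top_linorder)
  then have "(\<lambda>k. x' (\<tau> k)) \<longlonglongrightarrow> b"
    using H(3) filterlim_compose by blast
  then show "y \<in> {b}" using H(4) LIMSEQ_unique by blast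
next
  fix y assume "y \<in> {b}"
  moreover have "(\<lambda>k. x (real k)) \<longlonglongrightarrow> b"
    using lim filterlim_real_sequentially filterlim_compose by blast
  ultimately show "y \<in> omega_limit X (x 0)"
    unfolding omega_limit_def using x filterlim_real_sequentially by blast
qed

lemma orbit_singularity:
  assumes lip: "lipschitz_on_balls X" and X: "X a = 0"
  shows "orbit X a = {a}"
proof -
  have *: "{y. \<exists>x t. t \<ge> 0 \<and> solution_on X {0..t} x \<and> x 0 = a \<and> x t = y} = {a}"
    if lip: "lipschitz_on_balls X" and X: "X a = 0" for X
  proof -
    have c: "solution_on X {0..t} (\<lambda>_. a)" for t
      using X by (auto simp: solution_on_def)
    have "x t = a" if "solution_on X {0..t} x" "t \<ge> 0" "x 0 = a" for x t
      using solution_on_unique[OF lip that(1) c] that by auto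
    then show ?thesis using c[of 0] by force
  qed
  show ?thesis
    unfolding orbit_forward_backward
    using *[OF lip X] *[OF lipschitz_on_balls_minus[OF lip]] X by simp
qed

lemma edge_forward:
  fixes X :: planar_vf
  assumes lip: "lipschitz_on_balls X" and ab: "a \<noteq> b" and Xa: "X a = 0" and Xb: "X b = 0"
    and along: "\<And>u. 0 < u \<Longrightarrow> u < 1 \<Longrightarrow> \<exists>c>0. X (a + u *\<^sub>R (b - a)) = c *\<^sub>R (b - a)"
    and s: "0 < s" "s < 1" and q: "q = a + s *\<^sub>R (b - a)"
  shows "omega_limit X q = {b}"
    "{y. \<exists>x t. t \<ge> 0 \<and> solution_on X {0..t} x \<and> x 0 = q \<and> x t = y} = (\<lambda>u. a + u *\<^sub>R (b - a)) ` {s..<1}"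
proof -
  obtain x where x: "solution_on X {0..} x" "x 0 = a + s *\<^sub>R (b - a)"
    "\<And>t. t \<ge> 0 \<Longrightarrow> x t \<in> (\<lambda>u. a + u *\<^sub>R (b - a)) ` {s..<1}"
    "\<And>c. s \<le> c \<Longrightarrow> c < 1 \<Longrightarrow> \<exists>T\<ge>0. x T = a + c *\<^sub>R (b - a) \<and>
        x ` {0..T} = (\<lambda>u. a + u *\<^sub>R (b - a)) ` {s..c}"
    "(x \<longlongrightarrow> b) at_top"
    using edge_connection[OF lip ab Xa Xb along s] by blast
  show "omega_limit X q = {b}"
    using omega_limit_convergent[OF lip x(1,5)] x(2) q by simp
  show "{y. \<exists>x t. t \<ge> 0 \<and> solution_on X {0..t} x \<and> x 0 = q \<and> x t = y} = (\<lambda>u. a + u *\<^sub>R (b - a)) ` {s..<1}"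
    (is "?F = ?E")
  proof (intro equalityI subsetI)
    fix y assume "y \<in> ?F"
    then obtain x' t where H: "t \<ge> 0" "solution_on X {0..t} x'" "x' 0 = q" "x' t = y" by blast
    have "x' t = x t"
      by (rule solution_on_unique[OF lip H(2), of x])
         (use H x q in \<open>auto elim: solution_on_subset\<close>)
    then show "y \<in> ?E" using x(3) H by auto
  next
    fix y assume "y \<in> ?E"
    then obtain c where "s \<le> c" "c < 1" "y = a + c *\<^sub>R (b - a)" by auto
    then obtain T where "T \<ge> 0" "x T = y" using x(4) by blast
    then show "y \<in> ?F"
      using x(1,2) q solution_on_subset[of X "{0..}" x "{0..T}"] by auto
  qed
qed

text \<open>The open segment is one orbit.  Its backward half is the forward orbit of the opposite field, for which the segment runs
from \<open>b\<close> to \<open>a\<close>.\<close>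
lemma edge_orbit:
  fixes X :: planar_vf
  assumes lip: "lipschitz_on_balls X" and ab: "a \<noteq> b" and Xa: "X a = 0" and Xb: "X b = 0"
    and along: "\<And>u. 0 < u \<Longrightarrow> u < 1 \<Longrightarrow> \<exists>c>0. X (a + u *\<^sub>R (b - a)) = c *\<^sub>R (b - a)"
    and q: "q \<in> (\<lambda>u. a + u *\<^sub>R (b - a)) ` {0<..<1}"
  shows "orbit X q = (\<lambda>u. a + u *\<^sub>R (b - a)) ` {0<..<1}" "omega_limit X q = {b}" "alpha_limit X q = {a}"
proof -
  obtain s where s: "0 < s" "s < 1" and q': "q = a + s *\<^sub>R (b - a)" using q by auto
  have flip: "b + u *\<^sub>R (a - b) = a + (1 - u) *\<^sub>R (b - a)" for u by (simp add: algebra_simps)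
  have along': "\<exists>c>0. - X (b + u *\<^sub>R (a - b)) = c *\<^sub>R (a - b)" if u: "0 < u" "u < 1" for u
  proof -
    obtain c where "c > 0" "X (a + (1 - u) *\<^sub>R (b - a)) = c *\<^sub>R (b - a)" using along[of "1 - u"] u by auto
    then show ?thesis unfolding flip by (intro exI[of _ c]) (auto simp: algebra_simps)
  qed
  note fwd = edge_forward[OF lip ab Xa Xb along s q']
  have "q = b + (1 - s) *\<^sub>R (a - b)" using q' flip by simp
  note bwd = edge_forward[OF lipschitz_on_balls_minus[OF lip] ab[symmetric] _ _ along' _ _ this]
  show "omega_limit X q = {b}" by (rule fwd)
  show "alpha_limit X q = {a}"
    unfolding alpha_limit_eq_omega_limit_reverse using bwd(1) Xa Xb s by simp
  have "(\<lambda>u. b + u *\<^sub>R (a - b)) ` {1 - s..<1} = (\<lambda>u. a + u *\<^sub>R (b - a)) ` (\<lambda>u. 1 - u) ` {1 - s..<1}"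
    unfolding image_image flip ..
  also have "(\<lambda>u. 1 - u) ` {1 - s..<1} = {0<..s}"
    by (auto simp: image_iff intro!: bexI[of _ "1 - _"])
  finally have "orbit X q = (\<lambda>u. a + u *\<^sub>R (b - a)) ` ({s..<1} \<union> {0<..s})"
    unfolding orbit_forward_backward image_Un using fwd(2) bwd(2) Xa Xb s by simp
  also have "{s..<1} \<union> {0<..s} = {0<..<1}" using s by auto
  finally show "orbit X q = (\<lambda>u. a + u *\<^sub>R (b - a)) ` {0<..<1}" .
qed

section \<open>Convex polygons\<close>
definition det2 :: "real \<times> real \<Rightarrow> real \<times> real \<Rightarrow> real" where
  "det2 a b = fst a * snd b - snd a * fst b"

lemma det2_simps [simp]:
  "det2 (a + b) c = det2 a c + det2 b c" "det2 c (a + b) = det2 c a + det2 c b"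
  "det2 (a - b) c = det2 a c - det2 b c" "det2 c (a - b) = det2 c a - det2 c b"
  "det2 (k *\<^sub>R a) c = k * det2 a c" "det2 c (k *\<^sub>R a) = k * det2 c a"
  "det2 (- a) c = - det2 a c" "det2 c (- a) = - det2 c a"
  "det2 a a = 0" "det2 0 a = 0" "det2 a 0 = 0"
  by (auto simp: det2_def algebra_simps)

lemma det2_commute: "det2 a b = - det2 b a"
  by (simp add: det2_def)

lemma continuous_on_det2 [continuous_intros]:
  "continuous_on A f \<Longrightarrow> continuous_on A g \<Longrightarrow> continuous_on A (\<lambda>x. det2 (f x) (g x))"
  unfolding det2_def by (intro continuous_intros)

lemma det2_has_vector_derivative:
  "(x has_vector_derivative x') (at t within S) \<Longrightarrow>
    ((\<lambda>t. det2 a (x t)) has_vector_derivative det2 a x') (at t within S)"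
  by (rule bounded_linear.has_vector_derivative) (auto simp: det2_def intro!: bounded_linear_intros)

text \<open>Cramer's rule.\<close>

lemma det2_cramer: "det2 a b *\<^sub>R v = det2 a v *\<^sub>R b - det2 b v *\<^sub>R a"
  by (auto simp: det2_def prod_eq_iff algebra_simps)

lemma det2_eq_zero: "det2 a b \<noteq> 0 \<Longrightarrow> det2 a v = 0 \<Longrightarrow> det2 b v = 0 \<Longrightarrow> v = 0"
  using det2_cramer[of a b v] by simp

text \<open>The vertices form a sequence of period \<open>n\<close>, so that edge \<open>i\<close>, from \<open>p i\<close> to \<open>p (Suc i)\<close>, has a
successor and, by adding \<open>n\<close> first, a predecessor without case distinctions.  Strict convexity with counterclockwise
orientation is expressed by all other vertices lying on the left of each edge.\<close>
locale convex_polygon =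
  fixes n :: nat and p :: "nat \<Rightarrow> real \<times> real"
  assumes n3: "n \<ge> 3" and periodic: "p (i + n) = p i"
    and strictly_convex: "j mod n \<noteq> i mod n \<Longrightarrow> j mod n \<noteq> Suc i mod n \<Longrightarrow>
      0 < det2 (p (Suc i) - p i) (p j - p i)"
begin

text \<open>\<open>l i\<close> is the affine function that defines the line of edge \<open>i\<close>, \<open>pt i\<close> parametrizes that edge by \<open>[0, 1]\<close>,
and \<open>d i\<close> is the determinant of the pair \<open>(l i, l (Suc i))\<close>, which serves as
coordinates at the vertex between two edges.\<close>
definition e :: "nat \<Rightarrow> real \<times> real" where "e i = p (Suc i) - p i"
definition l :: "nat \<Rightarrow> real \<times> real \<Rightarrow> real" where "l i z = det2 (e i) (z - p i)"
definition pt :: "nat \<Rightarrow> real \<Rightarrow> real \<times> real" where "pt i u = p i + u *\<^sub>R e i"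
definition d :: "nat \<Rightarrow> real" where "d i = det2 (e i) (e (Suc i))"
definition \<Gamma> :: "(real \<times> real) set" where "\<Gamma> = (\<Union>i<n. pt i ` {0..1})"

lemma p_mod: "p (i mod n) = p i"
proof -
  have "p (i + k * n) = p i" for i k
  proof (induction k)
    case (Suc k)
    have "p (i + Suc k * n) = p ((i + k * n) + n)" by (simp add: algebra_simps)
    then show ?case using Suc periodic by simp
  qed simp
  from this[of "i mod n" "i div n"] show ?thesis by (simp add: mod_div_mult_eq)
qed

lemma p_cong: "i mod n = j mod n \<Longrightarrow> p i = p j"
  using p_mod[of i] p_mod[of j] by simp

lemma Suc_mod_cong: "i mod n = j mod n \<Longrightarrow> Suc i mod n = Suc j mod n"
  using mod_Suc_eq[of i n] mod_Suc_eq[of j n] by simp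

lemma e_cong: "i mod n = j mod n \<Longrightarrow> e i = e j"
  unfolding e_def by (simp only: p_cong[of i j] p_cong[OF Suc_mod_cong, of i j])

lemma l_cong: "i mod n = j mod n \<Longrightarrow> l i = l j"
  by (simp only: fun_eq_iff l_def p_cong[of i j] e_cong[of i j]) simp

lemma pt_cong: "i mod n = j mod n \<Longrightarrow> pt i = pt j"
  by (simp only: fun_eq_iff pt_def p_cong[of i j] e_cong[of i j]) simp

lemma Suc_mod_neq: "Suc i mod n \<noteq> i mod n"
  using n3 by (auto simp: mod_Suc)

lemma Suc_Suc_mod_neq: "Suc (Suc i) mod n \<noteq> i mod n"
  using n3 by (auto simp: mod_Suc split: if_splits)

lemma vertex_predecessor: obtains k where "Suc k mod n = i mod n"
proof
  show "Suc (i + n - 1) mod n = i mod n" using n3 by simp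
qed

lemma l_vertex [simp]: "l i (p i) = 0" "l i (p (Suc i)) = 0"
  by (simp_all add: l_def e_def)

lemma l_from_end: "l i z = det2 (e i) (z - p (Suc i))"
  by (simp add: l_def e_def det2_def algebra_simps)

lemma l_vertex_pos: "j mod n \<noteq> i mod n \<Longrightarrow> j mod n \<noteq> Suc i mod n \<Longrightarrow> 0 < l i (p j)"
  unfolding l_def e_def by (rule strictly_convex)

lemma l_vertex_nonneg: "0 \<le> l i (p j)"
  using l_vertex_pos[of j i] p_cong[of j i] p_cong[of j "Suc i"] by force

lemma d_pos: "0 < d i"
proof -
  have "d i = l i (p (Suc (Suc i)))"
    by (simp add: d_def l_def e_def det2_def algebra_simps)
  then show ?thesis
    using l_vertex_pos[of "Suc (Suc i)" i] Suc_mod_neq[of "Suc i"] Suc_Suc_mod_neq[of i] by simp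
qed

lemma l_both_zero:
  assumes "l i z = 0" "l (Suc i) z = 0"
  shows "z = p (Suc i)"
proof -
  have "det2 (e i) (e (Suc i)) \<noteq> 0" using d_pos[of i] by (simp add: d_def)
  then have "z - p (Suc i) = 0"
    by (rule det2_eq_zero) (use assms in \<open>simp_all add: l_from_end[of i] l_def[of "Suc i"]\<close>)
  then show ?thesis by simp
qed

lemma e_nonzero: "e i \<noteq> 0"
  using d_pos[of i] by (auto simp: d_def)

lemma l_pt: "l j (pt i u) = (1 - u) * l j (p i) + u * l j (p (Suc i))"
  by (simp add: l_def pt_def e_def algebra_simps)

lemma pt_0 [simp]: "pt i 0 = p i" and pt_1 [simp]: "pt i 1 = p (Suc i)"
  by (simp_all add: pt_def e_def)

lemma l_pt_self [simp]: "l i (pt i u) = 0"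
  by (simp add: l_pt)

text \<open>An interior point of edge \<open>i\<close> lies strictly inside every other line \<open>j\<close>: its end points cannot both lie on
that line, since a third vertex exists.\<close>
lemma l_pt_pos:
  assumes "i mod n \<noteq> j mod n" "0 < u" "u < 1"
  shows "0 < l j (pt i u)"
proof -
  have "0 < l j (p i) \<or> 0 < l j (p (Suc i))"
  proof (rule ccontr)
    assume H: "\<not> ?thesis"
    then have "i mod n = Suc j mod n" using l_vertex_pos[of i j] assms by auto
    moreover have "Suc i mod n = j mod n \<or> Suc i mod n = Suc j mod n"
      using H l_vertex_pos[of "Suc i" j] by auto
    ultimately show False
      using Suc_mod_cong[of i "Suc j"] Suc_Suc_mod_neq[of j] Suc_mod_neq[of "Suc j"] by auto
  qed
  then show ?thesis
    using l_vertex_nonneg[of j i] l_vertex_nonneg[of j "Suc i"] assms unfolding l_pt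
    by (auto intro: add_pos_nonneg add_nonneg_pos)
qed

lemma inj_vertex: "p i = p j \<Longrightarrow> i mod n = j mod n"
proof (rule ccontr)
  assume H: "p i = p j" "i mod n \<noteq> j mod n"
  have "j mod n = Suc i mod n" using l_vertex_pos[of j i] l_vertex(1)[of i] H by force
  moreover have "i mod n = Suc j mod n" using l_vertex_pos[of i j] l_vertex(1)[of j] H by force
  ultimately show False using Suc_mod_cong[of j "Suc i"] Suc_Suc_mod_neq[of i] by auto
qed

lemma pt_on_\<Gamma>: "0 \<le> u \<Longrightarrow> u \<le> 1 \<Longrightarrow> pt i u \<in> \<Gamma>"
proof -
  assume u: "0 \<le> u" "u \<le> 1"
  have "pt i u = pt (i mod n) u" using pt_cong[of i "i mod n"] by simp
  then show ?thesis unfolding \<Gamma>_def using n3 u by (intro UN_I[of "i mod n"]) auto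
qed

lemma vertex_on_\<Gamma>: "p i \<in> \<Gamma>"
  using pt_on_\<Gamma>[of 0 i] by simp

lemma \<Gamma>_on_line: "z \<in> \<Gamma> \<Longrightarrow> \<exists>i<n. l i z = 0"
  by (auto simp: \<Gamma>_def)

lemma continuous_on_l [continuous_intros]:
  "continuous_on A f \<Longrightarrow> continuous_on A (\<lambda>x. l i (f x))"
  unfolding l_def by (intro continuous_intros)

lemma edge_segment: "pt i ` {0..1} = closed_segment (p i) (p (Suc i))"
  by (auto simp: closed_segment_def pt_def e_def algebra_simps image_iff intro!: bexI)

lemma boundary_path:
  "\<exists>g. path g \<and> pathstart g = p 0 \<and> pathfinish g = p (Suc k) \<and> path_image g = (\<Union>i<Suc k. pt i ` {0..1})"
proof (induction k)
  case 0
  show ?case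
    by (rule exI[of _ "linepath (p 0) (p (Suc 0))"]) (simp add: edge_segment lessThan_Suc)
next
  case (Suc k)
  then obtain g where g: "path g" "pathstart g = p 0" "pathfinish g = p (Suc k)"
    "path_image g = (\<Union>i<Suc k. pt i ` {0..1})" by blast
  show ?case
    by (rule exI[of _ "g +++ linepath (p (Suc k)) (p (Suc (Suc k)))"])
       (use g in \<open>simp add: path_image_join lessThan_Suc[of "Suc k"] edge_segment Un_commute\<close>)
qed

text \<open>The edges concatenate to a closed path, and a closed path factors through the circle.\<close>
lemma circle_parametrization: "\<exists>g. continuous_on (sphere (0::complex) 1) g \<and> g ` sphere 0 1 = \<Gamma>"
proof -
  obtain g where g: "path g" "pathstart g = p 0" "pathfinish g = p n"
    and im: "path_image g = \<Gamma>"
    using boundary_path[of "n - 1"] n3 unfolding \<Gamma>_def by (auto simp del: lessThan_Suc)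
  have "p n = p 0" using periodic[of 0] by simp
  then have "homotopic_loops \<Gamma> g g"
    using g im homotopic_loops_refl[of \<Gamma> g] by simp
  then have "continuous_on (sphere (0::complex) 1) (g \<circ> (\<lambda>z. Arg2pi z / (2 * pi)))"
    using homotopic_loops_imp_homotopic_circlemaps homotopic_with_imp_continuous by blast
  moreover have "(g \<circ> (\<lambda>z. Arg2pi z / (2 * pi))) ` sphere (0::complex) 1 = \<Gamma>"
  proof (intro equalityI subsetI)
    fix y assume "y \<in> (g \<circ> (\<lambda>z. Arg2pi z / (2 * pi))) ` sphere (0::complex) 1"
    then obtain z where z: "y = g (Arg2pi z / (2 * pi))" by auto
    have "Arg2pi z / (2 * pi) \<in> {0..1}"
      using Arg2pi_ge_0[of z] Arg2pi_lt_2pi[of z] by (auto simp: field_simps)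
    then show "y \<in> \<Gamma>" using z im by (auto simp: path_image_def)
  next
    fix y assume "y \<in> \<Gamma>"
    then obtain t where t: "t \<in> {0..1}" "y = g t" using im unfolding path_image_def by blast
    \<comment> \<open>\<open>Arg2pi z / (2 * pi)\<close> ranges over \<open>[0, 1)\<close> only.\<close>
    define s where "s = (if t = 1 then 0 else t)"
    have y: "y = g s" "0 \<le> s" "s < 1"
      using t g \<open>p n = p 0\<close> by (auto simp: s_def pathstart_def pathfinish_def)
    define w where "w = exp (\<i> * of_real (2 * pi * s))"
    have "Arg2pi w = 2 * pi * s"
      unfolding w_def using y by (subst Arg2pi_exp) auto
    then have "y = (g \<circ> (\<lambda>z. Arg2pi z / (2 * pi))) w" using y by simp
    moreover have "w \<in> sphere 0 1" by (simp add: w_def)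
    ultimately show "y \<in> (g \<circ> (\<lambda>z. Arg2pi z / (2 * pi))) ` sphere (0::complex) 1" by blast
  qed
  ultimately show ?thesis by blast
qed

end

section \<open>Fields tangent to the edges: the graphic\<close>

text \<open>The function \<open>K i\<close> is the cofactor of the invariant line \<open>l i = 0\<close>.  At the end vertex of edge \<open>i\<close> the distance
\<open>l i\<close> from the incoming edge is expanded and the distance \<open>l (Suc i)\<close> from the outgoing edge is contracted; this is the
saddle condition.\<close>
locale polygon_field = convex_polygon +
  fixes X :: planar_vf and K :: "nat \<Rightarrow> real \<times> real \<Rightarrow> real"
  assumes lip: "lipschitz_on_balls X"
    and cofactor: "det2 (e i) (X z) = l i z * K i z"
    and cont_K: "continuous_on UNIV (K i)"
    and K_pos: "0 < K i (p (Suc i))"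
    and K_neg: "K (Suc i) (p (Suc i)) < 0"
    and along: "0 < u \<Longrightarrow> u < 1 \<Longrightarrow> \<exists>c>0. X (pt i u) = c *\<^sub>R e i"
begin

text \<open>Two independent lines through the vertex are invariant.\<close>
lemma X_vertex: "X (p i) = 0"
proof -
  obtain k where k: "Suc k mod n = i mod n" by (rule vertex_predecessor)
  have "X (p (Suc k)) = 0"
    using det2_eq_zero[of "e k" "e (Suc k)" "X (p (Suc k))"] d_pos[of k]
    by (simp add: cofactor d_def)
  then show ?thesis using p_cong[OF k] by simp
qed

text \<open>Near a vertex neither of its two cofactors vanishes; there a zero of the field lies on both lines.\<close>
lemma singularity_isolated: "p i isolated_in {z. X z = 0}"
proof -
  obtain k where k: "Suc k mod n = i mod n" by (rule vertex_predecessor)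
  have "(K k \<longlongrightarrow> K k (p (Suc k))) (at (p (Suc k)))" "(K (Suc k) \<longlongrightarrow> K (Suc k) (p (Suc k))) (at (p (Suc k)))"
    using cont_K[of k] cont_K[of "Suc k"] unfolding continuous_on_def by (blast intro: UNIV_I)+
  then have "\<forall>\<^sub>F z in at (p (Suc k)). 0 < K k z" "\<forall>\<^sub>F z in at (p (Suc k)). K (Suc k) z < 0"
    using K_pos[of k] K_neg[of k] by (auto intro: order_tendstoD)
  moreover have "\<forall>\<^sub>F z in at (p (Suc k)). z \<noteq> p (Suc k)"
    by (rule eventually_neq_at_within)
  ultimately have "\<forall>\<^sub>F z in at (p (Suc k)). z \<notin> {z. X z = 0}"
  proof eventually_elim
    case (elim z)
    then show ?case
      using cofactor[of k z] cofactor[of "Suc k" z] l_both_zero[of k z] by auto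
  qed
  then show ?thesis
    using p_cong[OF k] X_vertex by (simp add: isolated_in_altdef)
qed

lemma edge_dynamics:
  assumes "q \<in> pt i ` {0<..<1}"
  shows "orbit X q = pt i ` {0<..<1}" "omega_limit X q = {p (Suc i)}" "alpha_limit X q = {p i}"
proof -
  have pt: "(\<lambda>u. p i + u *\<^sub>R (p (Suc i) - p i)) = pt i"
    by (simp add: fun_eq_iff pt_def e_def)
  have "p i \<noteq> p (Suc i)" using e_nonzero[of i] by (auto simp: e_def)
  note * = edge_orbit[OF lip this X_vertex X_vertex, of q]
  show "orbit X q = pt i ` {0<..<1}" "omega_limit X q = {p (Suc i)}" "alpha_limit X q = {p i}"
    using * assms along[of _ i] unfolding pt by (auto simp: pt_def e_def)
qed

lemma \<Gamma>_eq: "\<Gamma> = p ` {1..n} \<union> (\<Union>i\<in>{1..n}. pt (i - 1) ` {0<..<1})"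
proof (intro equalityI subsetI)
  fix z assume "z \<in> \<Gamma>"
  then obtain i u where iu: "i < n" "0 \<le> u" "u \<le> 1" "z = pt i u" by (auto simp: \<Gamma>_def)
  have "p i \<in> p ` {1..n}"
    using periodic[of 0] iu n3 by (cases "i = 0") (auto intro: image_eqI[of _ _ n])
  then show "z \<in> p ` {1..n} \<union> (\<Union>i\<in>{1..n}. pt (i - 1) ` {0<..<1})"
    using iu by (cases "u = 0"; cases "u = 1") (auto intro!: bexI[of _ "Suc i"])
qed (auto intro!: vertex_on_\<Gamma> pt_on_\<Gamma>)

theorem polygon_graphic: "graphic X n \<Gamma> p (\<lambda>i. pt (i - 1) ` {0<..<1})"
proof -
  obtain g where g: "continuous_on (sphere (0::complex) 1) g" "g ` sphere 0 1 = \<Gamma>"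
    using circle_parametrization by blast
  have "compact \<Gamma>"
    using compact_continuous_image[OF g(1)] g(2) by simp
  moreover have "\<Gamma> \<noteq> {}" using vertex_on_\<Gamma> by blast
  moreover have "orbit X q \<subseteq> \<Gamma>" if "q \<in> \<Gamma>" for q
  proof (cases "q \<in> p ` {1..n}")
    case True
    then show ?thesis using orbit_singularity[OF lip X_vertex] that by auto
  next
    case False
    moreover have "q \<in> p ` {1..n} \<union> (\<Union>i\<in>{1..n}. pt (i - 1) ` {0<..<1})" using that \<Gamma>_eq by simp
    ultimately obtain i where "q \<in> pt i ` {0<..<1}" by blast
    then have "orbit X q = pt i ` {0<..<1}" by (rule edge_dynamics)
    then show ?thesis using pt_on_\<Gamma>[of _ i] by (simp add: image_subset_iff)
  qed
  moreover have "regular_orbit X (pt i ` {0<..<1})" for i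
  proof -
    have "X (pt i (1/2)) \<noteq> 0" using along[of "1/2" i] e_nonzero[of i] by auto
    moreover have "orbit X (pt i (1/2)) = pt i ` {0<..<1}" by (rule edge_dynamics) auto
    ultimately show ?thesis unfolding regular_orbit_def by blast
  qed
  moreover have "inj_on (\<lambda>i. pt (i - 1) ` {0<..<1::real}) {1..n}"
  proof (rule inj_onI)
    fix i j assume ij: "i \<in> {1..n}" "j \<in> {1..n}" "pt (i - 1) ` {0<..<1::real} = pt (j - 1) ` {0<..<1}"
    then have "pt (i - 1) (1/2) \<in> pt (j - 1) ` {0<..<1}" by auto
    then have "l (j - 1) (pt (i - 1) (1/2)) = 0" by auto
    then have "(i - 1) mod n = (j - 1) mod n"
      using l_pt_pos[of "i - 1" "j - 1" "1/2"] by force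
    then show "i = j" using ij by auto
  qed
  moreover have "omega_limit X q = {p i}" if "i \<in> {1..n}" "q \<in> pt (i - 1) ` {0<..<1}" for i q
    using edge_dynamics(2)[OF that(2)] that(1) by simp
  moreover have "alpha_limit X q = {p i}"
    if "i \<in> {1..n}" "q \<in> pt (Suc (i mod n) - 1) ` {0<..<1}" for i q
    using edge_dynamics(3)[of q "i mod n"] that by (simp add: p_mod)
  ultimately show ?thesis
    unfolding graphic_def using g \<Gamma>_eq singularity_isolated by auto
qed

end

section \<open>The flow near the polygon\<close>
lemma first_exit:
  fixes x :: "real \<Rightarrow> 'a::topological_space"
  assumes cont: "continuous_on {0..} x" and opn: "open U" and start: "x 0 \<in> U"
  obtains "\<And>t. t \<ge> 0 \<Longrightarrow> x t \<in> U"
  | T where "T > 0" "x T \<notin> U" "\<And>t. 0 \<le> t \<Longrightarrow> t < T \<Longrightarrow> x t \<in> U"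
proof (cases "\<forall>t\<ge>0. x t \<in> U")
  case True
  then show ?thesis using that(1) by blast
next
  case False
  define S where "S = {0..} \<inter> x -` (- U)"
  have S: "closed S" "S \<noteq> {}" "bdd_below S"
    using False continuous_closed_preimage[OF cont, of "- U"] opn
    by (auto simp: S_def closed_def intro!: bdd_belowI[of _ 0])
  have "Inf S \<in> S" using closed_contains_Inf S by blast
  then have T: "Inf S \<ge> 0" "x (Inf S) \<notin> U" by (auto simp: S_def)
  moreover have "Inf S \<noteq> 0" using T start by auto
  moreover have "x t \<in> U" if "0 \<le> t" "t < Inf S" for t
    using cInf_lower[OF _ S(3), of t] that by (force simp: S_def)
  ultimately show ?thesis using that(2)[of "Inf S"] by auto
qed

context polygon_field
begin

text \<open>The disc of this radius contains the unit neighbourhood of the polygon, where all orbits considered below live.\<close>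
definition radius :: real where "radius = (SOME B. B \<ge> 0 \<and> (\<forall>z\<in>\<Gamma>. cball z 1 \<subseteq> cball 0 B))"

lemma \<Gamma>_compact: "compact \<Gamma>"
  using polygon_graphic unfolding graphic_def by (rule conjunct1)

lemma radius: "radius \<ge> 0" "z \<in> \<Gamma> \<Longrightarrow> dist z w \<le> 1 \<Longrightarrow> w \<in> cball 0 radius"
proof -
  obtain B where B: "\<And>z. z \<in> \<Gamma> \<Longrightarrow> norm z \<le> B"
    using compact_imp_bounded[OF \<Gamma>_compact] by (auto simp: bounded_iff)
  have "cball z 1 \<subseteq> cball 0 (\<bar>B\<bar> + 1)" if "z \<in> \<Gamma>" for z
  proof
    fix w assume "w \<in> cball z 1"
    then show "w \<in> cball 0 (\<bar>B\<bar> + 1)"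
      using B[OF that] norm_triangle_ineq[of z "w - z"] by (auto simp: dist_norm norm_minus_commute)
  qed
  then have "\<exists>B. B \<ge> 0 \<and> (\<forall>z\<in>\<Gamma>. cball z 1 \<subseteq> cball 0 B)" by (intro exI[of _ "\<bar>B\<bar> + 1"]) auto
  then have *: "radius \<ge> 0 \<and> (\<forall>z\<in>\<Gamma>. cball z 1 \<subseteq> cball 0 radius)"
    unfolding radius_def by (rule someI_ex)
  then show "radius \<ge> 0" by blast
  show "z \<in> \<Gamma> \<Longrightarrow> dist z w \<le> 1 \<Longrightarrow> w \<in> cball 0 radius" 
    using * unfolding subset_iff mem_cball by blast
qed

text \<open>The cutoff field: globally Lipschitz, as projections onto convex sets do not increase distances, and
equal to the given field in the disc.\<close>
definition Xc :: planar_vf where "Xc z = X (closest_point (cball 0 radius) z)"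

lemma Xc_eq: "z \<in> cball 0 radius \<Longrightarrow> Xc z = X z"
  by (simp add: Xc_def closest_point_self)

lemma Xc_lipschitz: obtains L where "L-lipschitz_on UNIV Xc"
proof -
  obtain L where L: "L-lipschitz_on (cball 0 radius) X"
    using lip by (auto simp: lipschitz_on_balls_def)
  have mem: "closest_point (cball 0 radius) z \<in> cball 0 radius" for z
    by (rule closest_point_in_set) (use radius(1) in auto)
  have "L-lipschitz_on UNIV Xc"
  proof (rule lipschitz_onI)
    fix z w
    have "dist (Xc z) (Xc w) \<le> L * dist (closest_point (cball 0 radius) z) (closest_point (cball 0 radius) w)"
      unfolding Xc_def by (rule lipschitz_onD[OF L mem mem])
    also have "\<dots> \<le> L * dist z w"
      by (intro mult_left_mono closest_point_lipschitz lipschitz_on_nonneg[OF L]) (use radius(1) in auto)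
    finally show "dist (Xc z) (Xc w) \<le> L * dist z w" .
  qed (rule lipschitz_on_nonneg[OF L])
  then show ?thesis by (rule that)
qed

lemma Xc_lipschitz_on_balls: "lipschitz_on_balls Xc"
  using Xc_lipschitz unfolding lipschitz_on_balls_def by (metis lipschitz_on_subset subset_UNIV)

definition \<phi> :: "real \<times> real \<Rightarrow> real \<Rightarrow> real \<times> real" where
  "\<phi> z = (SOME x. x 0 = z \<and> (\<forall>t\<ge>0. (x has_vector_derivative Xc (x t)) (at t within {0..})))"

lemma \<phi>: "\<phi> z 0 = z" "t \<ge> 0 \<Longrightarrow> (\<phi> z has_vector_derivative Xc (\<phi> z t)) (at t within {0..})"
proof -
  obtain L where "L-lipschitz_on UNIV Xc" by (rule Xc_lipschitz)
  from ode_solution_exists[OF this, of z]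
  have "\<phi> z 0 = z \<and> (\<forall>t\<ge>0. (\<phi> z has_vector_derivative Xc (\<phi> z t)) (at t within {0..}))"
    unfolding \<phi>_def by (rule someI_ex)
  then show "\<phi> z 0 = z" "t \<ge> 0 \<Longrightarrow> (\<phi> z has_vector_derivative Xc (\<phi> z t)) (at t within {0..})"
    by auto
qed

lemma \<phi>_within: "t \<in> {0..T} \<Longrightarrow> (\<phi> z has_vector_derivative Xc (\<phi> z t)) (at t within {0..T})"
  by (rule has_vector_derivative_within_subset[OF \<phi>(2)]) auto

lemma \<phi>_at: "t > 0 \<Longrightarrow> (\<phi> z has_vector_derivative Xc (\<phi> z t)) (at t)"
  using \<phi>(2)[of t z] at_within_interior[of t "{0..}"] by simp

lemma continuous_on_\<phi>: "A \<subseteq> {0..} \<Longrightarrow> continuous_on A (\<phi> z)"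
proof (rule continuous_on_subset)
  show "continuous_on {0..} (\<phi> z)"
    unfolding continuous_on_eq_continuous_within
    by (intro ballI has_vector_derivative_continuous[OF \<phi>(2)]) simp
qed

text \<open>\<open>\<phi> z\<close> is the only solution that starts at \<open>z\<close>; hence the semigroup law \<open>\<phi>_add\<close>, and the agreement with the
explicitly known solutions on the edges (\<open>\<phi>_edge\<close>).\<close>
lemma \<phi>_unique:
  assumes "\<And>s. s \<in> {0..t} \<Longrightarrow> (x has_vector_derivative Xc (x s)) (at s within {0..t})" "t \<ge> 0"
  shows "x t = \<phi> (x 0) t"
  by (rule ode_solution_unique[OF Xc_lipschitz_on_balls assms(1) \<phi>_within]) (use assms(2) \<phi>(1) in auto)

lemma \<phi>_add:
  assumes "s \<ge> 0" "t \<ge> 0"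
  shows "\<phi> z (s + t) = \<phi> (\<phi> z s) t"
proof -
  have "((\<lambda>t. \<phi> z (s + t)) has_vector_derivative Xc (\<phi> z (s + u))) (at u within {0..t})"
    if "u \<in> {0..t}" for u
  proof -
    have "((+) s has_vector_derivative 1) (at u within {0..t})"
      by (auto intro!: derivative_eq_intros)
    moreover have "(\<phi> z has_vector_derivative Xc (\<phi> z (s + u))) (at (s + u) within (+) s ` {0..t})"
      by (rule has_vector_derivative_within_subset[OF \<phi>(2)]) (use that assms in auto)
    ultimately show ?thesis
      using vector_diff_chain_within[of "(+) s" 1 u "{0..t}" "\<phi> z"] by (simp add: o_def)
  qed
  then show ?thesis using \<phi>_unique[of t "\<lambda>t. \<phi> z (s + t)"] assms by simp
qed

lemma \<phi>_solution:
  assumes "\<And>t. t \<in> {0..T} \<Longrightarrow> \<phi> z t \<in> cball 0 radius"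
  shows "solution_on X {0..T} (\<phi> z)"
  unfolding solution_on_def using \<phi>_within[of _ T z] assms Xc_eq by auto

lemma \<phi>_dependence:
  obtains L where "L \<ge> 0" "\<And>z w t. t \<ge> 0 \<Longrightarrow> dist (\<phi> z t) (\<phi> w t) \<le> exp (L * t) * dist z w"
proof -
  obtain L where L: "L-lipschitz_on UNIV Xc" by (rule Xc_lipschitz)
  have "dist (\<phi> z t) (\<phi> w t) \<le> exp (L * t) * dist z w" if "t \<ge> 0" for z w t
    using ode_difference_bounds(2)[OF L, of t "\<phi> z" "\<phi> w" t] \<phi>_within \<phi>(1) that by auto
  then show ?thesis using that lipschitz_on_nonneg[OF L] by blast
qed

lemma \<phi>_edge:
  assumes "0 < s" "s \<le> c" "c < 1"
  obtains T where "T \<ge> 0" "\<phi> (pt i s) T = pt i c" "\<phi> (pt i s) ` {0..T} = pt i ` {s..c}"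
proof -
  have pt: "p i + u *\<^sub>R (p (Suc i) - p i) = pt i u" for u
    by (simp add: pt_def e_def)
  have ne: "p i \<noteq> p (Suc i)" using e_nonzero[of i] by (auto simp: e_def)
  have dir: "\<exists>c>0. X (p i + u *\<^sub>R (p (Suc i) - p i)) = c *\<^sub>R (p (Suc i) - p i)" if "0 < u" "u < 1" for u
    using along[OF that, of i] by (simp add: pt_def e_def)
  have "s < 1" using assms by simp
  obtain x where x: "solution_on X {0..} x" "x 0 = pt i s"
    "\<And>t. t \<ge> 0 \<Longrightarrow> x t \<in> pt i ` {s..<1}"
    "\<And>c. s \<le> c \<Longrightarrow> c < 1 \<Longrightarrow> \<exists>T\<ge>0. x T = pt i c \<and> x ` {0..T} = pt i ` {s..c}"
    by (rule edge_connection[OF lip ne X_vertex X_vertex dir assms(1) \<open>s < 1\<close>, unfolded pt]) auto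
  have "x t \<in> cball 0 radius" if "t \<ge> 0" for t
  proof -
    have "x t \<in> \<Gamma>" using x(3)[OF that] assms(1) pt_on_\<Gamma>[of _ i] by (force simp: image_iff)
    then show ?thesis using radius(2)[of "x t" "x t"] by simp
  qed
  then have eq: "x t = \<phi> (pt i s) t" if "t \<ge> 0" for t
    using \<phi>_unique[of t x] solution_on_subset[OF x(1), of "{0..t}"] that x(2) Xc_eq
    by (auto simp: solution_on_def)
  obtain T where T: "T \<ge> 0" "x T = pt i c" "x ` {0..T} = pt i ` {s..c}" using x(4) assms by blast
  moreover have "x ` {0..T} = \<phi> (pt i s) ` {0..T}" using eq by (auto intro!: image_cong)
  ultimately show ?thesis using eq that[of T] by auto
qed

lemma l_derivative:
  assumes "t > 0" "\<phi> z t \<in> cball 0 radius"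
  shows "((\<lambda>t. l i (\<phi> z t)) has_real_derivative l i (\<phi> z t) * K i (\<phi> z t)) (at t)"
proof -
  have "((\<lambda>t. \<phi> z t - p i) has_vector_derivative Xc (\<phi> z t)) (at t)"
    using \<phi>_at[OF assms(1), of z] by (auto intro!: derivative_eq_intros)
  then have "((\<lambda>t. l i (\<phi> z t)) has_vector_derivative det2 (e i) (Xc (\<phi> z t))) (at t)"
    unfolding l_def by (rule det2_has_vector_derivative)
  then show ?thesis
    using Xc_eq[OF assms(2)] cofactor[of i] by (simp add: has_real_derivative_iff_has_vector_derivative)
qed

definition Inside :: "(real \<times> real) set" where "Inside = {z. \<forall>i. 0 < l i z}"

text \<open>An orbit inside the polygon does not reach a line \<open>l i = 0\<close> in finite time, because \<open>|l i|\<close> decays at most exponentially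
at a rate that bounds \<open>|K i|\<close> on the disc.\<close>
lemma \<phi>_Inside:
  assumes z: "z \<in> Inside" and ball: "\<And>s. s \<in> {0..t} \<Longrightarrow> \<phi> z s \<in> cball 0 radius" and t: "t \<ge> 0"
  shows "\<phi> z t \<in> Inside"
  unfolding Inside_def
proof (rule CollectI, rule allI, rule ccontr)
  fix i assume "\<not> 0 < l i (\<phi> z t)"
  moreover have cont: "continuous_on {0..t} (\<lambda>t. l i (\<phi> z t))"
    by (intro continuous_intros continuous_on_\<phi>) auto
  moreover have z0: "0 < l i (\<phi> z 0)" using z \<phi>(1) by (auto simp: Inside_def)
  ultimately obtain s where s: "0 \<le> s" "s \<le> t" "l i (\<phi> z s) = 0"
    using IVT2'[of "\<lambda>t. l i (\<phi> z t)" t 0 0] t by force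
  obtain M where M: "\<And>w. w \<in> cball 0 radius \<Longrightarrow> \<bar>K i w\<bar> \<le> M"
  proof -
    have "compact (K i ` cball 0 radius)"
      by (intro compact_continuous_image continuous_on_subset[OF cont_K]) auto
    then show ?thesis using that compact_imp_bounded by (force simp: bounded_iff)
  qed
  have der: "((\<lambda>t. l i (\<phi> z t)) has_vector_derivative l i (\<phi> z u) * K i (\<phi> z u)) (at u within {0..t})"
    if "u \<in> {0..t}" for u
  proof -
    have "((\<lambda>t. \<phi> z t - p i) has_vector_derivative Xc (\<phi> z u)) (at u within {0..t})"
      using \<phi>_within[OF that, of z] by (auto intro!: derivative_eq_intros)
    then have "((\<lambda>t. l i (\<phi> z t)) has_vector_derivative det2 (e i) (Xc (\<phi> z u))) (at u within {0..t})"
      unfolding l_def by (rule det2_has_vector_derivative)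
    then show ?thesis using Xc_eq[OF ball[OF that]] cofactor[of i] by simp
  qed
  have "exp (- M * s) * norm (l i (\<phi> z 0)) \<le> norm (l i (\<phi> z s))"
  proof (rule exponential_growth_bounds(1)[OF der])
    fix u assume "u \<in> {0..t}"
    then show "norm (l i (\<phi> z u) * K i (\<phi> z u)) \<le> M * norm (l i (\<phi> z u))"
      using M[OF ball[of u]] by (simp add: abs_mult mult.commute mult_right_mono)
  qed (use s in auto)
  then show False using s z0 by (auto simp: mult_le_0_iff)
qed

section \<open>Orbits that follow the polygon\<close>

text \<open>Orbits from inside that start close enough to \<open>a\<close> arrive as close to \<open>b\<close> as desired, and on the way their trace has
Hausdorff distance less than \<open>\<epsilon>\<close> from \<open>A\<close>.  The accuracy \<open>\<eta>\<close> at the end has to be independent of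
\<open>\<epsilon>\<close> for the relation to compose.\<close>
definition tracks :: "real \<Rightarrow> (real \<times> real) set \<Rightarrow> real \<times> real \<Rightarrow> real \<times> real \<Rightarrow> bool" where
  "tracks \<epsilon> A a b \<longleftrightarrow> (\<forall>\<eta>>0. \<exists>\<delta>>0. \<forall>z\<in>Inside. dist z a < \<delta> \<longrightarrow>
     (\<exists>T\<ge>0. \<phi> z T \<in> Inside \<and> dist (\<phi> z T) b < \<eta> \<and>
        (\<forall>t\<in>{0..T}. \<exists>y\<in>A. dist (\<phi> z t) y < \<epsilon>) \<and> (\<forall>y\<in>A. \<exists>t\<in>{0..T}. dist (\<phi> z t) y < \<epsilon>)))"

lemma tracks_trans:
  assumes 1: "tracks \<epsilon> A a b" and 2: "tracks \<epsilon> B b c"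
  shows "tracks \<epsilon> (A \<union> B) a c"
  unfolding tracks_def
proof (intro allI impI)
  fix \<eta> :: real assume "\<eta> > 0"
  then obtain \<delta>2 where \<delta>2: "\<delta>2 > 0" and *: "\<And>z. z \<in> Inside \<Longrightarrow> dist z b < \<delta>2 \<Longrightarrow>
     \<exists>T\<ge>0. \<phi> z T \<in> Inside \<and> dist (\<phi> z T) c < \<eta> \<and>
        (\<forall>t\<in>{0..T}. \<exists>y\<in>B. dist (\<phi> z t) y < \<epsilon>) \<and> (\<forall>y\<in>B. \<exists>t\<in>{0..T}. dist (\<phi> z t) y < \<epsilon>)"
    using 2 unfolding tracks_def by metis
  obtain \<delta> where \<delta>: "\<delta> > 0" and **: "\<And>z. z \<in> Inside \<Longrightarrow> dist z a < \<delta> \<Longrightarrow>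
     \<exists>T\<ge>0. \<phi> z T \<in> Inside \<and> dist (\<phi> z T) b < \<delta>2 \<and>
        (\<forall>t\<in>{0..T}. \<exists>y\<in>A. dist (\<phi> z t) y < \<epsilon>) \<and> (\<forall>y\<in>A. \<exists>t\<in>{0..T}. dist (\<phi> z t) y < \<epsilon>)"
    using 1 \<delta>2 unfolding tracks_def by metis
  show "\<exists>\<delta>>0. \<forall>z\<in>Inside. dist z a < \<delta> \<longrightarrow> (\<exists>T\<ge>0. \<phi> z T \<in> Inside \<and> dist (\<phi> z T) c < \<eta> \<and>
        (\<forall>t\<in>{0..T}. \<exists>y\<in>A \<union> B. dist (\<phi> z t) y < \<epsilon>) \<and> (\<forall>y\<in>A \<union> B. \<exists>t\<in>{0..T}. dist (\<phi> z t) y < \<epsilon>))"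
  proof (rule exI[of _ \<delta>], intro conjI ballI impI)
    show "\<delta> > 0" by (rule \<delta>)
  next
    fix z assume "z \<in> Inside" "dist z a < \<delta>"
    then obtain T where T: "T \<ge> 0" "\<phi> z T \<in> Inside" "dist (\<phi> z T) b < \<delta>2"
        "\<forall>t\<in>{0..T}. \<exists>y\<in>A. dist (\<phi> z t) y < \<epsilon>" "\<forall>y\<in>A. \<exists>t\<in>{0..T}. dist (\<phi> z t) y < \<epsilon>"
      using ** by blast
    then obtain T' where T': "T' \<ge> 0" "\<phi> (\<phi> z T) T' \<in> Inside" "dist (\<phi> (\<phi> z T) T') c < \<eta>"
        "\<forall>t\<in>{0..T'}. \<exists>y\<in>B. dist (\<phi> (\<phi> z T) t) y < \<epsilon>"
        "\<forall>y\<in>B. \<exists>t\<in>{0..T'}. dist (\<phi> (\<phi> z T) t) y < \<epsilon>"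
      using * by blast
    have add: "\<phi> (\<phi> z T) t = \<phi> z (T + t)" if "t \<ge> 0" for t
      using \<phi>_add[of T t z] T(1) that by simp
    have "\<exists>y\<in>A \<union> B. dist (\<phi> z t) y < \<epsilon>" if "t \<in> {0..T + T'}" for t
    proof (cases "t \<le> T")
      case True
      then show ?thesis using T(4) that by (metis UnI1 atLeastAtMost_iff)
    next
      case False
      then have "t - T \<in> {0..T'}" "\<phi> (\<phi> z T) (t - T) = \<phi> z t" using add[of "t - T"] that by auto
      then show ?thesis using T'(4) by (metis UnI2)
    qed
    moreover have "\<exists>t\<in>{0..T + T'}. dist (\<phi> z t) y < \<epsilon>" if y: "y \<in> A \<union> B" for y
      using y
    proof
      assume "y \<in> A"
      then obtain t where "t \<in> {0..T}" "dist (\<phi> z t) y < \<epsilon>" using T(5) by blast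
      then show ?thesis using T'(1) by (intro bexI[of _ t]) auto
    next
      assume "y \<in> B"
      then obtain t where "t \<in> {0..T'}" "dist (\<phi> (\<phi> z T) t) y < \<epsilon>" using T'(5) by blast
      then show ?thesis using T(1) add by (intro bexI[of _ "T + t"]) auto
    qed
    ultimately show "\<exists>T\<ge>0. \<phi> z T \<in> Inside \<and> dist (\<phi> z T) c < \<eta> \<and>
        (\<forall>t\<in>{0..T}. \<exists>y\<in>A \<union> B. dist (\<phi> z t) y < \<epsilon>) \<and> (\<forall>y\<in>A \<union> B. \<exists>t\<in>{0..T}. dist (\<phi> z t) y < \<epsilon>)"
      using T(1) T'(1-3) add by (intro exI[of _ "T + T'"]) auto
  qed
qed

lemma tracks_edge:
  assumes s: "0 < s" "s \<le> c" "c < 1" and \<epsilon>: "0 < \<epsilon>" "\<epsilon> \<le> 1"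
  shows "tracks \<epsilon> (pt i ` {s..c}) (pt i s) (pt i c)"
  unfolding tracks_def
proof (intro allI impI)
  fix \<eta> :: real assume \<eta>: "\<eta> > 0"
  obtain T where T: "T \<ge> 0" "\<phi> (pt i s) T = pt i c" "\<phi> (pt i s) ` {0..T} = pt i ` {s..c}"
    using \<phi>_edge[OF s] by blast
  obtain L where L: "L \<ge> 0" "\<And>z w t. t \<ge> 0 \<Longrightarrow> dist (\<phi> z t) (\<phi> w t) \<le> exp (L * t) * dist z w"
    using \<phi>_dependence by blast
  define \<delta> where "\<delta> = min \<eta> \<epsilon> / exp (L * T)"
  have close: "dist (\<phi> z t) (\<phi> (pt i s) t) < min \<eta> \<epsilon>" if "dist z (pt i s) < \<delta>" "t \<in> {0..T}" for z t
  proof -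
    have "dist (\<phi> z t) (\<phi> (pt i s) t) \<le> exp (L * t) * dist z (pt i s)" using L(2) that by auto
    also have "\<dots> \<le> exp (L * T) * dist z (pt i s)"
      using that L(1) by (intro mult_right_mono) (auto intro: mult_left_mono)
    also have "\<dots> < exp (L * T) * \<delta>" using that by simp
    finally show ?thesis by (simp add: \<delta>_def)
  qed
  show "\<exists>\<delta>>0. \<forall>z\<in>Inside. dist z (pt i s) < \<delta> \<longrightarrow> (\<exists>T\<ge>0. \<phi> z T \<in> Inside \<and> dist (\<phi> z T) (pt i c) < \<eta> \<and>
        (\<forall>t\<in>{0..T}. \<exists>y\<in>pt i ` {s..c}. dist (\<phi> z t) y < \<epsilon>) \<and> (\<forall>y\<in>pt i ` {s..c}. \<exists>t\<in>{0..T}. dist (\<phi> z t) y < \<epsilon>))"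
  proof (rule exI[of _ \<delta>], intro conjI ballI impI)
    show "\<delta> > 0" using \<eta> \<epsilon> by (simp add: \<delta>_def)
  next
    fix z assume z: "z \<in> Inside" "dist z (pt i s) < \<delta>"
    have A: "\<forall>t\<in>{0..T}. \<exists>y\<in>pt i ` {s..c}. dist (\<phi> z t) y < \<epsilon>"
      unfolding T(3)[symmetric]
    proof
      fix t assume "t \<in> {0..T}"
      then show "\<exists>y\<in>\<phi> (pt i s) ` {0..T}. dist (\<phi> z t) y < \<epsilon>"
        using close[OF z(2), of t] by (intro bexI[of _ "\<phi> (pt i s) t"]) auto
    qed
    have B: "\<forall>y\<in>pt i ` {s..c}. \<exists>t\<in>{0..T}. dist (\<phi> z t) y < \<epsilon>"
      unfolding T(3)[symmetric]
    proof
      fix y assume "y \<in> \<phi> (pt i s) ` {0..T}"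
      then obtain t where "t \<in> {0..T}" "y = \<phi> (pt i s) t" by blast
      then show "\<exists>t\<in>{0..T}. dist (\<phi> z t) y < \<epsilon>" using close[OF z(2), of t] by (intro bexI[of _ t]) auto
    qed
    have "\<phi> z t \<in> cball 0 radius" if "t \<in> {0..T}" for t
    proof -
      from bspec[OF A that] obtain y where y: "y \<in> pt i ` {s..c}" "dist (\<phi> z t) y < \<epsilon>"
        by (rule bexE)
      from y(1) obtain u where "y = pt i u" "u \<in> {s..c}" by (rule imageE)
      then have "y \<in> \<Gamma>" using pt_on_\<Gamma>[of u i] s by simp
      then show ?thesis
        by (rule radius(2)) (use y(2) \<epsilon> in \<open>simp add: dist_commute\<close>)
    qed
    then have "\<phi> z T \<in> Inside" by (rule \<phi>_Inside[OF z(1)]) (use T in auto)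
    then show "\<exists>T\<ge>0. \<phi> z T \<in> Inside \<and> dist (\<phi> z T) (pt i c) < \<eta> \<and>
        (\<forall>t\<in>{0..T}. \<exists>y\<in>pt i ` {s..c}. dist (\<phi> z t) y < \<epsilon>) \<and> (\<forall>y\<in>pt i ` {s..c}. \<exists>t\<in>{0..T}. dist (\<phi> z t) y < \<epsilon>)"
      using T close[OF z(2), of T] by (intro exI[of _ T] conjI A B) auto
  qed
qed

text \<open>Cramer's rule in the coordinates \<open>(l i, l (Suc i))\<close> at a vertex.\<close>
lemma dist_vertex:
  "dist z (p (Suc i)) \<le> (\<bar>l i z\<bar> * norm (e (Suc i)) + \<bar>l (Suc i) z\<bar> * norm (e i)) / d i"
proof -
  have "d i *\<^sub>R (z - p (Suc i)) = l i z *\<^sub>R e (Suc i) - l (Suc i) z *\<^sub>R e i"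
    unfolding d_def l_from_end[of i] l_def[of "Suc i"] by (rule det2_cramer)
  then have "d i * dist z (p (Suc i)) = norm (l i z *\<^sub>R e (Suc i) - l (Suc i) z *\<^sub>R e i)"
    using d_pos[of i] by (metis abs_of_pos dist_norm norm_scaleR)
  also have "\<dots> \<le> \<bar>l i z\<bar> * norm (e (Suc i)) + \<bar>l (Suc i) z\<bar> * norm (e i)"
    using norm_triangle_ineq4[of "l i z *\<^sub>R e (Suc i)" "l (Suc i) z *\<^sub>R e i"] by simp
  finally show ?thesis using d_pos[of i] by (simp add: field_simps)
qed

text \<open>Near the vertex, \<open>u = l i\<close> and \<open>v = l (Suc i)\<close> satisfy \<open>a u \<le> u' \<le> a' u\<close> and \<open>v' \<le> - b v\<close>.  So \<open>v\<close>
decreases, \<open>u\<close> grows at least linearly, and \<open>u\<^sup>b v\<^bsup>a'\<^esup>\<close>, whose logarithm has derivative at most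
\<open>b a' - a' b = 0\<close>, does not increase.\<close>
lemma saddle_passage_estimates:
  fixes \<rho> :: real
  assumes ball: "\<And>t. t \<in> {0..T} \<Longrightarrow> \<phi> z t \<in> cball (p (Suc i)) \<rho>" and \<rho>: "\<rho> \<le> 1"
    and a: "\<And>w. w \<in> cball (p (Suc i)) \<rho> \<Longrightarrow> a \<le> K i w \<and> K i w \<le> a'" "a > 0"
    and b: "\<And>w. w \<in> cball (p (Suc i)) \<rho> \<Longrightarrow> K (Suc i) w \<le> - b" "b > 0"
    and z: "z \<in> Inside" and T: "T \<ge> 0"
  shows "\<phi> z T \<in> Inside" "l (Suc i) (\<phi> z T) \<le> l (Suc i) z" "l i z + a * l i z * T \<le> l i (\<phi> z T)"
    "b * ln (l i (\<phi> z T)) + a' * ln (l (Suc i) (\<phi> z T)) \<le> b * ln (l i z) + a' * ln (l (Suc i) z)"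
proof -
  have inR: "\<phi> z t \<in> cball 0 radius" if "t \<in> {0..T}" for t
    using ball[OF that] radius(2)[OF vertex_on_\<Gamma>, of "Suc i" "\<phi> z t"] \<rho> by simp
  have Ins: "\<phi> z t \<in> Inside" if "t \<in> {0..T}" for t
    by (rule \<phi>_Inside[OF z]) (use inR that in auto)
  then have pos: "0 < l j (\<phi> z t)" if "t \<in> {0..T}" for t j
    using that by (auto simp: Inside_def)
  have der: "((\<lambda>t. l j (\<phi> z t)) has_real_derivative l j (\<phi> z t) * K j (\<phi> z t)) (at t)"
    if "0 < t" "t < T" for j t
    by (rule l_derivative) (use that inR in auto)
  have cont: "continuous_on {0..t} (\<lambda>t. l j (\<phi> z t))" for j t
    by (intro continuous_intros continuous_on_\<phi>) auto
  show "\<phi> z T \<in> Inside" using Ins T by auto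
  have "l (Suc i) (\<phi> z T) \<le> l (Suc i) (\<phi> z 0)"
  proof (rule DERIV_nonpos_imp_decreasing_open[OF T _ cont])
    fix t assume t: "0 < t" "t < T"
    have "K (Suc i) (\<phi> z t) \<le> 0" using b(1)[OF ball[of t]] b(2) t by auto
    then show "\<exists>y. ((\<lambda>t. l (Suc i) (\<phi> z t)) has_real_derivative y) (at t) \<and> y \<le> 0"
      using der[OF t, of "Suc i"] pos[of t "Suc i"] t
      by (intro exI[of _ "l (Suc i) (\<phi> z t) * K (Suc i) (\<phi> z t)"]) (auto intro: mult_nonneg_nonpos)
  qed
  then show "l (Suc i) (\<phi> z T) \<le> l (Suc i) z" by (simp add: \<phi>(1))
  have mono: "l i (\<phi> z 0) \<le> l i (\<phi> z t)" if "0 \<le> t" "t \<le> T" for t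
  proof (rule DERIV_nonneg_imp_increasing_open[OF that(1) _ cont])
    fix s assume s: "0 < s" "s < t"
    have "K i (\<phi> z s) \<ge> 0" using a(1)[OF ball[of s]] a(2) s that by auto
    then show "\<exists>y. ((\<lambda>t. l i (\<phi> z t)) has_real_derivative y) (at s) \<and> 0 \<le> y"
      using der[of s i] pos[of s i] s that
      by (intro exI[of _ "l i (\<phi> z s) * K i (\<phi> z s)"]) auto
  qed
  have "l i (\<phi> z 0) - a * l i z * 0 \<le> l i (\<phi> z T) - a * l i z * T"
  proof (rule DERIV_nonneg_imp_increasing_open[OF T, of "\<lambda>t. l i (\<phi> z t) - a * l i z * t"])
    fix t assume t: "0 < t" "t < T"
    have "l i z * a \<le> l i (\<phi> z t) * K i (\<phi> z t)"
      using a(1)[OF ball[of t]] a(2) mono[of t] pos[of 0 i] t by (intro mult_mono) (auto simp: \<phi>(1))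
    then show "\<exists>y. ((\<lambda>t. l i (\<phi> z t) - a * l i z * t) has_real_derivative y) (at t) \<and> 0 \<le> y"
      using der[OF t, of i]
      by (intro exI[of _ "l i (\<phi> z t) * K i (\<phi> z t) - a * l i z"]) (auto intro!: derivative_eq_intros simp: mult.commute)
  qed (intro continuous_intros cont)
  then show "l i z + a * l i z * T \<le> l i (\<phi> z T)" by (simp add: \<phi>(1))
  have "b * ln (l i (\<phi> z T)) + a' * ln (l (Suc i) (\<phi> z T))
      \<le> b * ln (l i (\<phi> z 0)) + a' * ln (l (Suc i) (\<phi> z 0))"
  proof (rule DERIV_nonpos_imp_decreasing_open[OF T, of "\<lambda>t. b * ln (l i (\<phi> z t)) + a' * ln (l (Suc i) (\<phi> z t))"])
    fix t assume t: "0 < t" "t < T"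
    have "((\<lambda>t. b * ln (l i (\<phi> z t)) + a' * ln (l (Suc i) (\<phi> z t))) has_real_derivative
        b * K i (\<phi> z t) + a' * K (Suc i) (\<phi> z t)) (at t)"
      using der[OF t, of i] der[OF t, of "Suc i"] pos[of t i] pos[of t "Suc i"] t
      by (auto intro!: derivative_eq_intros simp: field_simps)
    moreover have "b * K i (\<phi> z t) + a' * K (Suc i) (\<phi> z t) \<le> b * a' + a' * (- b)"
      using a(1)[OF ball[of t]] a(2) b(1)[OF ball[of t]] b(2) t
      by (intro add_mono mult_left_mono) auto
    ultimately show "\<exists>y. ((\<lambda>t. b * ln (l i (\<phi> z t)) + a' * ln (l (Suc i) (\<phi> z t))) has_real_derivative y) (at t) \<and> y \<le> 0"
      by (auto intro!: exI)
  next
    show "continuous_on {0..T} (\<lambda>t. b * ln (l i (\<phi> z t)) + a' * ln (l (Suc i) (\<phi> z t)))"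
      by (intro continuous_intros cont ballI) (metis pos less_irrefl)+
  qed
  then show "b * ln (l i (\<phi> z T)) + a' * ln (l (Suc i) (\<phi> z T)) \<le> b * ln (l i z) + a' * ln (l (Suc i) z)"
    by (simp add: \<phi>(1))
qed

section \<open>Passing a vertex\<close>
lemma saddle_neighbourhood:
  assumes "\<epsilon> > 0"
  obtains \<rho> a a' b where "0 < \<rho>" "\<rho> \<le> \<epsilon>" "a > 0" "a' > 0" "b > 0"
    "\<And>w. w \<in> cball (p (Suc i)) \<rho> \<Longrightarrow> a \<le> K i w \<and> K i w \<le> a'"
    "\<And>w. w \<in> cball (p (Suc i)) \<rho> \<Longrightarrow> K (Suc i) w \<le> - b"
proof -
  let ?P = "p (Suc i)"
  define U where "U = {w. K i ?P / 2 < K i w} \<inter> {w. K i w < 2 * K i ?P} \<inter> {w. K (Suc i) w < K (Suc i) ?P / 2}"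
  have "open U" unfolding U_def
    by (intro open_Int open_Collect_less continuous_on_const cont_K)
  moreover have "?P \<in> U" using K_pos[of i] K_neg[of i] by (auto simp: U_def)
  ultimately obtain \<rho> where \<rho>: "\<rho> > 0" "cball ?P \<rho> \<subseteq> U"
    unfolding open_contains_cball by blast
  show ?thesis
  proof (rule that)
    show "0 < min \<rho> \<epsilon>" "min \<rho> \<epsilon> \<le> \<epsilon>" using \<rho> assms by auto
    show "0 < K i ?P / 2" "0 < 2 * K i ?P" "0 < - (K (Suc i) ?P / 2)"
      using K_pos[of i] K_neg[of i] by auto
    fix w assume "w \<in> cball ?P (min \<rho> \<epsilon>)"
    then have "w \<in> U" using \<rho>(2) by auto
    then show "K i ?P / 2 \<le> K i w \<and> K i w \<le> 2 * K i ?P" "K (Suc i) w \<le> - (- (K (Suc i) ?P / 2))"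
      by (auto simp: U_def)
  qed
qed

lemma l_Suc_before_vertex: "l (Suc i) (pt i (1 - \<alpha>)) = \<alpha> * d i"
  by (simp add: l_pt) (simp add: l_def d_def e_def det2_def algebra_simps)

lemma dist_after_vertex:
  assumes "l i w = \<alpha> * d i"
  shows "dist w (pt (Suc i) \<alpha>) = \<bar>l (Suc i) w\<bar> * norm (e i) / d i"
proof -
  have "d i *\<^sub>R (w - p (Suc i)) = l i w *\<^sub>R e (Suc i) - l (Suc i) w *\<^sub>R e i"
    unfolding d_def l_from_end[of i] l_def[of "Suc i"] by (rule det2_cramer)
  then have "d i *\<^sub>R (w - pt (Suc i) \<alpha>) = - l (Suc i) w *\<^sub>R e i"
    by (simp add: pt_def assms algebra_simps)
  then have "norm (d i *\<^sub>R (w - pt (Suc i) \<alpha>)) = \<bar>l (Suc i) w\<bar> * norm (e i)"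
    by simp
  then show ?thesis using d_pos[of i] unfolding dist_norm norm_scaleR by (simp add: field_simps)
qed

lemma dist_pt: "dist (pt i u) (pt i v) = \<bar>u - v\<bar> * norm (e i)"
  by (simp add: pt_def dist_norm flip: scaleR_diff_left)

text \<open>Entering the parallelogram at the vertex with small \<open>u = l i\<close> and bounded \<open>v = l (Suc i)\<close>, the orbit leaves it
through the side \<open>u = D\<close>, since \<open>u\<close> grows and \<open>v\<close> decreases.  As \<open>u\<^sup>b v\<^bsup>a'\<^esup>\<close> does not increase,
\<open>v\<close> is arbitrarily small at the exit if \<open>u\<close> is small enough at the entry.\<close>
lemma saddle_passage:
  assumes \<rho>: "0 < \<rho>" "\<rho> \<le> 1" and const: "a > 0" "a' > 0" "b > 0"
    and Ki: "\<And>w. w \<in> cball (p (Suc i)) \<rho> \<Longrightarrow> a \<le> K i w \<and> K i w \<le> a'"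
    and KS: "\<And>w. w \<in> cball (p (Suc i)) \<rho> \<Longrightarrow> K (Suc i) w \<le> - b"
    and \<alpha>: "0 < \<alpha>" "2 * \<alpha> * (norm (e i) + norm (e (Suc i))) < \<rho>" and \<eta>: "\<eta> > 0"
  shows "\<exists>\<kappa>>0. \<forall>z\<in>Inside. l i z < \<kappa> \<longrightarrow> l (Suc i) z < 2 * (\<alpha> * d i) \<longrightarrow>
    (\<exists>T\<ge>0. \<phi> z T \<in> Inside \<and> dist (\<phi> z T) (pt (Suc i) \<alpha>) < \<eta> \<and>
      (\<forall>t\<in>{0..T}. dist (p (Suc i)) (\<phi> z t) \<le> \<rho>))"
proof -
  let ?P = "p (Suc i)"
  define D where "D = \<alpha> * d i"
  have D: "D > 0" using \<alpha>(1) d_pos[of i] by (simp add: D_def)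
  \<comment> \<open>By \<open>dist_after_vertex\<close>, \<open>v < w1\<close> at the exit is the required accuracy; \<open>\<kappa>\<close> is solved for accordingly.\<close>
  define w1 where "w1 = \<eta> * d i / norm (e i)"
  have w1: "w1 > 0" using \<eta> d_pos[of i] e_nonzero[of i] by (simp add: w1_def)
  define \<kappa> where "\<kappa> = min D (exp ((b * ln D + a' * ln w1 - a' * ln (2 * D)) / b))"
  have \<kappa>: "\<kappa> > 0" "\<kappa> \<le> D" using D by (auto simp: \<kappa>_def)
  have "ln \<kappa> \<le> (b * ln D + a' * ln w1 - a' * ln (2 * D)) / b"
    using ln_mono[of \<kappa> "exp ((b * ln D + a' * ln w1 - a' * ln (2 * D)) / b)"] \<kappa> by (simp add: \<kappa>_def)
  then have \<kappa>_bound: "b * ln \<kappa> + a' * ln (2 * D) \<le> b * ln D + a' * ln w1"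
    using const by (simp add: field_simps)
  \<comment> \<open>The parallelogram of side lengths \<open>D\<close> and \<open>2 D\<close> at the vertex fits into the ball.\<close>
  have box: "dist ?P w < \<rho>" if "w \<in> Inside" "l i w \<le> D" "l (Suc i) w < 2 * D" for w
  proof -
    have pos: "0 < l i w" "0 < l (Suc i) w" using that by (auto simp: Inside_def)
    have "dist w ?P \<le> (\<bar>l i w\<bar> * norm (e (Suc i)) + \<bar>l (Suc i) w\<bar> * norm (e i)) / d i"
      by (rule dist_vertex)
    also have "\<dots> \<le> (2 * D * norm (e (Suc i)) + 2 * D * norm (e i)) / d i"
      using pos that D d_pos[of i] by (intro divide_right_mono add_mono mult_right_mono) auto
    also have "\<dots> = 2 * \<alpha> * (norm (e i) + norm (e (Suc i)))"
      using d_pos[of i] by (simp add: D_def field_simps)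
    finally show ?thesis using \<alpha>(2) by (simp add: dist_commute)
  qed
  show ?thesis
  proof (rule exI[of _ \<kappa>], intro conjI ballI impI)
    show "\<kappa> > 0" by (rule \<kappa>(1))
  next
    fix z assume z: "z \<in> Inside" "l i z < \<kappa>" "l (Suc i) z < 2 * (\<alpha> * d i)"
    have z2: "l (Suc i) z < 2 * D" using z(3) by (simp add: D_def)
    have zpos: "0 < l i z" "0 < l (Suc i) z" using z(1) by (auto simp: Inside_def)
    define U where "U = ball ?P \<rho> \<inter> {w. l i w < D}"
    have "open U" unfolding U_def
      by (intro open_Int open_ball open_Collect_less continuous_on_const continuous_on_l continuous_on_id)
    have start: "\<phi> z 0 \<in> U" using z z2 \<kappa> box[of z] by (auto simp: U_def \<phi>(1))
    show "\<exists>T\<ge>0. \<phi> z T \<in> Inside \<and> dist (\<phi> z T) (pt (Suc i) \<alpha>) < \<eta> \<and>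
      (\<forall>t\<in>{0..T}. dist ?P (\<phi> z t) \<le> \<rho>)"
    proof (rule first_exit[OF continuous_on_\<phi>[OF order_refl, of z] \<open>open U\<close> start])
      assume stay: "\<And>t. 0 \<le> t \<Longrightarrow> \<phi> z t \<in> U"
      \<comment> \<open>At this time linear growth would have taken \<open>u\<close> beyond \<open>D\<close>.\<close>
      define t where "t = D / (a * l i z)"
      have t: "t \<ge> 0" using D const zpos by (simp add: t_def)
      have "l i z + a * l i z * t \<le> l i (\<phi> z t)"
        by (rule saddle_passage_estimates(3)[OF _ \<rho>(2) Ki const(1) KS const(3) z(1) t])
           (use stay in \<open>auto simp: U_def less_imp_le\<close>)
      moreover have "a * l i z * t = D" using const zpos by (simp add: t_def)
      moreover have "l i (\<phi> z t) < D" using stay[OF t] by (auto simp: U_def)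
      ultimately show ?thesis using zpos by linarith
    next
      fix T assume T: "T > 0" "\<phi> z T \<notin> U" and before: "\<And>t. 0 \<le> t \<Longrightarrow> t < T \<Longrightarrow> \<phi> z t \<in> U"
      have cl: "closure {0..<T} = {0..T}" using T(1) by simp
      have at_T: "f (\<phi> z T) \<le> c"
        if "continuous_on UNIV f" "\<And>w. w \<in> U \<Longrightarrow> f w \<le> c" for f :: "real \<times> real \<Rightarrow> real" and c
      proof (rule continuous_le_on_closure[of "{0..<T}" "\<lambda>t. f (\<phi> z t)"])
        show "continuous_on (closure {0..<T}) (\<lambda>t. f (\<phi> z t))"
          unfolding cl by (rule continuous_on_compose2[OF that(1) continuous_on_\<phi>]) auto
      qed (use cl T that(2) before in auto)
      have "dist ?P (\<phi> z T) \<le> \<rho>"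
        by (rule at_T) (auto simp: U_def intro!: continuous_intros)
      then have ball: "\<phi> z t \<in> cball ?P \<rho>" if "t \<in> {0..T}" for t
        using before[of t] that by (cases "t = T") (auto simp: U_def less_imp_le)
      have "l i (\<phi> z T) \<le> D"
        by (rule at_T) (auto simp: U_def intro!: continuous_intros)
      note est = saddle_passage_estimates[OF ball \<rho>(2) Ki const(1) KS const(3) z(1) less_imp_le[OF T(1)]]
      have "dist ?P (\<phi> z T) < \<rho>"
        by (rule box) (use est(1,2) z2 \<open>l i (\<phi> z T) \<le> D\<close> in auto)
      then have exit: "l i (\<phi> z T) = D" using T(2) \<open>l i (\<phi> z T) \<le> D\<close> by (auto simp: U_def)
      have wpos: "0 < l (Suc i) (\<phi> z T)" using est(1) by (auto simp: Inside_def)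
      have "b * ln D + a' * ln (l (Suc i) (\<phi> z T)) \<le> b * ln (l i z) + a' * ln (l (Suc i) z)"
        using est(4) exit by simp
      also have "\<dots> < b * ln \<kappa> + a' * ln (2 * D)"
        using const zpos z(2) z2 \<kappa>(1) D
        by (intro add_less_le_mono mult_strict_left_mono mult_left_mono) auto
      finally have "a' * ln (l (Suc i) (\<phi> z T)) < a' * ln w1" using \<kappa>_bound by linarith
      then have "l (Suc i) (\<phi> z T) < w1" using const wpos w1 by simp
      then have "dist (\<phi> z T) (pt (Suc i) \<alpha>) < w1 * norm (e i) / d i"
        using wpos d_pos[of i] e_nonzero[of i] dist_after_vertex[of i "\<phi> z T" \<alpha>] exit
        by (auto simp: D_def intro!: divide_strict_right_mono mult_strict_right_mono)
      also have "\<dots> = \<eta>" using d_pos[of i] e_nonzero[of i] by (simp add: w1_def)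
      finally show ?thesis
        using T(1) est(1) ball by (intro exI[of _ T]) auto
    qed
  qed
qed

text \<open>If the passage takes place in a disc of diameter less than \<open>\<epsilon>\<close> that also contains the two pieces of edges, closeness
of the traces needs no further argument.  This is why the size \<open>\<alpha>\<close> of the pieces is taken arbitrarily small.\<close>
lemma tracks_near_vertex:
  assumes \<epsilon>: "0 < \<epsilon>" "\<epsilon> \<le> 1"
  shows "\<exists>\<alpha>0>0. \<forall>\<alpha>. 0 < \<alpha> \<and> \<alpha> < \<alpha>0 \<longrightarrow>
    tracks \<epsilon> (pt i ` {1 - \<alpha>..1} \<union> pt (Suc i) ` {0..\<alpha>}) (pt i (1 - \<alpha>)) (pt (Suc i) \<alpha>)"
proof -
  let ?P = "p (Suc i)"
  have e3: "\<epsilon> / 3 > 0" using \<epsilon> by simp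
  obtain \<rho> a a' b where \<rho>: "0 < \<rho>" "\<rho> \<le> \<epsilon> / 3" and const: "a > 0" "a' > 0" "b > 0"
    and Ki: "\<And>w. w \<in> cball ?P \<rho> \<Longrightarrow> a \<le> K i w \<and> K i w \<le> a'"
    and KS: "\<And>w. w \<in> cball ?P \<rho> \<Longrightarrow> K (Suc i) w \<le> - b"
    using saddle_neighbourhood[OF e3, of i] by blast
  define N where "N = norm (e i) + norm (e (Suc i))"
  have N: "N > 0" using e_nonzero[of i] by (simp add: N_def add_pos_nonneg)
  have \<rho>1: "\<rho> \<le> 1" using \<rho> \<epsilon> by simp
  have "tracks \<epsilon> (pt i ` {1 - \<alpha>..1} \<union> pt (Suc i) ` {0..\<alpha>}) (pt i (1 - \<alpha>)) (pt (Suc i) \<alpha>)"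
    if \<alpha>: "0 < \<alpha>" "\<alpha> < \<rho> / (2 * N)" for \<alpha>
    unfolding tracks_def
  proof (intro allI impI)
    let ?A = "pt i ` {1 - \<alpha>..1} \<union> pt (Suc i) ` {0..\<alpha>}"
    fix \<eta> :: real assume \<eta>: "\<eta> > 0"
    have \<alpha>N: "2 * \<alpha> * N < \<rho>" using \<alpha>(2) N by (simp add: field_simps)
    have A_near: "dist ?P y < \<rho>" if y: "y \<in> ?A" for y
    proof -
      have "dist ?P y \<le> \<alpha> * N" using y
      proof
        assume "y \<in> pt i ` {1 - \<alpha>..1}"
        then obtain u where u: "y = pt i u" "1 - \<alpha> \<le> u" "u \<le> 1" by auto
        have "dist ?P y = \<bar>1 - u\<bar> * norm (e i)" using dist_pt[of i 1 u] u(1) by simp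
        also have "\<dots> \<le> \<alpha> * N" using u \<alpha> by (intro mult_mono) (auto simp: N_def)
        finally show ?thesis .
      next
        assume "y \<in> pt (Suc i) ` {0..\<alpha>}"
        then obtain u where u: "y = pt (Suc i) u" "0 \<le> u" "u \<le> \<alpha>" by auto
        have "dist ?P y = \<bar>0 - u\<bar> * norm (e (Suc i))" using dist_pt[of "Suc i" 0 u] u(1) by simp
        also have "\<dots> \<le> \<alpha> * N" using u \<alpha> by (intro mult_mono) (auto simp: N_def)
        finally show ?thesis .
      qed
      moreover have "0 < \<alpha> * N" using \<alpha>(1) N by simp
      ultimately show ?thesis using \<alpha>N by linarith
    qed
    have "pt i 1 \<in> pt i ` {1 - \<alpha>..1}" using \<alpha>(1) by (intro imageI) simp
    then have PA: "?P \<in> ?A" unfolding pt_1 by (rule UnI1)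
    have "\<exists>\<kappa>>0. \<forall>z\<in>Inside. l i z < \<kappa> \<longrightarrow> l (Suc i) z < 2 * (\<alpha> * d i) \<longrightarrow>
      (\<exists>T\<ge>0. \<phi> z T \<in> Inside \<and> dist (\<phi> z T) (pt (Suc i) \<alpha>) < \<eta> \<and>
        (\<forall>t\<in>{0..T}. dist ?P (\<phi> z t) \<le> \<rho>))"
      by (rule saddle_passage[OF \<rho>(1) \<rho>1 const Ki KS \<alpha>(1) \<alpha>N[unfolded N_def] \<eta>])
    then obtain \<kappa> where \<kappa>: "\<kappa> > 0" and passage: "\<forall>z\<in>Inside. l i z < \<kappa> \<longrightarrow> l (Suc i) z < 2 * (\<alpha> * d i) \<longrightarrow>
      (\<exists>T\<ge>0. \<phi> z T \<in> Inside \<and> dist (\<phi> z T) (pt (Suc i) \<alpha>) < \<eta> \<and>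
        (\<forall>t\<in>{0..T}. dist ?P (\<phi> z t) \<le> \<rho>))"
      by (elim exE conjE) (rule that)
    define U where "U = {w. l i w < \<kappa>} \<inter> {w. l (Suc i) w < 2 * (\<alpha> * d i)}"
    have "open U" unfolding U_def
      by (intro open_Int open_Collect_less continuous_on_const continuous_on_l continuous_on_id)
    moreover have "pt i (1 - \<alpha>) \<in> U"
      using \<kappa> \<alpha>(1) d_pos[of i] by (simp add: U_def l_Suc_before_vertex)
    ultimately obtain \<delta> where \<delta>: "\<delta> > 0" "ball (pt i (1 - \<alpha>)) \<delta> \<subseteq> U"
      unfolding open_contains_ball by blast
    show "\<exists>\<delta>>0. \<forall>z\<in>Inside. dist z (pt i (1 - \<alpha>)) < \<delta> \<longrightarrow> (\<exists>T\<ge>0. \<phi> z T \<in> Inside \<and>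
        dist (\<phi> z T) (pt (Suc i) \<alpha>) < \<eta> \<and>
        (\<forall>t\<in>{0..T}. \<exists>y\<in>?A. dist (\<phi> z t) y < \<epsilon>) \<and> (\<forall>y\<in>?A. \<exists>t\<in>{0..T}. dist (\<phi> z t) y < \<epsilon>))"
    proof (rule exI[of _ \<delta>], intro conjI ballI impI)
      show "\<delta> > 0" by (rule \<delta>(1))
    next
      fix z assume z: "z \<in> Inside" "dist z (pt i (1 - \<alpha>)) < \<delta>"
      then have "z \<in> U" using \<delta>(2) by (auto simp: dist_commute)
      then have zU: "l i z < \<kappa>" "l (Suc i) z < 2 * (\<alpha> * d i)" by (auto simp: U_def)
      obtain T where T: "T \<ge> 0" "\<phi> z T \<in> Inside" "dist (\<phi> z T) (pt (Suc i) \<alpha>) < \<eta>"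
        and near: "\<forall>t\<in>{0..T}. dist ?P (\<phi> z t) \<le> \<rho>"
        using mp[OF mp[OF bspec[OF passage z(1)] zU(1)] zU(2)] by (elim exE conjE) (rule that)
      have "dist (\<phi> z t) y < \<epsilon>" if "t \<in> {0..T}" "y \<in> ?A" for t y
        using bspec[OF near that(1)] A_near[OF that(2)] \<rho> dist_triangle3[of "\<phi> z t" y ?P] by linarith
      then have "\<forall>t\<in>{0..T}. \<exists>y\<in>?A. dist (\<phi> z t) y < \<epsilon>" "\<forall>y\<in>?A. \<exists>t\<in>{0..T}. dist (\<phi> z t) y < \<epsilon>"
        using PA T(1) by (meson atLeastAtMost_iff order_refl)+
      then show "\<exists>T\<ge>0. \<phi> z T \<in> Inside \<and>
        dist (\<phi> z T) (pt (Suc i) \<alpha>) < \<eta> \<and>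
        (\<forall>t\<in>{0..T}. \<exists>y\<in>?A. dist (\<phi> z t) y < \<epsilon>) \<and> (\<forall>y\<in>?A. \<exists>t\<in>{0..T}. dist (\<phi> z t) y < \<epsilon>)"
        using T by blast
    qed
  qed
  then show ?thesis using \<rho>(1) N by (intro exI[of _ "\<rho> / (2 * N)"]) auto
qed

text \<open>The vertex is approached and left along compact pieces of the edges, whose lengths depend on \<open>\<epsilon>\<close>.\<close>
lemma tracks_vertex:
  assumes \<epsilon>: "0 < \<epsilon>" "\<epsilon> \<le> 1" and s: "0 < s" "s < 1" "0 < s'" "s' < 1"
  shows "tracks \<epsilon> (pt i ` {s..1} \<union> pt (Suc i) ` {0..s'}) (pt i s) (pt (Suc i) s')"
proof -
  obtain \<alpha>0 where "\<alpha>0 > 0" and *: "\<And>\<alpha>. 0 < \<alpha> \<Longrightarrow> \<alpha> < \<alpha>0 \<Longrightarrow>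
      tracks \<epsilon> (pt i ` {1 - \<alpha>..1} \<union> pt (Suc i) ` {0..\<alpha>}) (pt i (1 - \<alpha>)) (pt (Suc i) \<alpha>)"
    using tracks_near_vertex[OF \<epsilon>] by blast
  define \<alpha> where "\<alpha> = min (\<alpha>0 / 2) (min (1 - s) s')"
  have \<alpha>: "0 < \<alpha>" "\<alpha> < \<alpha>0" "s \<le> 1 - \<alpha>" "\<alpha> \<le> s'" "\<alpha> < 1"
    using \<open>\<alpha>0 > 0\<close> s by (auto simp: \<alpha>_def min_def)
  have "tracks \<epsilon> (pt i ` {s..1 - \<alpha>} \<union> (pt i ` {1 - \<alpha>..1} \<union> pt (Suc i) ` {0..\<alpha>}) \<union> pt (Suc i) ` {\<alpha>..s'})
      (pt i s) (pt (Suc i) s')"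
    using \<alpha> s by (intro tracks_trans[OF tracks_trans[OF tracks_edge *] tracks_edge] \<epsilon>) auto
  also have "pt i ` {s..1 - \<alpha>} \<union> (pt i ` {1 - \<alpha>..1} \<union> pt (Suc i) ` {0..\<alpha>}) \<union> pt (Suc i) ` {\<alpha>..s'}
    = pt i ` ({s..1 - \<alpha>} \<union> {1 - \<alpha>..1}) \<union> pt (Suc i) ` ({0..\<alpha>} \<union> {\<alpha>..s'})"
    by (simp add: image_Un Un_assoc)
  also have "{s..1 - \<alpha>} \<union> {1 - \<alpha>..1} = {s..1}" using \<alpha> by auto
  also have "{0..\<alpha>} \<union> {\<alpha>..s'} = {0..s'}" using \<alpha> by auto
  finally show ?thesis .
qed

lemma tracks_around:
  assumes \<epsilon>: "0 < \<epsilon>" "\<epsilon> \<le> 1" and s: "0 < s" "s < 1" "0 < s'" "s' < 1"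
  shows "tracks \<epsilon> (pt 0 ` {s..1} \<union> (\<Union>j\<in>{1..k}. pt j ` {0..1}) \<union> pt (Suc k) ` {0..s'}) (pt 0 s) (pt (Suc k) s')"
  using s
proof (induction k arbitrary: s')
  case 0
  then show ?case using tracks_vertex[OF \<epsilon>, of s s' 0] by simp
next
  case (Suc k)
  have "tracks \<epsilon> ((pt 0 ` {s..1} \<union> (\<Union>j\<in>{1..k}. pt j ` {0..1}) \<union> pt (Suc k) ` {0..1/2})
      \<union> (pt (Suc k) ` {1/2..1} \<union> pt (Suc (Suc k)) ` {0..s'})) (pt 0 s) (pt (Suc (Suc k)) s')"
    by (rule tracks_trans[OF Suc.IH tracks_vertex[OF \<epsilon>]]) (use Suc.prems in auto)
  also have "(pt 0 ` {s..1} \<union> (\<Union>j\<in>{1..k}. pt j ` {0..1}) \<union> pt (Suc k) ` {0..1/2})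
      \<union> (pt (Suc k) ` {1/2..1} \<union> pt (Suc (Suc k)) ` {0..s'})
    = pt 0 ` {s..1} \<union> ((\<Union>j\<in>{1..k}. pt j ` {0..1}) \<union> pt (Suc k) ` ({0..1/2} \<union> {1/2..1}))
      \<union> pt (Suc (Suc k)) ` {0..s'}"
    unfolding image_Un by blast
  also have "{0..1/2} \<union> {1/2..1} = {0..1::real}" by auto
  also have "(\<Union>j\<in>{1..k}. pt j ` {0..1}) \<union> pt (Suc k) ` {0..1} = (\<Union>j\<in>{1..Suc k}. pt j ` {0..1})"
    by (simp add: atLeastAtMostSuc_conv Un_commute)
  finally show ?case .
qed

section \<open>The first return map\<close>
lemma Inside_iff: "z \<in> Inside \<longleftrightarrow> (\<forall>i<n. 0 < l i z)"
proof
  assume H: "\<forall>i<n. 0 < l i z"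
  have "0 < l i z" for i
    using H[rule_format, of "i mod n"] l_cong[of "i mod n" i] n3 by simp
  then show "z \<in> Inside" by (simp add: Inside_def)
qed (simp add: Inside_def)

lemma Inside_not_on_\<Gamma>: "z \<in> Inside \<Longrightarrow> z \<notin> \<Gamma>"
  unfolding Inside_def mem_Collect_eq by (metis \<Gamma>_on_line less_irrefl)

lemma continuous_on_X: "continuous_on A X"
proof -
  have "continuous (at z) X" for z
  proof -
    obtain L where "L-lipschitz_on (cball 0 (norm z + 1)) X"
      using lip by (auto simp: lipschitz_on_balls_def)
    then have "continuous_on (cball 0 (norm z + 1)) X" by (rule lipschitz_on_continuous_on)
    then show ?thesis by (rule continuous_on_interior) simp
  qed
  then show ?thesis by (simp add: continuous_at_imp_continuous_on)
qed

text \<open>The transversal starts at \<open>q\<close> in the direction of \<open>e 1\<close>, which points inside.  The function \<open>c\<close> vanishes exactly on its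
line and increases along orbits that cross it near \<open>q\<close>.\<close>
definition q :: "real \<times> real" where "q = pt 0 (1/2)"

definition c :: "real \<times> real \<Rightarrow> real" where "c z = det2 (z - q) (e 1)"

lemma continuous_on_c: "continuous_on A f \<Longrightarrow> continuous_on A (\<lambda>x. c (f x))"
  unfolding c_def by (intro continuous_intros)

lemma c_pt: "c (pt 0 u) = (u - 1/2) * d 0"
  by (simp add: c_def q_def pt_def d_def algebra_simps)

lemma section_neighbourhood:
  obtains \<rho> where "\<rho> > 0" "\<And>w. dist q w < \<rho> \<Longrightarrow> 0 < det2 (X w) (e 1)"
    "\<And>w j. dist q w < \<rho> \<Longrightarrow> 0 < j \<Longrightarrow> j < n \<Longrightarrow> 0 < l j w"
proof -
  define U where "U = {w. 0 < det2 (X w) (e 1)} \<inter> (\<Inter>j\<in>{0<..<n}. {w. 0 < l j w})"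
  have "open U" unfolding U_def
    by (intro open_Int open_INT ballI open_Collect_less continuous_on_const continuous_on_l
        continuous_on_id continuous_on_det2 continuous_on_X) auto
  moreover have "q \<in> U"
  proof -
    obtain c where "c > 0" "X q = c *\<^sub>R e 0" using along[of "1/2" 0] by (auto simp: q_def)
    then have "0 < det2 (X q) (e 1)" using d_pos[of 0] by (simp add: d_def)
    then show ?thesis using l_pt_pos[of 0 _ "1/2"] by (auto simp: U_def q_def)
  qed
  ultimately obtain \<rho> where "\<rho> > 0" "ball q \<rho> \<subseteq> U"
    unfolding open_contains_ball by blast
  then show ?thesis by (intro that[of \<rho>]) (auto simp: U_def subset_iff)
qed

lemma c_increasing:
  assumes \<rho>: "\<And>w. dist q w < \<rho> \<Longrightarrow> 0 < det2 (X w) (e 1)"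
    and near: "\<And>t. t \<in> {0..T} \<Longrightarrow> dist q (\<phi> z t) < \<rho>"
    and inR: "\<And>t. t \<in> {0..T} \<Longrightarrow> \<phi> z t \<in> cball 0 radius" and st: "0 \<le> s" "s < t" "t \<le> T"
  shows "c (\<phi> z s) < c (\<phi> z t)"
proof (rule DERIV_pos_imp_increasing_open[OF st(2)])
  fix u assume u: "s < u" "u < t"
  have "((\<lambda>t. \<phi> z t - q) has_vector_derivative Xc (\<phi> z u)) (at u)"
    using \<phi>_at[of u z] u st by (auto intro!: derivative_eq_intros)
  then have "((\<lambda>t. det2 (e 1) (\<phi> z t - q)) has_vector_derivative det2 (e 1) (Xc (\<phi> z u))) (at u)"
    by (rule det2_has_vector_derivative)
  then have "((\<lambda>t. - det2 (e 1) (\<phi> z t - q)) has_vector_derivative - det2 (e 1) (Xc (\<phi> z u))) (at u)"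
    by (rule has_vector_derivative_minus)
  moreover have "c w = - det2 (e 1) (w - q)" for w
    unfolding c_def by (rule det2_commute)
  moreover have "- det2 (e 1) (Xc (\<phi> z u)) = det2 (X (\<phi> z u)) (e 1)"
    using Xc_eq[OF inR[of u]] u st det2_commute[of "X (\<phi> z u)" "e 1"] by simp
  ultimately have "((\<lambda>t. c (\<phi> z t)) has_real_derivative det2 (X (\<phi> z u)) (e 1)) (at u)"
    by (simp only: has_real_derivative_iff_has_vector_derivative)
  then show "\<exists>y. ((\<lambda>t. c (\<phi> z t)) has_real_derivative y) (at u) \<and> 0 < y"
    using \<rho>[OF near[of u]] u st by (intro exI[of _ "det2 (X (\<phi> z u)) (e 1)"]) auto
next
  show "continuous_on {s..t} (\<lambda>t. c (\<phi> z t))"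
    by (intro continuous_on_c continuous_on_\<phi>) (use st in auto)
qed

lemma l_q: "l 0 q = 0" "det2 (e 0) (z - q) = l 0 z"
  by (simp_all add: q_def) (simp add: l_def pt_def)

lemma section_line:
  assumes "c w = 0"
  shows "w = q + (l 0 w / d 0) *\<^sub>R e 1"
proof -
  have "d 0 *\<^sub>R (w - q) = l 0 w *\<^sub>R e 1 - det2 (e 1) (w - q) *\<^sub>R e 0"
    unfolding d_def l_q(2)[symmetric] One_nat_def by (rule det2_cramer)
  moreover have "det2 (e 1) (w - q) = 0" using assms det2_commute[of "e 1"] by (simp add: c_def)
  ultimately have "d 0 *\<^sub>R (w - q) = l 0 w *\<^sub>R e 1" by simp
  then have "(1 / d 0) *\<^sub>R (d 0 *\<^sub>R (w - q)) = (1 / d 0) *\<^sub>R (l 0 w *\<^sub>R e 1)" by simp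
  then have "w - q = (l 0 w / d 0) *\<^sub>R e 1" using d_pos[of 0] by simp
  then show ?thesis by (simp add: algebra_simps)
qed

text \<open>A turn consists of three phases, separated by the times \<open>T1\<close> and \<open>T2\<close>: away from the transversal, around the
polygon along \<open>A\<close>, which does not contain \<open>q\<close>, and through the transversal from its negative to its positive
side.  The phases are separated because a return has to be excluded in the first two, for different reasons.\<close>
lemma one_turn:
  assumes \<mu>: "0 < \<mu>" "\<mu> < 1/2" and \<epsilon>: "0 < \<epsilon>" "\<epsilon> \<le> 1"
  defines "A \<equiv> pt 0 ` {1/2 + \<mu>..1} \<union> (\<Union>j\<in>{1..n-1}. pt j ` {0..1}) \<union> pt 0 ` {0..1/2 - \<mu>}"
    and "B \<equiv> pt 0 ` {1/2 - \<mu>..1/2 + \<mu>}"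
  shows "\<exists>\<delta>>0. \<forall>z\<in>Inside. dist z q < \<delta> \<longrightarrow> (\<exists>T1 T2 T3. 0 \<le> T1 \<and> T1 \<le> T2 \<and> T2 \<le> T3 \<and>
    0 < c (\<phi> z T1) \<and> c (\<phi> z T2) < 0 \<and> 0 < c (\<phi> z T3) \<and>
    (\<forall>t\<in>{0..T1}. \<exists>y\<in>B. dist (\<phi> z t) y < \<epsilon>) \<and> (\<forall>t\<in>{T1..T2}. \<exists>y\<in>A. dist (\<phi> z t) y < \<epsilon>) \<and>
    (\<forall>t\<in>{T2..T3}. \<exists>y\<in>B. dist (\<phi> z t) y < \<epsilon>) \<and>
    (\<forall>y\<in>A. \<exists>t\<in>{T1..T2}. dist (\<phi> z t) y < \<epsilon>))"
proof -
  have 1: "tracks \<epsilon> (pt 0 ` {1/2..1/2 + \<mu>}) q (pt 0 (1/2 + \<mu>))"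
    unfolding q_def by (rule tracks_edge) (use \<mu> \<epsilon> in auto)
  have "pt n = pt 0" by (rule pt_cong) simp
  then have 2: "tracks \<epsilon> A (pt 0 (1/2 + \<mu>)) (pt 0 (1/2 - \<mu>))"
    using tracks_around[OF \<epsilon>, of "1/2 + \<mu>" "1/2 - \<mu>" "n - 1"] \<mu> n3 unfolding A_def by simp
  have 3: "tracks \<epsilon> B (pt 0 (1/2 - \<mu>)) (pt 0 (1/2 + \<mu>))"
    unfolding B_def by (rule tracks_edge) (use \<mu> \<epsilon> in auto)
  have opn: "open {w. 0 < c w}" "open {w. c w < 0}"
    by (intro open_Collect_less continuous_on_const continuous_on_c continuous_on_id)+
  obtain \<eta>3 where \<eta>3: "\<eta>3 > 0" "\<And>w. dist w (pt 0 (1/2 + \<mu>)) < \<eta>3 \<Longrightarrow> 0 < c w"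
    using opn(1)[unfolded open_dist, rule_format, of "pt 0 (1/2 + \<mu>)"] \<mu> d_pos[of 0] by (auto simp: c_pt)
  obtain \<eta>2 where \<eta>2: "\<eta>2 > 0" "\<And>w. dist w (pt 0 (1/2 - \<mu>)) < \<eta>2 \<Longrightarrow> c w < 0"
    using opn(2)[unfolded open_dist, rule_format, of "pt 0 (1/2 - \<mu>)"] \<mu> d_pos[of 0]
    by (auto simp: c_pt mult_less_0_iff)
  obtain \<delta>3 where \<delta>3: "\<delta>3 > 0" "\<forall>z\<in>Inside. dist z (pt 0 (1/2 - \<mu>)) < \<delta>3 \<longrightarrow>
     (\<exists>T\<ge>0. \<phi> z T \<in> Inside \<and> dist (\<phi> z T) (pt 0 (1/2 + \<mu>)) < \<eta>3 \<and>
        (\<forall>t\<in>{0..T}. \<exists>y\<in>B. dist (\<phi> z t) y < \<epsilon>) \<and> (\<forall>y\<in>B. \<exists>t\<in>{0..T}. dist (\<phi> z t) y < \<epsilon>))"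
    using 3[unfolded tracks_def, THEN spec, THEN mp, OF \<eta>3(1)] by (elim exE conjE) (rule that)
  have m: "min \<delta>3 \<eta>2 > 0" using \<delta>3 \<eta>2 by simp
  obtain \<delta>2 where \<delta>2: "\<delta>2 > 0" "\<forall>z\<in>Inside. dist z (pt 0 (1/2 + \<mu>)) < \<delta>2 \<longrightarrow>
     (\<exists>T\<ge>0. \<phi> z T \<in> Inside \<and> dist (\<phi> z T) (pt 0 (1/2 - \<mu>)) < min \<delta>3 \<eta>2 \<and>
        (\<forall>t\<in>{0..T}. \<exists>y\<in>A. dist (\<phi> z t) y < \<epsilon>) \<and> (\<forall>y\<in>A. \<exists>t\<in>{0..T}. dist (\<phi> z t) y < \<epsilon>))"
    using 2[unfolded tracks_def, THEN spec, THEN mp, OF m] by (elim exE conjE) (rule that)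
  have m: "min \<delta>2 \<eta>3 > 0" using \<delta>2 \<eta>3 by simp
  obtain \<delta>1 where \<delta>1: "\<delta>1 > 0" "\<forall>z\<in>Inside. dist z q < \<delta>1 \<longrightarrow>
     (\<exists>T\<ge>0. \<phi> z T \<in> Inside \<and> dist (\<phi> z T) (pt 0 (1/2 + \<mu>)) < min \<delta>2 \<eta>3 \<and>
        (\<forall>t\<in>{0..T}. \<exists>y\<in>pt 0 ` {1/2..1/2 + \<mu>}. dist (\<phi> z t) y < \<epsilon>) \<and>
        (\<forall>y\<in>pt 0 ` {1/2..1/2 + \<mu>}. \<exists>t\<in>{0..T}. dist (\<phi> z t) y < \<epsilon>))"
    using 1[unfolded tracks_def, THEN spec, THEN mp, OF m] by (elim exE conjE) (rule that)
  show ?thesis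
  proof (rule exI[of _ \<delta>1], intro conjI ballI impI)
    show "\<delta>1 > 0" by (rule \<delta>1(1))
  next
    fix z assume z: "z \<in> Inside" "dist z q < \<delta>1"
    obtain T1 where T1: "T1 \<ge> 0" "\<phi> z T1 \<in> Inside" "dist (\<phi> z T1) (pt 0 (1/2 + \<mu>)) < min \<delta>2 \<eta>3"
      "\<forall>t\<in>{0..T1}. \<exists>y\<in>pt 0 ` {1/2..1/2 + \<mu>}. dist (\<phi> z t) y < \<epsilon>"
      using mp[OF bspec[OF \<delta>1(2) z(1)] z(2)] by (elim exE conjE) (rule that)
    have near2: "dist (\<phi> z T1) (pt 0 (1/2 + \<mu>)) < \<delta>2" using T1(3) by simp
    obtain S2 where S2: "S2 \<ge> 0" "\<phi> (\<phi> z T1) S2 \<in> Inside"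
      "dist (\<phi> (\<phi> z T1) S2) (pt 0 (1/2 - \<mu>)) < min \<delta>3 \<eta>2"
      "\<forall>t\<in>{0..S2}. \<exists>y\<in>A. dist (\<phi> (\<phi> z T1) t) y < \<epsilon>"
      "\<forall>y\<in>A. \<exists>t\<in>{0..S2}. dist (\<phi> (\<phi> z T1) t) y < \<epsilon>"
      using mp[OF bspec[OF \<delta>2(2) T1(2)] near2] by (elim exE conjE) (rule that)
    define T2 where "T2 = T1 + S2"
    have add2: "\<phi> (\<phi> z T1) t = \<phi> z (T1 + t)" if "t \<ge> 0" for t
      using \<phi>_add[of T1 t z] T1(1) that by simp
    have near3: "dist (\<phi> z T2) (pt 0 (1/2 - \<mu>)) < \<delta>3" "\<phi> z T2 \<in> Inside" "c (\<phi> z T2) < 0"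
      using S2(1-3) add2[of S2] \<eta>2(2) by (auto simp: T2_def)
    obtain S3 where S3: "S3 \<ge> 0" "dist (\<phi> (\<phi> z T2) S3) (pt 0 (1/2 + \<mu>)) < \<eta>3"
      "\<forall>t\<in>{0..S3}. \<exists>y\<in>B. dist (\<phi> (\<phi> z T2) t) y < \<epsilon>"
      using mp[OF bspec[OF \<delta>3(2) near3(2)] near3(1)] by (elim exE conjE) (rule that)
    define T3 where "T3 = T2 + S3"
    have add3: "\<phi> (\<phi> z T2) t = \<phi> z (T2 + t)" if "t \<ge> 0" for t
      using \<phi>_add[of T2 t z] T1(1) S2(1) that by (simp add: T2_def)
    show "\<exists>T1 T2 T3. 0 \<le> T1 \<and> T1 \<le> T2 \<and> T2 \<le> T3 \<and>
      0 < c (\<phi> z T1) \<and> c (\<phi> z T2) < 0 \<and> 0 < c (\<phi> z T3) \<and>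
      (\<forall>t\<in>{0..T1}. \<exists>y\<in>B. dist (\<phi> z t) y < \<epsilon>) \<and> (\<forall>t\<in>{T1..T2}. \<exists>y\<in>A. dist (\<phi> z t) y < \<epsilon>) \<and>
      (\<forall>t\<in>{T2..T3}. \<exists>y\<in>B. dist (\<phi> z t) y < \<epsilon>) \<and>
      (\<forall>y\<in>A. \<exists>t\<in>{T1..T2}. dist (\<phi> z t) y < \<epsilon>)"
    proof (intro exI conjI)
      show "0 \<le> T1" "T1 \<le> T2" "T2 \<le> T3" using T1 S2 S3 by (auto simp: T2_def T3_def)
      show "0 < c (\<phi> z T1)" using \<eta>3(2) T1(3) by simp
      show "c (\<phi> z T2) < 0" by (rule near3(3))
      show "0 < c (\<phi> z T3)" using \<eta>3(2)[OF S3(2)] add3[of S3] S3(1) by (simp add: T3_def)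
      have "pt 0 ` {1/2..1/2 + \<mu>} \<subseteq> B" unfolding B_def using \<mu> by (intro image_mono) auto
      then show "\<forall>t\<in>{0..T1}. \<exists>y\<in>B. dist (\<phi> z t) y < \<epsilon>" using T1(4) by (meson subsetD)
      show "\<forall>t\<in>{T1..T2}. \<exists>y\<in>A. dist (\<phi> z t) y < \<epsilon>"
      proof
        fix t assume t: "t \<in> {T1..T2}"
        then have "t - T1 \<in> {0..S2}" by (auto simp: T2_def)
        from bspec[OF S2(4) this] show "\<exists>y\<in>A. dist (\<phi> z t) y < \<epsilon>" using add2[of "t - T1"] t by simp
      qed
      show "\<forall>t\<in>{T2..T3}. \<exists>y\<in>B. dist (\<phi> z t) y < \<epsilon>"
      proof
        fix t assume t: "t \<in> {T2..T3}"
        then have "t - T2 \<in> {0..S3}" by (auto simp: T3_def)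
        from bspec[OF S3(3) this] show "\<exists>y\<in>B. dist (\<phi> z t) y < \<epsilon>" using add3[of "t - T2"] t by simp
      qed
      show "\<forall>y\<in>A. \<exists>t\<in>{T1..T2}. dist (\<phi> z t) y < \<epsilon>"
      proof
        fix y assume "y \<in> A"
        from bspec[OF S2(5) this] obtain t where "t \<in> {0..S2}" "dist (\<phi> (\<phi> z T1) t) y < \<epsilon>" by (rule bexE)
        then show "\<exists>t\<in>{T1..T2}. dist (\<phi> z t) y < \<epsilon>"
          using add2[of t] by (intro bexI[of _ "T1 + t"]) (auto simp: T2_def)
      qed
    qed
  qed
qed

text \<open>In the first phase \<open>c\<close> is positive, since it starts at 0 and increases; in the second the orbit is closer to \<open>A\<close> than
the transversal is; in the third \<open>c\<close> increases from a negative to a positive value.  So the unique zero of \<open>c\<close> in the third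
phase is the first return to the line of the transversal, and it is on the transversal itself since the orbit is
inside the polygon and near \<open>q\<close>.\<close>
theorem polygon_first_return_map: "has_first_return_map X \<Gamma>"
proof -
  obtain \<rho> where \<rho>: "\<rho> > 0" and transversal: "\<And>w. dist q w < \<rho> \<Longrightarrow> 0 < det2 (X w) (e 1)"
    and other_lines: "\<And>w j. dist q w < \<rho> \<Longrightarrow> 0 < j \<Longrightarrow> j < n \<Longrightarrow> 0 < l j w"
    using section_neighbourhood by blast
  \<comment> \<open>The transversal has half the length of the radius in which the field is transversal.\<close>
  define \<kappa> where "\<kappa> = \<rho> / (2 * norm (e 1))"
  define v where "v = \<kappa> *\<^sub>R e 1"
  have e1: "norm (e 1) > 0" "norm (e 0) > 0" using e_nonzero by auto
  have \<kappa>: "\<kappa> > 0" using \<rho> e1 by (simp add: \<kappa>_def)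
  have norm_v: "norm v = \<rho> / 2" using \<rho> e1 by (simp add: v_def \<kappa>_def)
  define S where "S = (\<lambda>s. q + s *\<^sub>R v) ` {0<..1}"
  have dist_S: "dist q (q + s *\<^sub>R v) = \<bar>s\<bar> * (\<rho> / 2)" for s by (simp add: dist_norm norm_v)
  have near_S: "dist q (q + s *\<^sub>R v) < \<rho>" if "0 \<le> s" "s \<le> 1" for s
    using that \<rho> mult_right_mono[of s 1 "\<rho> / 2"] by (simp add: dist_S)
  have c_S: "c (q + s *\<^sub>R v) = 0" for s by (simp add: c_def v_def)
  have S_Inside: "q + s *\<^sub>R v \<in> Inside" if s: "0 < s" "s \<le> 1" for s
  proof -
    have "det2 (e 0) ((q + s *\<^sub>R v) - q) = s * \<kappa> * d 0" by (simp add: v_def d_def)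
    then have "0 < l 0 (q + s *\<^sub>R v)" using s \<kappa> d_pos[of 0] unfolding l_q(2) by simp
    then show ?thesis
      unfolding Inside_iff using other_lines[OF near_S[of s]] s by (metis gr0I less_imp_le)
  qed
  have "q \<in> \<Gamma>" unfolding q_def by (rule pt_on_\<Gamma>) auto
  moreover have "\<forall>z\<in>insert q S. transversal_to X z v"
  proof
    fix z assume "z \<in> insert q S"
    then obtain s where s: "z = q + s *\<^sub>R v" "0 \<le> s" "s \<le> 1" by (force simp: S_def)
    have "0 < det2 (X z) (e 1)" using transversal near_S s by auto
    then have "det2 (X z) v \<noteq> 0" using \<kappa> by (simp add: v_def)
    then show "transversal_to X z v" by (simp add: transversal_to_def det2_def)
  qed
  moreover have "S \<inter> \<Gamma> = {}"
  proof -
    have "S \<subseteq> Inside" unfolding S_def using S_Inside by (intro image_subsetI) simp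
    then show ?thesis using Inside_not_on_\<Gamma> by blast
  qed
  moreover have "\<forall>\<^sub>F s in at_right 0. \<exists>T x.
           first_return X S (q + s *\<^sub>R v) T x \<and>
           (\<forall>t\<in>{0..T}. infdist (x t) \<Gamma> < \<epsilon>) \<and>
           (\<forall>y\<in>\<Gamma>. infdist y (x ` {0..T}) < \<epsilon>)" if \<epsilon>: "\<epsilon> > 0" for \<epsilon>
  proof -
    define m where "m = min \<epsilon> (\<rho> / 2)"
    have m: "m > 0" "m \<le> \<epsilon>" "m \<le> \<rho> / 2" using \<epsilon> \<rho> by (auto simp: m_def)
    \<comment> \<open>The piece \<open>B\<close> of the edge around \<open>q\<close> is so short that the starting point is close to all of it: the returning orbit stops at the transversal and need not trace \<open>B\<close> again.\<close>
    define \<mu> where "\<mu> = min (1/4) (m / (4 * norm (e 0)))"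
    have \<mu>: "0 < \<mu>" "\<mu> < 1/2" using m e1 by (auto simp: \<mu>_def)
    have "\<mu> \<le> m / (4 * norm (e 0))" unfolding \<mu>_def by (rule min.cobounded2)
    then have \<mu>m: "\<mu> * norm (e 0) \<le> m / 4" using e1 by (simp add: field_simps)
    define A where "A = pt 0 ` {1/2 + \<mu>..1} \<union> (\<Union>j\<in>{1..n-1}. pt j ` {0..1}) \<union> pt 0 ` {0..1/2 - \<mu>}"
    define B where "B = pt 0 ` {1/2 - \<mu>..1/2 + \<mu>}"
    have "A \<subseteq> \<Gamma>" unfolding A_def using \<mu> by (auto intro!: pt_on_\<Gamma>)
    have "B \<subseteq> \<Gamma>" unfolding B_def using \<mu> by (auto intro!: pt_on_\<Gamma>)
    have cont_pt: "continuous_on I (pt j)" for I j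
      unfolding pt_def by (intro continuous_intros)
    have "compact A" unfolding A_def
      by (intro compact_Un compact_UN compact_continuous_image cont_pt) auto
    \<comment> \<open>The closed transversal has a positive distance \<open>\<sigma>\<close> from \<open>A\<close>.\<close>
    define S0 where "S0 = (\<lambda>s. q + s *\<^sub>R v) ` {0..1}"
    have "compact S0" unfolding S0_def
      by (intro compact_continuous_image continuous_intros) auto
    have "q \<notin> A"
    proof
      assume "q \<in> A"
      moreover have "q \<notin> pt j ` {0..1}" if j: "j \<in> {1..n-1}" for j
      proof
        assume "q \<in> pt j ` {0..1}"
        then have "l j q = 0" by auto
        moreover have "0 < l j q" using other_lines[of q j] j \<rho> by auto
        ultimately show False by simp
      qed
      moreover have "q \<notin> pt 0 ` I" if "1/2 \<notin> I" for I
      proof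
        assume "q \<in> pt 0 ` I"
        then obtain u where "u \<in> I" "q = pt 0 u" by blast
        moreover have "u = 1/2"
          using dist_pt[of 0 "1/2" u] e1(2) \<open>q = pt 0 u\<close> by (auto simp: q_def)
        ultimately show False using that by simp
      qed
      then have "q \<notin> pt 0 ` {1/2 + \<mu>..1}" "q \<notin> pt 0 ` {0..1/2 - \<mu>}" using \<mu> by simp_all
      ultimately show False unfolding A_def by blast
    qed
    moreover have "q + s *\<^sub>R v \<notin> A" if "0 < s" "s \<le> 1" for s
      using S_Inside[OF that] Inside_not_on_\<Gamma> \<open>A \<subseteq> \<Gamma>\<close> by blast
    ultimately have "S0 \<inter> A = {}" unfolding S0_def
      by (auto simp: less_le) (metis add.right_neutral scaleR_zero_left)
    then obtain \<sigma> where \<sigma>: "\<sigma> > 0" "\<And>x y. x \<in> S0 \<Longrightarrow> y \<in> A \<Longrightarrow> \<sigma> \<le> dist x y"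
      using separate_compact_closed[OF \<open>compact S0\<close> compact_imp_closed[OF \<open>compact A\<close>]] by blast
    have "S \<subseteq> S0" by (auto simp: S_def S0_def)
    define \<epsilon>' where "\<epsilon>' = min (m / 4) (min \<sigma> 1)"
    have \<epsilon>': "0 < \<epsilon>'" "\<epsilon>' \<le> 1" "\<epsilon>' \<le> m / 4" "\<epsilon>' \<le> \<sigma>" using m \<sigma>(1) by (auto simp: \<epsilon>'_def)
    obtain \<delta> where \<delta>: "\<delta> > 0" and turn: "\<forall>z\<in>Inside. dist z q < \<delta> \<longrightarrow> (\<exists>T1 T2 T3. 0 \<le> T1 \<and> T1 \<le> T2 \<and> T2 \<le> T3 \<and>
      0 < c (\<phi> z T1) \<and> c (\<phi> z T2) < 0 \<and> 0 < c (\<phi> z T3) \<and>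
      (\<forall>t\<in>{0..T1}. \<exists>y\<in>B. dist (\<phi> z t) y < \<epsilon>') \<and> (\<forall>t\<in>{T1..T2}. \<exists>y\<in>A. dist (\<phi> z t) y < \<epsilon>') \<and>
      (\<forall>t\<in>{T2..T3}. \<exists>y\<in>B. dist (\<phi> z t) y < \<epsilon>') \<and>
      (\<forall>y\<in>A. \<exists>t\<in>{T1..T2}. dist (\<phi> z t) y < \<epsilon>'))"
      using one_turn[OF \<mu> \<epsilon>'(1,2)] unfolding A_def[symmetric] B_def[symmetric] by (elim exE conjE) (rule that)
    have B_near: "dist q y \<le> m / 4" if yB: "y \<in> B" for y
    proof -
      obtain u where u': "u \<in> {1/2 - \<mu>..1/2 + \<mu>}" and u: "y = pt 0 u" using yB unfolding B_def by blast
      then have "\<bar>1/2 - u\<bar> \<le> \<mu>" by auto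
      note u = u this
      have "dist q y \<le> \<mu> * norm (e 0)" unfolding q_def u(1) dist_pt using u(2) by (intro mult_right_mono) auto
      then show ?thesis using \<mu>m by simp
    qed
    have "\<forall>\<^sub>F s in at_right 0. 0 < s \<and> s < min 1 (min (\<delta> / (\<rho> / 2)) (m / 4 / (\<rho> / 2)))"
      using \<delta> \<rho> m unfolding eventually_at_right_field by (intro exI[of _ "min 1 (min (\<delta> / (\<rho> / 2)) (m / 4 / (\<rho> / 2)))"]) auto
    then show ?thesis
    proof eventually_elim
      case (elim s)
      define z where "z = q + s *\<^sub>R v"
      have s: "0 < s" "s \<le> 1" "s * (\<rho> / 2) < \<delta>" "s * (\<rho> / 2) < m / 4"
        using elim \<rho> by (auto simp: field_simps)
      have "dist z q = s * (\<rho> / 2)" using dist_S[of s] s by (simp add: z_def dist_commute)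
      then have z: "z \<in> Inside" "dist z q < \<delta>" "dist z q < m / 4" "c z = 0"
        using S_Inside[of s] s c_S[of s] by (simp_all only: z_def)
      obtain T1 T2 T3 where T: "0 \<le> T1" "T1 \<le> T2" "T2 \<le> T3"
        and c: "0 < c (\<phi> z T1)" "c (\<phi> z T2) < 0" "0 < c (\<phi> z T3)"
        and close1: "\<forall>t\<in>{0..T1}. \<exists>y\<in>B. dist (\<phi> z t) y < \<epsilon>'"
        and close2: "\<forall>t\<in>{T1..T2}. \<exists>y\<in>A. dist (\<phi> z t) y < \<epsilon>'"
        and close3: "\<forall>t\<in>{T2..T3}. \<exists>y\<in>B. dist (\<phi> z t) y < \<epsilon>'"
        and dense: "\<forall>y\<in>A. \<exists>t\<in>{T1..T2}. dist (\<phi> z t) y < \<epsilon>'"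
        using mp[OF bspec[OF turn z(1)] z(2)] by (elim exE conjE) (rule that)
      have close: "\<exists>y\<in>\<Gamma>. dist (\<phi> z t) y < \<epsilon>'" if t: "t \<in> {0..T3}" for t
      proof -
        consider "t \<in> {0..T1}" | "t \<in> {T1..T2}" | "t \<in> {T2..T3}" using t by fastforce
        then have "\<exists>y\<in>A \<union> B. dist (\<phi> z t) y < \<epsilon>'"
        proof cases
          case 1 from bspec[OF close1 this] show ?thesis by (rule bexE) (rule bexI, assumption, simp)
        next
          case 2 from bspec[OF close2 this] show ?thesis by (rule bexE) (rule bexI, assumption, simp)
        next
          case 3 from bspec[OF close3 this] show ?thesis by (rule bexE) (rule bexI, assumption, simp)
        qed
        then show ?thesis using \<open>A \<subseteq> \<Gamma>\<close> \<open>B \<subseteq> \<Gamma>\<close> by (elim bexE) (rule bexI, assumption, auto)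
      qed
      have inR: "\<phi> z t \<in> cball 0 radius" if "t \<in> {0..T3}" for t
      proof -
        from close[OF that] obtain y where "y \<in> \<Gamma>" "dist (\<phi> z t) y < \<epsilon>'" by (rule bexE)
        then show ?thesis using \<epsilon>' by (intro radius(2)[of y]) (auto simp: dist_commute)
      qed
      have near: "dist q (\<phi> z t) < \<rho> / 2" if t: "t \<in> {0..T1} \<or> t \<in> {T2..T3}" for t
      proof -
        have "\<exists>y\<in>B. dist (\<phi> z t) y < \<epsilon>'"
          using t by (elim disjE) (rule bspec[OF close1], assumption, rule bspec[OF close3], assumption)
        then obtain y where y: "y \<in> B" "dist (\<phi> z t) y < \<epsilon>'" by (rule bexE)
        have "dist q (\<phi> z t) \<le> dist q y + dist (\<phi> z t) y" by (rule dist_triangle2)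
        also have "\<dots> < m / 4 + m / 4" using B_near[OF y(1)] y(2) \<epsilon>'(3) by linarith
        also have "\<dots> \<le> \<rho> / 2" using m by linarith
        finally show ?thesis .
      qed
      have incr1: "c (\<phi> z t) < c (\<phi> z t')" if "0 \<le> t" "t < t'" "t' \<le> T1" for t t'
        by (rule c_increasing[where \<rho> = \<rho> and T = T1])
           (use that transversal near inR T \<rho> in \<open>force+\<close>)
      have incr3: "c (\<phi> z t) < c (\<phi> z t')" if tt: "T2 \<le> t" "t < t'" "t' \<le> T3" for t t'
      proof -
        have shift: "\<phi> (\<phi> z T2) u = \<phi> z (T2 + u)" if "u \<ge> 0" for u
          using \<phi>_add[of T2 u z] T that by simp
        have "c (\<phi> (\<phi> z T2) (t - T2)) < c (\<phi> (\<phi> z T2) (t' - T2))"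
        proof (rule c_increasing[where \<rho> = \<rho> and T = "T3 - T2"])
          fix u assume u: "u \<in> {0..T3 - T2}"
          then show "dist q (\<phi> (\<phi> z T2) u) < \<rho>"
            using near[of "T2 + u"] shift[of u] \<rho> by auto
          show "\<phi> (\<phi> z T2) u \<in> cball 0 radius"
            using inR[of "T2 + u"] shift[of u] u T by auto
        qed (use tt transversal in auto)
        then show ?thesis using shift tt by simp
      qed
      obtain \<tau> where \<tau>: "T2 \<le> \<tau>" "\<tau> \<le> T3" "c (\<phi> z \<tau>) = 0"
        using IVT'[of "\<lambda>t. c (\<phi> z t)" T2 0 T3] c T continuous_on_c[OF continuous_on_\<phi>[of "{T2..T3}" z]]
        by force
      have "T1 \<noteq> 0" using c(1) z(4) \<phi>(1)[of z] by auto
      then have \<tau>pos: "0 < \<tau>" using T \<tau> by simp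
      have sol: "solution_on X {0..\<tau>} (\<phi> z)" by (rule \<phi>_solution) (use inR \<tau> in auto)
      have "\<phi> z \<tau> \<in> Inside" by (rule \<phi>_Inside[OF z(1)]) (use inR \<tau> \<tau>pos in auto)
      have "\<phi> z \<tau> \<in> S"
      proof -
        define u where "u = l 0 (\<phi> z \<tau>) / d 0 / \<kappa>"
        have "u > 0" using \<open>\<phi> z \<tau> \<in> Inside\<close> d_pos[of 0] \<kappa> by (simp add: u_def Inside_def)
        have eq: "\<phi> z \<tau> = q + u *\<^sub>R v"
          using section_line[OF \<tau>(3)] \<kappa> by (simp add: u_def v_def)
        have "u * (\<rho> / 2) < 1 * (\<rho> / 2)"
          using near[of \<tau>] \<tau> dist_S[of u] \<open>u > 0\<close> by (simp flip: eq)
        then have "u < 1" using \<rho> by simp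
        then show ?thesis unfolding S_def eq using \<open>u > 0\<close> by auto
      qed
      moreover have "\<phi> z t \<notin> S" if t: "0 < t" "t < \<tau>" for t
      proof (cases "t \<in> {T1..T2}")
        case True
        from bspec[OF close2 this] obtain y where "y \<in> A" "dist (\<phi> z t) y < \<epsilon>'" by (rule bexE)
        moreover from this have "\<phi> z t \<in> S \<Longrightarrow> \<sigma> \<le> dist (\<phi> z t) y"
          using \<sigma>(2) subsetD[OF \<open>S \<subseteq> S0\<close>] by blast
        ultimately show ?thesis using \<epsilon>'(4) by linarith
      next
        case False
        then have "t < T1 \<or> T2 < t" by auto
        then have "c (\<phi> z t) \<noteq> 0"
        proof
          assume "t < T1"
          then show ?thesis using incr1[of 0 t] t z(4) by (simp add: \<phi>(1))
        next
          assume "T2 < t"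
          then show ?thesis using incr3[of t \<tau>] t \<tau> by simp
        qed
        then show ?thesis using c_S by (auto simp: S_def)
      qed
      ultimately have ret: "first_return X S z \<tau> (\<phi> z)"
        unfolding first_return_def using \<tau>pos sol \<phi>(1) by blast
      have "infdist (\<phi> z t) \<Gamma> < \<epsilon>" if "t \<in> {0..\<tau>}" for t
      proof -
        have "t \<in> {0..T3}" using that \<tau> by simp
        from close[OF this] obtain y where "y \<in> \<Gamma>" "dist (\<phi> z t) y < \<epsilon>'" by (rule bexE)
        then show ?thesis using infdist_le[of y \<Gamma> "\<phi> z t"] \<epsilon>' m by linarith
      qed
      moreover have "infdist y (\<phi> z ` {0..\<tau>}) < \<epsilon>" if y: "y \<in> \<Gamma>" for y
      proof -
        obtain i u where iu: "i < n" "0 \<le> u" "u \<le> 1" "y = pt i u" using y by (auto simp: \<Gamma>_def)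
        have "y \<in> A \<or> y \<in> B"
        proof (cases "i = 0")
          case True
          then show ?thesis using iu unfolding A_def B_def by (cases "u \<le> 1/2 - \<mu>"; cases "u \<ge> 1/2 + \<mu>") auto
        next
          case False
          then have "i \<in> {1..n-1}" "y \<in> pt i ` {0..1}" using iu by auto
          then show ?thesis unfolding A_def by blast
        qed
        then have "\<exists>t\<in>{0..\<tau>}. dist (\<phi> z t) y < \<epsilon>"
        proof
          assume "y \<in> A"
          from bspec[OF dense this] obtain t where "t \<in> {T1..T2}" "dist (\<phi> z t) y < \<epsilon>'" by (rule bexE)
          then show ?thesis using T \<tau> \<epsilon>' m by (intro bexI[of _ t]) auto
        next
          assume "y \<in> B"
          then have "dist z y < \<epsilon>"
            using B_near[of y] z(3) dist_triangle[of z y q] m by linarith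
          then show ?thesis using \<tau>pos by (intro bexI[of _ 0]) (auto simp: \<phi>(1))
        qed
        then obtain t where "t \<in> {0..\<tau>}" "dist (\<phi> z t) y < \<epsilon>" by (rule bexE)
        then show ?thesis
          using infdist_le[of "\<phi> z t" "\<phi> z ` {0..\<tau>}" y] by (simp add: dist_commute)
      qed
      ultimately show ?case using ret unfolding z_def by blast
    qed
  qed
  ultimately show ?thesis
    unfolding has_first_return_map_def using S_def by blast
qed

end

section \<open>Polynomials in two variables\<close>
definition affine :: "real \<Rightarrow> real \<Rightarrow> real \<Rightarrow> real poly poly" where
  "affine a b c = [:[:c, a:], [:b:]:]"

lemma eval2_affine [simp]: "eval2 (affine a b c) z = c + a * fst z + b * snd z"
  by (simp add: eval2_def affine_def)

lemma eval2_simps [simp]: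
  "eval2 (F + G) z = eval2 F z + eval2 G z" "eval2 (F * G) z = eval2 F z * eval2 G z"
  "eval2 0 z = 0" "eval2 1 z = 1"
  by (simp_all add: eval2_def)

lemma eval2_sum: "eval2 (\<Sum>i\<in>A. F i) z = (\<Sum>i\<in>A. eval2 (F i) z)"
  by (induction A rule: infinite_finite_induct) auto

lemma eval2_prod: "eval2 (\<Prod>i\<in>A. F i) z = (\<Prod>i\<in>A. eval2 (F i) z)"
  by (induction A rule: infinite_finite_induct) auto

lemma eval2_pCons: "eval2 (pCons a F) z = poly a (fst z) + snd z * eval2 F z"
  by (simp add: eval2_def)

text \<open>The total degree is the least bound for the degrees of the monomials that occur; this lemma and the next replace
the maximum over coefficient polynomials in its definition.\<close>
lemma total_degree_leI:
  assumes "\<And>i j. coeff (coeff F j) i \<noteq> 0 \<Longrightarrow> i + j \<le> m"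
  shows "total_degree F \<le> m"
  unfolding total_degree_def
proof (rule Max.boundedI)
  fix k assume "k \<in> (\<lambda>j. if coeff F j = 0 then 0 else degree (coeff F j) + j) ` {..degree F}"
  then obtain j where k: "k = (if coeff F j = 0 then 0 else degree (coeff F j) + j)" by blast
  show "k \<le> m"
    using assms[of j "degree (coeff F j)"] k by (auto split: if_splits)
qed auto

lemma total_degree_coeff:
  assumes "coeff (coeff F j) i \<noteq> 0"
  shows "i + j \<le> total_degree F"
proof -
  have nz: "coeff F j \<noteq> 0" using assms by auto
  have "degree (coeff F j) + j \<in> (\<lambda>j. if coeff F j = 0 then 0 else degree (coeff F j) + j) ` {..degree F}"
    using nz by (intro image_eqI[of _ _ j]) (auto simp: le_degree)
  then have "degree (coeff F j) + j \<le> total_degree F"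
    unfolding total_degree_def by (intro Max_ge) auto
  moreover have "i \<le> degree (coeff F j)" using assms by (rule le_degree)
  ultimately show ?thesis by simp
qed

lemma total_degree_add:
  assumes "total_degree F \<le> m" "total_degree G \<le> m"
  shows "total_degree (F + G) \<le> m"
proof (rule total_degree_leI)
  fix i j assume "coeff (coeff (F + G) j) i \<noteq> 0"
  then have "coeff (coeff F j) i \<noteq> 0 \<or> coeff (coeff G j) i \<noteq> 0" by auto
  then show "i + j \<le> m"
    using total_degree_coeff[of F j i] total_degree_coeff[of G j i] assms by auto
qed

lemma total_degree_mult: "total_degree (F * G) \<le> total_degree F + total_degree G"
proof (rule total_degree_leI)
  fix i j assume "coeff (coeff (F * G) j) i \<noteq> 0"
  then have "(\<Sum>k\<le>j. \<Sum>h\<le>i. coeff (coeff F k) h * coeff (coeff G (j - k)) (i - h)) \<noteq> 0"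
    by (simp add: coeff_mult coeff_sum)
  then obtain k where k: "k \<le> j" "(\<Sum>h\<le>i. coeff (coeff F k) h * coeff (coeff G (j - k)) (i - h)) \<noteq> 0"
    by (meson atMost_iff sum.not_neutral_contains_not_neutral)
  then obtain h where h: "h \<le> i" "coeff (coeff F k) h * coeff (coeff G (j - k)) (i - h) \<noteq> 0"
    by (meson atMost_iff sum.not_neutral_contains_not_neutral)
  then have "h + k \<le> total_degree F" "(i - h) + (j - k) \<le> total_degree G"
    by (simp_all add: total_degree_coeff del: Nat.add_diff_assoc2 Nat.add_diff_assoc Nat.diff_add_assoc2)
  then show "i + j \<le> total_degree F + total_degree G" using k h by simp
qed

lemma total_degree_const: "total_degree [:[:c:]:] = 0"
proof -
  have "total_degree [:[:c:]:] \<le> 0"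
    by (rule total_degree_leI) (auto simp: coeff_pCons split: nat.splits)
  then show ?thesis by simp
qed

lemma total_degree_affine: "total_degree (affine a b c) \<le> 1"
  by (rule total_degree_leI) (auto simp: affine_def coeff_pCons split: nat.splits if_splits)

lemma total_degree_sum:
  "(\<And>i. i \<in> A \<Longrightarrow> total_degree (F i) \<le> m) \<Longrightarrow> total_degree (\<Sum>i\<in>A. F i) \<le> m"
  using total_degree_const[of 0]
  by (induction A rule: infinite_finite_induct) (auto intro: total_degree_add)

lemma total_degree_prod_affine:
  "finite A \<Longrightarrow> total_degree (\<Prod>i\<in>A. affine (a i) (b i) (c i)) \<le> card A"
proof (induction A rule: finite_induct)
  case empty
  then show ?case using total_degree_const[of 1] by (simp add: one_pCons)
next
  case (insert x A)
  then show ?case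
    using total_degree_mult[of "affine (a x) (b x) (c x)" "\<Prod>i\<in>A. affine (a i) (b i) (c i)"]
      total_degree_affine[of "a x" "b x" "c x"] by simp
qed

lemma lipschitz_on_balls_const: "lipschitz_on_balls (\<lambda>z. c)"
  unfolding lipschitz_on_balls_def by (auto intro: exI[of _ 0] lipschitz_on_constant)

lemma lipschitz_on_balls_add:
  fixes f g :: "'a::real_normed_vector \<Rightarrow> 'b::real_normed_vector"
  assumes "lipschitz_on_balls f" "lipschitz_on_balls g"
  shows "lipschitz_on_balls (\<lambda>z. f z + g z)"
  unfolding lipschitz_on_balls_def
proof
  fix R
  obtain L M where "L-lipschitz_on (cball 0 R) f" "M-lipschitz_on (cball 0 R) g"
    using assms unfolding lipschitz_on_balls_def by blast
  then show "\<exists>L. L-lipschitz_on (cball 0 R) (\<lambda>z. f z + g z)"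
    by (blast intro: lipschitz_on_add)
qed

lemma lipschitz_on_balls_bounded:
  assumes "lipschitz_on_balls (f :: 'a::real_normed_vector \<Rightarrow> 'b::real_normed_vector)"
  shows "\<exists>B\<ge>0. \<forall>z\<in>cball 0 R. norm (f z) \<le> B"
proof (cases "R < 0")
  case False
  obtain L where L: "L-lipschitz_on (cball 0 R) f"
    using assms unfolding lipschitz_on_balls_def by blast
  have "norm (f z) \<le> norm (f 0) + L * R" if "z \<in> cball 0 R" for z
  proof -
    have "dist (f z) (f 0) \<le> L * dist z 0" by (rule lipschitz_onD[OF L that]) (use False in auto)
    also have "\<dots> \<le> L * R" using that lipschitz_on_nonneg[OF L] by (intro mult_left_mono) auto
    finally show ?thesis using norm_triangle_ineq2[of "f z" "f 0"] by (simp add: dist_norm)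
  qed
  then show ?thesis
    using lipschitz_on_nonneg[OF L] False by (intro exI[of _ "norm (f 0) + L * R"]) auto
qed auto

lemma lipschitz_on_balls_mult:
  fixes f g :: "'a::real_normed_vector \<Rightarrow> real"
  assumes "lipschitz_on_balls f" "lipschitz_on_balls g"
  shows "lipschitz_on_balls (\<lambda>z. f z * g z)"
  unfolding lipschitz_on_balls_def
proof
  fix R
  obtain L M where L: "L-lipschitz_on (cball 0 R) f" and M: "M-lipschitz_on (cball 0 R) g"
    using assms unfolding lipschitz_on_balls_def by blast
  obtain A where A: "A \<ge> 0" "\<And>z. z \<in> cball 0 R \<Longrightarrow> norm (f z) \<le> A"
    using lipschitz_on_balls_bounded[OF assms(1)] by blast
  obtain B where B: "B \<ge> 0" "\<And>z. z \<in> cball 0 R \<Longrightarrow> norm (g z) \<le> B"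
    using lipschitz_on_balls_bounded[OF assms(2)] by blast
  have "(A * M + L * B)-lipschitz_on (cball 0 R) (\<lambda>z. f z * g z)"
  proof (rule lipschitz_onI)
    fix x y :: 'a assume xy: "x \<in> cball 0 R" "y \<in> cball 0 R"
    have "f x * g x - f y * g y = f x * (g x - g y) + (f x - f y) * g y" by (simp add: algebra_simps)
    then have "dist (f x * g x) (f y * g y) \<le> norm (f x) * dist (g x) (g y) + dist (f x) (f y) * norm (g y)"
      using norm_triangle_ineq[of "f x * (g x - g y)" "(f x - f y) * g y"] by (simp add: dist_norm abs_mult)
    also have "\<dots> \<le> A * (M * dist x y) + L * dist x y * B"
      using A B xy lipschitz_onD[OF L xy] lipschitz_onD[OF M xy] lipschitz_on_nonneg[OF L]
      by (intro add_mono mult_mono) auto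
    finally show "dist (f x * g x) (f y * g y) \<le> (A * M + L * B) * dist x y" by (simp add: algebra_simps)
  qed (use A B lipschitz_on_nonneg[OF L] lipschitz_on_nonneg[OF M] in auto)
  then show "\<exists>L. L-lipschitz_on (cball 0 R) (\<lambda>z. f z * g z)" by blast
qed

lemma lipschitz_on_balls_Pair:
  fixes f g :: "'a::real_normed_vector \<Rightarrow> real"
  assumes "lipschitz_on_balls f" "lipschitz_on_balls g"
  shows "lipschitz_on_balls (\<lambda>z. (f z, g z))"
  unfolding lipschitz_on_balls_def
proof
  fix R
  obtain L M where L: "L-lipschitz_on (cball 0 R) f" and M: "M-lipschitz_on (cball 0 R) g"
    using assms unfolding lipschitz_on_balls_def by blast
  then show "\<exists>L. L-lipschitz_on (cball 0 R) (\<lambda>z. (f z, g z))"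
    by (blast intro: lipschitz_on_Pair)
qed

lemma lipschitz_on_balls_fst: "lipschitz_on_balls (fst :: real \<times> real \<Rightarrow> real)"
  and lipschitz_on_balls_snd: "lipschitz_on_balls (snd :: real \<times> real \<Rightarrow> real)"
  unfolding lipschitz_on_balls_def
  by (intro allI exI[of _ 1] lipschitz_onI; simp add: dist_fst_le dist_snd_le)+

lemma lipschitz_on_balls_eval2: "lipschitz_on_balls (eval2 F)"
proof -
  have poly: "lipschitz_on_balls (\<lambda>z::real \<times> real. poly a (fst z))" for a
    by (induction a) (auto intro!: lipschitz_on_balls_add lipschitz_on_balls_mult
        lipschitz_on_balls_const lipschitz_on_balls_fst)
  have "lipschitz_on_balls (\<lambda>z. eval2 F z)"
    by (induction F) (auto simp: eval2_pCons intro!: lipschitz_on_balls_add lipschitz_on_balls_mult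
        lipschitz_on_balls_const lipschitz_on_balls_snd poly)
  then show ?thesis .
qed

lemma eval2_differentiable: "eval2 F differentiable (at z)"
proof -
  have fst: "fst differentiable (at z)" and snd: "snd differentiable (at z)"
    by (simp_all add: bounded_linear_imp_differentiable bounded_linear_fst bounded_linear_snd)
  have poly: "(\<lambda>z::real \<times> real. poly a (fst z)) differentiable (at z)" for a
  proof (induction a)
    case (pCons c a)
    then show ?case by (auto intro!: differentiable_add differentiable_mult fst)
  qed auto
  have "(\<lambda>z. eval2 F z) differentiable (at z)"
  proof (induction F)
    case (pCons c F)
    then show ?case by (auto simp: eval2_pCons intro!: differentiable_add differentiable_mult poly snd)
  qed auto
  then show ?thesis .
qed

lemma poly_vf_lipschitz: "lipschitz_on_balls (poly_vf P Q)"
proof -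
  have "lipschitz_on_balls (\<lambda>z. (eval2 P z, eval2 Q z))"
    by (intro lipschitz_on_balls_Pair lipschitz_on_balls_eval2)
  then show ?thesis by (simp add: poly_vf_def[abs_def])
qed

lemma poly_vf_differentiable: "poly_vf P Q differentiable (at z)"
proof -
  obtain P' Q' where "(eval2 P has_derivative P') (at z)" "(eval2 Q has_derivative Q') (at z)"
    using eval2_differentiable unfolding differentiable_def by blast
  then have "((\<lambda>z. (eval2 P z, eval2 Q z)) has_derivative (\<lambda>h. (P' h, Q' h))) (at z)"
    by (rule has_derivative_Pair)
  then show ?thesis unfolding differentiable_def poly_vf_def[abs_def] by blast
qed

section \<open>Eigenvalues at the vertices\<close>

context polygon_field
begin

text \<open>The derivative of \<open>l j * K j\<close> at a zero of \<open>l j\<close>.  In Caratheodory's form of the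
derivative, continuity of \<open>K j\<close> suffices.\<close>
lemma det2_frechet_derivative:
  assumes diff: "X differentiable (at P)" and on: "l j P = 0"
  shows "det2 (e j) (frechet_derivative X (at P) v) = K j P * det2 (e j) v"
proof -
  let ?D = "frechet_derivative X (at P)"
  have D: "(X has_derivative ?D) (at (P + 0 *\<^sub>R v))"
    using iffD1[OF frechet_derivative_works diff] by simp
  have "((\<lambda>t. P + t *\<^sub>R v) has_derivative (\<lambda>t. t *\<^sub>R v)) (at 0)"
    by (auto intro!: derivative_eq_intros)
  then have "((\<lambda>t. X (P + t *\<^sub>R v)) has_derivative (\<lambda>t. ?D (t *\<^sub>R v))) (at 0)"
    using has_derivative_compose[of "\<lambda>t. P + t *\<^sub>R v" _ 0 UNIV X ?D] D by simp
  moreover have "linear ?D" using D has_derivative_linear by blast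
  ultimately have "((\<lambda>t. X (P + t *\<^sub>R v)) has_vector_derivative ?D v) (at 0)"
    by (simp add: has_vector_derivative_def linear_scale)
  then have "((\<lambda>t. det2 (e j) (X (P + t *\<^sub>R v))) has_vector_derivative det2 (e j) (?D v)) (at 0)"
    by (rule det2_has_vector_derivative)
  then have 1: "DERIV (\<lambda>t. det2 (e j) (X (P + t *\<^sub>R v))) 0 :> det2 (e j) (?D v)"
    by (simp add: has_real_derivative_iff_has_vector_derivative)
  define h where "h = (\<lambda>t. det2 (e j) v * K j (P + t *\<^sub>R v))"
  have "l j (P + t *\<^sub>R v) = t * det2 (e j) v" for t
    using on by (simp add: l_def)
  then have eq: "det2 (e j) (X (P + t *\<^sub>R v)) = h t * t" for t
    by (simp add: cofactor h_def)
  moreover have "isCont h 0"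
  proof -
    have "continuous_on UNIV h" unfolding h_def
      by (intro continuous_intros continuous_on_compose2[OF cont_K]) auto
    then show ?thesis by (simp add: continuous_on_eq_continuous_at)
  qed
  ultimately have 2: "DERIV (\<lambda>t. det2 (e j) (X (P + t *\<^sub>R v))) 0 :> h 0"
    unfolding CARAT_DERIV using eq eq[of 0] by (intro exI[of _ h]) simp
  show ?thesis using DERIV_unique[OF 1 2] by (simp add: h_def)
qed

text \<open>The derivative multiplies the two independent functionals \<open>det2 (e i)\<close> and \<open>det2 (e (Suc i))\<close> by the cofactors, so
these are its eigenvalues.\<close>
lemma vertex_eigenvalue_iff:
  assumes diff: "X differentiable (at (p (Suc i)))"
  shows "jacobian_eigenvalue X (p (Suc i)) m \<longleftrightarrow> m = K i (p (Suc i)) \<or> m = K (Suc i) (p (Suc i))"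
proof -
  let ?P = "p (Suc i)" and ?D = "frechet_derivative X (at (p (Suc i)))"
  have det: "det2 (e i) (e (Suc i)) \<noteq> 0" using d_pos[of i] by (simp add: d_def)
  have 1: "det2 (e i) (?D v) = K i ?P * det2 (e i) v" for v
    by (rule det2_frechet_derivative[OF diff]) simp
  have 2: "det2 (e (Suc i)) (?D v) = K (Suc i) ?P * det2 (e (Suc i)) v" for v
    by (rule det2_frechet_derivative[OF diff]) simp
  show ?thesis
  proof
    assume "jacobian_eigenvalue X ?P m"
    then obtain v where v: "v \<noteq> 0" "?D v = m *\<^sub>R v" by (auto simp: jacobian_eigenvalue_def)
    then have "(m - K i ?P) * det2 (e i) v = 0" "(m - K (Suc i) ?P) * det2 (e (Suc i)) v = 0"
      using 1[of v] 2[of v] by (simp_all add: algebra_simps)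
    then show "m = K i ?P \<or> m = K (Suc i) ?P"
      using det2_eq_zero[OF det, of v] v(1) by auto
  next
    have "?D (e (Suc i)) - K i ?P *\<^sub>R e (Suc i) = 0"
      by (rule det2_eq_zero[OF det]) (simp_all add: 1 2)
    then have "jacobian_eigenvalue X ?P (K i ?P)"
      unfolding jacobian_eigenvalue_def using e_nonzero by (intro exI[of _ "e (Suc i)"]) simp
    moreover have "?D (e i) - K (Suc i) ?P *\<^sub>R e i = 0"
      by (rule det2_eq_zero[OF det]) (simp_all add: 1 2)
    then have "jacobian_eigenvalue X ?P (K (Suc i) ?P)"
      unfolding jacobian_eigenvalue_def using e_nonzero by (intro exI[of _ "e i"]) simp
    moreover assume "m = K i ?P \<or> m = K (Suc i) ?P"
    ultimately show "jacobian_eigenvalue X ?P m" by blast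
  qed
qed

lemma vertex_saddle:
  assumes diff: "X differentiable (at (p (Suc i)))"
  shows "hyperbolic_saddle X (p (Suc i))"
    "hyperbolicity_ratio X (p (Suc i)) = - K (Suc i) (p (Suc i)) / K i (p (Suc i))"
proof -
  note iff = vertex_eigenvalue_iff[OF diff]
  show "hyperbolic_saddle X (p (Suc i))"
    unfolding hyperbolic_saddle_def iff using X_vertex diff K_pos[of i] K_neg[of i] by auto
  have "(THE m. m < 0 \<and> jacobian_eigenvalue X (p (Suc i)) m) = K (Suc i) (p (Suc i))"
    unfolding iff by (rule the_equality) (use K_pos[of i] K_neg[of i] in auto)
  moreover have "(THE m. m > 0 \<and> jacobian_eigenvalue X (p (Suc i)) m) = K i (p (Suc i))"
    unfolding iff by (rule the_equality) (use K_pos[of i] K_neg[of i] in auto)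
  ultimately show "hyperbolicity_ratio X (p (Suc i)) = - K (Suc i) (p (Suc i)) / K i (p (Suc i))"
    unfolding hyperbolicity_ratio_def using K_neg[of i] by simp
qed

end

section \<open>The field with prescribed ratios\<close>
lemma det2_sum: "det2 a (\<Sum>i\<in>A. f i) = (\<Sum>i\<in>A. det2 a (f i))"
  by (induction A rule: infinite_finite_induct) auto

text \<open>\<open>r i\<close> is the ratio wanted at the vertex \<open>p i\<close>, continued periodically like the vertices.\<close>
locale polygon_with_ratios = convex_polygon +
  fixes r :: "nat \<Rightarrow> real"
  assumes r_pos: "0 < r i" and r_periodic: "r (i + n) = r i"
begin

definition w :: "nat \<Rightarrow> real" where "w i = (r (Suc i) - 1) / (e i \<bullet> e i)"

text \<open>The weight \<open>C i\<close> of edge \<open>i\<close> is the affine function that is constant orthogonally to the edge and has the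
values 1 and \<open>r (Suc i)\<close> at its ends.\<close>
definition C :: "nat \<Rightarrow> real \<times> real \<Rightarrow> real" where "C i z = 1 + w i * ((z - p i) \<bullet> e i)"

definition line_poly :: "nat \<Rightarrow> real poly poly" where
  "line_poly i = affine (- snd (e i)) (fst (e i)) (snd (e i) * fst (p i) - fst (e i) * snd (p i))"

definition C_poly :: "nat \<Rightarrow> real poly poly" where
  "C_poly i = affine (w i * fst (e i)) (w i * snd (e i)) (1 - w i * (p i \<bullet> e i))"

definition component :: "(real \<times> real \<Rightarrow> real) \<Rightarrow> real poly poly" where
  "component \<pi> = (\<Sum>i<n. C_poly i * (\<Prod>j\<in>{..<n} - {i}. line_poly j) * [:[:\<pi> (e i):]:])"

definition X :: planar_vf where "X = poly_vf (component fst) (component snd)"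

definition K :: "nat \<Rightarrow> real \<times> real \<Rightarrow> real" where
  "K i z = (\<Sum>j\<in>{..<n} - {i mod n}. C j z * (\<Prod>k\<in>{..<n} - {i mod n, j}. l k z) * det2 (e i) (e j))"

lemma eval2_line_poly [simp]: "eval2 (line_poly i) z = l i z"
  by (simp add: line_poly_def l_def det2_def algebra_simps)

lemma eval2_C_poly [simp]: "eval2 (C_poly i) z = C i z"
  by (simp add: C_poly_def C_def inner_prod_def algebra_simps)

lemma degree_component: "total_degree (component \<pi>) \<le> n"
  unfolding component_def
proof (rule total_degree_sum)
  fix i assume i: "i \<in> {..<n}"
  let ?A = "\<Prod>j\<in>{..<n} - {i}. line_poly j" and ?c = "[:[:\<pi> (e i):]:]"
  have "total_degree ?A \<le> card ({..<n} - {i})"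
    unfolding line_poly_def by (rule total_degree_prod_affine) simp
  then have "total_degree ?A \<le> n - 1" using i by simp
  moreover have "total_degree (C_poly i) \<le> 1" unfolding C_poly_def by (rule total_degree_affine)
  moreover have "total_degree (C_poly i * ?A * ?c) \<le> total_degree (C_poly i) + total_degree ?A + 0"
    using total_degree_mult[of "C_poly i * ?A" ?c] total_degree_mult[of "C_poly i" ?A]
      total_degree_const[of "\<pi> (e i)"] by linarith
  ultimately show "total_degree (C_poly i * ?A * ?c) \<le> n" using n3 by linarith
qed

lemma X_eq: "X z = (\<Sum>i<n. (C i z * (\<Prod>j\<in>{..<n} - {i}. l j z)) *\<^sub>R e i)"
proof -
  have const: "eval2 [:[:c:]:] z = c" for c by (simp add: eval2_def)
  have "eval2 (component \<pi>) z = (\<Sum>i<n. (C i z * (\<Prod>j\<in>{..<n} - {i}. l j z)) * \<pi> (e i))" for \<pi>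
    by (simp only: component_def eval2_sum eval2_simps eval2_prod eval2_line_poly eval2_C_poly const)
  then show ?thesis
    by (simp add: X_def poly_vf_def prod_eq_iff fst_sum snd_sum)
qed

lemma r_mod: "r (i mod n) = r i"
proof -
  have "r (i + k * n) = r i" for i k
  proof (induction k)
    case (Suc k)
    have "r (i + Suc k * n) = r ((i + k * n) + n)" by (simp add: algebra_simps)
    then show ?case using Suc r_periodic by simp
  qed simp
  from this[of "i mod n" "i div n"] show ?thesis by (simp add: mod_div_mult_eq)
qed

lemma r_cong: "i mod n = j mod n \<Longrightarrow> r i = r j"
  using r_mod[of i] r_mod[of j] by simp

lemma C_cong: "i mod n = j mod n \<Longrightarrow> C i = C j"
  by (simp only: fun_eq_iff C_def w_def p_cong[of i j] e_cong[of i j] r_cong[OF Suc_mod_cong, of i j]) simp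

lemma C_pt: "C i (pt i u) = 1 + (r (Suc i) - 1) * u"
  using e_nonzero[of i] by (simp add: C_def pt_def w_def)

lemma C_start: "C i (p i) = 1" and C_end: "C i (p (Suc i)) = r (Suc i)"
  using C_pt[of i 0] C_pt[of i 1] by simp_all

lemma X_along:
  assumes u: "0 < u" "u < 1"
  shows "\<exists>c>0. X (pt i u) = c *\<^sub>R e i"
proof -
  define a where "a = i mod n"
  have a: "a < n" "a mod n = i mod n" using n3 by (auto simp: a_def)
  have la: "l a (pt i u) = 0" using l_cong[OF a(2)] by simp
  have zero: "(\<Prod>k\<in>{..<n} - {j}. l k (pt i u)) = 0" if "j \<in> {..<n} - {a}" for j
    using that a la by (intro prod_zero) auto
  have "X (pt i u) = (C a (pt i u) * (\<Prod>k\<in>{..<n} - {a}. l k (pt i u))) *\<^sub>R e a"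
    unfolding X_eq using a(1) by (subst sum.remove[of _ a]) (auto simp: zero)
  moreover have "0 < (\<Prod>k\<in>{..<n} - {a}. l k (pt i u))"
    using l_pt_pos[of i _ u] u a by (intro prod_pos) auto
  moreover have "0 < C a (pt i u)"
  proof -
    have "C a (pt i u) = (1 - u) + r (Suc i) * u"
      using C_pt[of i u] C_cong[OF a(2)] by (simp add: algebra_simps)
    then show ?thesis using u r_pos[of "Suc i"] by (simp add: add_pos_pos)
  qed
  ultimately show ?thesis
    using e_cong[OF a(2)] by (intro exI[of _ "C a (pt i u) * (\<Prod>k\<in>{..<n} - {a}. l k (pt i u))"]) auto
qed

lemma X_cofactor: "det2 (e i) (X z) = l i z * K i z"
proof -
  define a where "a = i mod n"
  have a: "a < n" "a mod n = i mod n" using n3 by (auto simp: a_def)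
  have "det2 (e i) (X z) = (\<Sum>j<n. C j z * (\<Prod>k\<in>{..<n} - {j}. l k z) * det2 (e i) (e j))"
    by (simp add: X_eq det2_sum)
  also have "\<dots> = (\<Sum>j\<in>{..<n} - {a}. C j z * (\<Prod>k\<in>{..<n} - {j}. l k z) * det2 (e i) (e j))"
    using a e_cong[OF a(2)] by (subst sum.remove[of _ a]) auto
  also have "\<dots> = (\<Sum>j\<in>{..<n} - {a}. l i z * (C j z * (\<Prod>k\<in>{..<n} - {a, j}. l k z) * det2 (e i) (e j)))"
  proof (rule sum.cong[OF refl])
    fix j assume j: "j \<in> {..<n} - {a}"
    have "{..<n} - {j} - {a} = {..<n} - {a, j}" by auto
    then have "(\<Prod>k\<in>{..<n} - {j}. l k z) = l a z * (\<Prod>k\<in>{..<n} - {a, j}. l k z)"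
      using prod.remove[of "{..<n} - {j}" a "\<lambda>k. l k z"] j a by simp
    then show "C j z * (\<Prod>k\<in>{..<n} - {j}. l k z) * det2 (e i) (e j)
        = l i z * (C j z * (\<Prod>k\<in>{..<n} - {a, j}. l k z) * det2 (e i) (e j))"
      using l_cong[OF a(2)] by simp
  qed
  finally show ?thesis by (simp add: K_def a_def sum_distrib_left)
qed

text \<open>At the vertex between the edges \<open>a\<close> and \<open>b\<close> a product over lines vanishes unless both \<open>a\<close> and \<open>b\<close> are omitted.
So a single summand of each cofactor survives, and these differ in the weight and in the order of the determinant.\<close>
lemma K_vertex:
  obtains M where "M > 0" "K i (p (Suc i)) = M" "K (Suc i) (p (Suc i)) = - r (Suc i) * M"
proof -
  define a b where "a = i mod n" and "b = Suc i mod n"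
  have ab: "a < n" "b < n" "a mod n = i mod n" "b mod n = Suc i mod n" "a \<noteq> b"
    using n3 Suc_mod_neq[of i] by (auto simp: a_def b_def)
  let ?P = "p (Suc i)"
  have l0: "l a ?P = 0" "l b ?P = 0"
    using l_cong[OF ab(3)] l_cong[OF ab(4)] by simp_all
  define M where "M = (\<Prod>k\<in>{..<n} - {a, b}. l k ?P)"
  have "M > 0" unfolding M_def
  proof (rule prod_pos)
    fix k assume k: "k \<in> {..<n} - {a, b}"
    have "Suc i mod n \<noteq> k mod n" using k ab by (auto simp: b_def)
    moreover have "Suc i mod n \<noteq> Suc k mod n"
      using k ab(1) by (auto simp: a_def mod_Suc split: if_splits)
    ultimately show "0 < l k ?P" by (rule l_vertex_pos)
  qed
  have CC: "C b ?P = 1" "C a ?P = r (Suc i)"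
    using C_cong[OF ab(3)] C_cong[OF ab(4)] C_start[of "Suc i"] C_end[of i] by simp_all
  have zero: "(\<Prod>k\<in>{..<n} - {c, j}. l k ?P) = 0" if "c \<in> {a, b}" "j \<notin> {a, b}" for c j
    using that ab l0 by (intro prod_zero) (auto intro: bexI[of _ a] bexI[of _ b])
  have "K i ?P = C b ?P * M * det2 (e i) (e b)"
    unfolding K_def a_def[symmetric] M_def
    using ab(1,2,5) by (subst sum.remove[of _ b]) (auto simp: zero)
  then have 1: "K i ?P = M * d i" using CC e_cong[OF ab(4)] by (simp add: d_def)
  have ba: "{..<n} - {b, a} = {..<n} - {a, b}" by auto
  have "K (Suc i) ?P = C a ?P * M * det2 (e (Suc i)) (e a)"
    unfolding K_def b_def[symmetric] M_def
    using ab(1,2,5) by (subst sum.remove[of _ a]) (auto simp: zero ba)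
  then have 2: "K (Suc i) ?P = - r (Suc i) * (M * d i)"
    using CC e_cong[OF ab(3)] det2_commute[of "e (Suc i)" "e i"] by (simp add: d_def)
  show ?thesis by (rule that[OF _ 1 2]) (use \<open>M > 0\<close> d_pos[of i] in simp)
qed

sublocale polygon_field n p X K
proof
  show "lipschitz_on_balls X" unfolding X_def by (rule poly_vf_lipschitz)
  show "det2 (e i) (X z) = l i z * K i z" for i z by (rule X_cofactor)
  show "continuous_on UNIV (K i)" for i
    unfolding K_def C_def by (intro continuous_intros)
  show "0 < K i (p (Suc i))" for i by (rule K_vertex[of i]) simp
  show "K (Suc i) (p (Suc i)) < 0" for i
    by (rule K_vertex[of i]) (use r_pos[of "Suc i"] in simp)
  show "\<exists>c>0. X (pt i u) = c *\<^sub>R e i" if "0 < u" "u < 1" for i u using that by (rule X_along)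
qed

lemma vertex_ratio:
  "hyperbolic_saddle X (p (Suc i))" "hyperbolicity_ratio X (p (Suc i)) = r (Suc i)"
proof -
  have diff: "X differentiable (at (p (Suc i)))" unfolding X_def by (rule poly_vf_differentiable)
  show "hyperbolic_saddle X (p (Suc i))" by (rule vertex_saddle[OF diff])
  obtain M where "M > 0" "K i (p (Suc i)) = M" "K (Suc i) (p (Suc i)) = - r (Suc i) * M"
    by (rule K_vertex)
  then show "hyperbolicity_ratio X (p (Suc i)) = r (Suc i)"
    unfolding vertex_saddle(2)[OF diff] by simp
qed

end

section \<open>Vertices on a parabola\<close>
lemma det2_parabola:
  "det2 ((b, b\<^sup>2) - (a, a\<^sup>2)) ((c, c\<^sup>2) - (a, a\<^sup>2)) = (b - a) * (c - a) * (c - b)"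
  by (simp add: det2_def power2_eq_square algebra_simps)

text \<open>Points of a parabola in the order of their abscissas are in convex position: the determinant of three of them is a Vandermonde
determinant, whose sign depends only on the cyclic order.  The last edge leads back from \<open>n - 1\<close> to 0.\<close>
lemma parabola_polygon:
  assumes n3: "n \<ge> 3"
  shows "convex_polygon n (\<lambda>k. (real (k mod n), (real (k mod n))\<^sup>2))"
proof
  fix i j assume ne: "j mod n \<noteq> i mod n" "j mod n \<noteq> Suc i mod n"
  define a c where "a = i mod n" and "c = j mod n"
  have ac: "a < n" "c < n" using n3 by (auto simp: a_def c_def)
  have "0 < (real (Suc i mod n) - real a) * (real c - real a) * (real c - real (Suc i mod n))"
  proof (cases "Suc a = n")
    case True
    then have b: "Suc i mod n = 0" by (simp add: a_def mod_Suc)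
    have "c \<noteq> a" "c \<noteq> 0" using ne b by (simp_all add: a_def c_def)
    then have "0 < c" "c < a" using ac True by linarith+
    then have "0 < real a * (real a - real c) * real c" by (intro mult_pos_pos) auto
    then show ?thesis unfolding b by (simp add: algebra_simps)
  next
    case False
    then have b: "Suc i mod n = Suc a" by (simp add: a_def mod_Suc)
    have "c \<noteq> a" "c \<noteq> Suc a" using ne b by (simp_all add: a_def c_def)
    then have "c < a \<or> Suc a < c" by linarith
    then have "0 < (real c - real a) * (real c - real (Suc a))"
    proof
      assume "c < a" then show ?thesis by (intro mult_neg_neg) auto
    next
      assume "Suc a < c" then show ?thesis by (intro mult_pos_pos) auto
    qed
    then show ?thesis unfolding b by simp
  qed
  then show "0 < det2 ((real (Suc i mod n), (real (Suc i mod n))\<^sup>2) - (real (i mod n), (real (i mod n))\<^sup>2))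
      ((real (j mod n), (real (j mod n))\<^sup>2) - (real (i mod n), (real (i mod n))\<^sup>2))"
    unfolding det2_parabola a_def c_def .
qed (use n3 in auto)

theorem proposition9:
  fixes n :: nat and r :: "nat \<Rightarrow> real"
  assumes "n \<ge> 3"
    and "\<And>i. i \<in> {1..n} \<Longrightarrow> r i > 0"
  shows "\<exists>(P :: real poly poly) (Q :: real poly poly) \<Gamma> p L.
    vf_degree P Q \<le> n \<and>
    polycycle (poly_vf P Q) n \<Gamma> p L \<and>
    inj_on p {1..n} \<and>
    (\<forall>i\<in>{1..n}. hyperbolic_saddle (poly_vf P Q) (p i) \<and>
       hyperbolicity_ratio (poly_vf P Q) (p i) = r i)"
proof -
  define p where "p = (\<lambda>k. (real (k mod n), (real (k mod n))\<^sup>2))"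
  \<comment> \<open>The indices of the ratios are \<open>{1..n}\<close>, and \<open>p n = p 0\<close>.\<close>
  define \<rho> where "\<rho> = (\<lambda>k. r (if k mod n = 0 then n else k mod n))"
  have "convex_polygon n p" unfolding p_def by (rule parabola_polygon[OF assms(1)])
  moreover have "0 < \<rho> i" for i
    unfolding \<rho>_def using assms by (intro assms(2)) (auto simp: less_imp_le)
  ultimately interpret polygon_with_ratios n p \<rho>
    by (intro polygon_with_ratios.intro polygon_with_ratios_axioms.intro) (auto simp: \<rho>_def)
  have \<rho>: "\<rho> i = r i" if "i \<in> {1..n}" for i
    using that by (cases "i = n") (auto simp: \<rho>_def)
  have saddle: "hyperbolic_saddle X (p i)" "hyperbolicity_ratio X (p i) = r i" if "i \<in> {1..n}" for i
    using vertex_ratio[of "i - 1"] \<rho>[OF that] that by auto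
  have "vf_degree (component fst) (component snd) \<le> n"
    using degree_component by (simp add: vf_degree_def)
  moreover have "polycycle X n \<Gamma> p (\<lambda>i. pt (i - 1) ` {0<..<1})"
    unfolding polycycle_def using polygon_graphic polygon_first_return_map by blast
  moreover have "inj_on p {1..n}"
  proof (rule inj_onI)
    fix i j assume ij: "i \<in> {1..n}" "j \<in> {1..n}" "p i = p j"
    then have "i mod n = j mod n" using inj_vertex by blast
    then show "i = j" using ij by (cases "i = n"; cases "j = n") auto
  qed
  ultimately show ?thesis
    using saddle unfolding X_def by blast
qed

end
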